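(* Let $M$ be a smooth manifold. Let $\mathcal{B}$ have as objects the bundle gerbes on $M$, as 1-arrows $P\to Q$ the bundle gerbe morphisms $\bar f:P\to Q$ over $\mathrm{id}_M$, and as 2-arrows $\bar f_1\Rightarrow\bar f_2$ the transformations of bundle gerbe morphisms, with the vertical composition of 2-arrows, the composition of 1-arrows and the horizontal composition of 2-arrows described in the context. Then $\mathcal{B}$ is a (strict) 2-category.
   Context: For a smooth surjection $\pi:X\to M$ admitting local sections, $X^{[p]}$ denotes the $p$-fold fibre product of $X$ over $M$ and $\pi_i:X^{[p]}\to X^{[p-1]}$ omits the $i$-th factor. $\mathbb{C}^\times$ bundles are principal; $\otimes$ is the contracted product. A bundle gerbe $(P,X,M)$ consists of such a surjection $\pi:X\to M$ and a $\mathbb{C}^\times$ bundle $P\to X^{[2]}$ with a product, i.e. an isomorphism of $\mathbb{C}^\times$ bundles over $X^{[3]}$ given fibrewise by $m_P:P_{(x_2,x_3)}\otimes P_{(x_1,x_2)}\to P_{(x_1,x_3)}$, which is associative over $X^{[4]}$. It then has a canonical identity section $e(x)\in P_{(x,x)}$ and an inverse $p\mapsto p^{-1}$, $P_{(x_1,x_2)}\to P_{(x_2,x_1)}$. A bundle gerbe morphism $\bar f=(\hat f,f,\mathrm{id}_M):(P,X,M)\to(Q,Y,M)$ consists of a smooth map $f:X\to Y$ over $M$ and a $\mathbb{C}^\times$ bundle map $\hat f:P\to Q$ covering $f^{[2]}:X^{[2]}\to Y^{[2]}$ and commuting with the bundle gerbe products. Bundle gerbe morphisms are composed in the evident way. Given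 bundle gerbe morphisms $\bar f_1,\bar f_2:P\to Q$, the $\mathbb{C}^\times$ bundle $(f_1,f_2)^{-1}Q$ on $X$ (with fibre $Q_{(f_1(x),f_2(x))}$ at $x$) descends to a $\mathbb{C}^\times$ bundle $D_{\bar f_1,\bar f_2}$ on $M$ by means of the descent isomorphism $Q_{(f_1(x_2),f_2(x_2))}\to Q_{(f_1(x_1),f_2(x_1))}$, $\xi\mapsto \hat f_2(p)^{-1}\,\xi\,\hat f_1(p)$ for any $p\in P_{(x_1,x_2)}$ (juxtaposition is $m_Q$). A transformation $\theta:\bar f_1\Rightarrow\bar f_2$ is a section of $D_{\bar f_1,\bar f_2}$; equivalently, a section $\hat\theta$ of $(f_1,f_2)^{-1}Q$ compatible with the descent isomorphism. Vertical composition of $\theta:\bar f_1\Rightarrow\bar f_2$ and $\theta':\bar f_2\Rightarrow\bar f_3$ is tensor product under the isomorphism $D_{\bar f_2,\bar f_3}\otimes D_{\bar f_1,\bar f_2}\cong D_{\bar f_1,\bar f_3}$ induced by $m_Q$, i.e. $x\mapsto m_Q(\hat\theta'(x)\otimes\hat\theta(x))$. For $\theta:\bar f_1\Rightarrow\bar f_2:P\to Q$ and $\rho:\bar g_1\Rightarrow\bar g_2:Q\to R$ the horizontal composite $\rho\circ\theta:\bar g_1\circ\bar f_1\Rightarrow\bar g_2\circ\bar f_2$ is tensor product under the isomorphism $D_{\bar g_1\circ\bar f_1,\bar g_2\circ\bar f_2}\cong D_{\bar f_1,\bar f_2}\otimes D_{\bar g_1,\bar g_2}$, i.e. $x\mapsto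 m_R(\hat g_2(\hat\theta(x))\otimes\hat\rho(f_1(x)))$. A 2-category is a bicategory in which composition is strictly associative and the left and right identity isomorphisms are identities. *)

theory Defs
  imports "HOL-Analysis.Analysis"
begin

text \<open>
  Euclidean n-space is the library's \<open>Euclidean_space n\<close>: sequences of reals vanishing from index
  n on, so that the dimension is a number and not a type. On an open set U, a real function is of
  class C-k if all its partial derivatives of order at most k exist and are continuous.
  The curve \<open>t \<mapsto> x(i := t)\<close> stays in U for t near \<open>x i\<close> whenever \<open>i < n\<close>.
\<close>

fun Ck_on :: "nat \<Rightarrow> nat \<Rightarrow> (nat \<Rightarrow> real) set \<Rightarrow> ((nat \<Rightarrow> real) \<Rightarrow> real) \<Rightarrow> bool" where
  "Ck_on 0 n U f \<longleftrightarrow> continuous_map (subtopology (Euclidean_space n) U) euclideanreal f"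
| "Ck_on (Suc k) n U f \<longleftrightarrow>
     continuous_map (subtopology (Euclidean_space n) U) euclideanreal f \<and>
     (\<forall>i<n. \<exists>f'. (\<forall>x\<in>U. ((\<lambda>t. f (x(i := t))) has_real_derivative f' x) (at (x i))) \<and>
                 Ck_on k n U f')"

definition Cinf_on :: "nat \<Rightarrow> nat \<Rightarrow> (nat \<Rightarrow> real) set \<Rightarrow> ((nat \<Rightarrow> real) \<Rightarrow> (nat \<Rightarrow> real)) \<Rightarrow> bool" where
  "Cinf_on n m U F \<longleftrightarrow>
     F ` U \<subseteq> topspace (Euclidean_space m) \<and> (\<forall>j<m. \<forall>k. Ck_on k n U (\<lambda>x. F x j))"

record 'a mfd =
  mtop :: "'a topology"
  mdim :: nat
  atlas :: "('a set \<times> ('a \<Rightarrow> (nat \<Rightarrow> real))) set"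

abbreviation pts :: "'a mfd \<Rightarrow> 'a set" where
  "pts X \<equiv> topspace (mtop X)"

definition is_chart :: "'a topology \<Rightarrow> nat \<Rightarrow> 'a set \<times> ('a \<Rightarrow> (nat \<Rightarrow> real)) \<Rightarrow> bool" where
  "is_chart T n = (\<lambda>(U, \<phi>).
     openin T U \<and> openin (Euclidean_space n) (\<phi> ` U) \<and>
     homeomorphic_map (subtopology T U) (subtopology (Euclidean_space n) (\<phi> ` U)) \<phi>)"

definition smooth_transition ::
    "nat \<Rightarrow> 'a set \<times> ('a \<Rightarrow> (nat \<Rightarrow> real)) \<Rightarrow> 'a set \<times> ('a \<Rightarrow> (nat \<Rightarrow> real)) \<Rightarrow> bool" where
  "smooth_transition n = (\<lambda>(U, \<phi>) (V, \<psi>). Cinf_on n n (\<phi> ` (U \<inter> V)) (\<psi> \<circ> inv_into U \<phi>))"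

definition compatible_charts ::
    "'a topology \<Rightarrow> nat \<Rightarrow> ('a set \<times> ('a \<Rightarrow> (nat \<Rightarrow> real))) set \<Rightarrow>
     ('a set \<times> ('a \<Rightarrow> (nat \<Rightarrow> real))) set" where
  "compatible_charts T n A =
     {c. is_chart T n c \<and> (\<forall>d\<in>A. smooth_transition n c d \<and> smooth_transition n d c)}"

text \<open>
  The last conjunct says three things at once: the elements of the atlas are charts, any two of them
  are smoothly compatible, and the atlas is maximal.
\<close>

definition smooth_manifold :: "'a mfd \<Rightarrow> bool" where
  "smooth_manifold X \<longleftrightarrow>
     Hausdorff_space (mtop X) \<and> second_countable (mtop X) \<and>
     (\<Union>(U, \<phi>)\<in>atlas X. U) = pts X \<and>
     atlas X = compatible_charts (mtop X) (mdim X) (atlas X)"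

definition smooth_on_open :: "'a mfd \<Rightarrow> 'a set \<Rightarrow> 'b mfd \<Rightarrow> ('a \<Rightarrow> 'b) \<Rightarrow> bool" where
  "smooth_on_open X W Y F \<longleftrightarrow>
     openin (mtop X) W \<and> F ` W \<subseteq> pts Y \<and>
     (\<forall>a\<in>W. \<exists>(U, \<phi>)\<in>atlas X. \<exists>(V, \<psi>)\<in>atlas Y.
        a \<in> U \<and> U \<subseteq> W \<and> F ` U \<subseteq> V \<and>
        Cinf_on (mdim X) (mdim Y) (\<phi> ` U) (\<psi> \<circ> F \<circ> inv_into U \<phi>))"

text \<open>
  A map on an arbitrary subset A of a manifold is smooth if near each point of A it is the
  restriction of a smooth map on an open set. If A is an embedded submanifold (for instance a fibre
  product inside a product, when the projection is a submersion), these are the smooth maps for the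
  submanifold structure; a map into an embedded submanifold is smooth iff it is smooth into the
  ambient manifold.
\<close>

definition smooth_map :: "'a mfd \<Rightarrow> 'a set \<Rightarrow> 'b mfd \<Rightarrow> ('a \<Rightarrow> 'b) \<Rightarrow> bool" where
  "smooth_map X A Y F \<longleftrightarrow>
     A \<subseteq> pts X \<and> F ` A \<subseteq> pts Y \<and>
     (\<forall>a\<in>A. \<exists>W G. a \<in> W \<and> smooth_on_open X W Y G \<and> (\<forall>x\<in>A \<inter> W. F x = G x))"

definition diffeo :: "'a mfd \<Rightarrow> 'a set \<Rightarrow> 'b mfd \<Rightarrow> 'b set \<Rightarrow> ('a \<Rightarrow> 'b) \<Rightarrow> bool" where
  "diffeo X A Y B F \<longleftrightarrow>
     bij_betw F A B \<and> smooth_map X A Y F \<and> smooth_map Y B X (inv_into A F)"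

definition prod_chart ::
    "nat \<Rightarrow> 'a set \<times> ('a \<Rightarrow> (nat \<Rightarrow> real)) \<Rightarrow> 'b set \<times> ('b \<Rightarrow> (nat \<Rightarrow> real)) \<Rightarrow>
     ('a \<times> 'b) set \<times> ('a \<times> 'b \<Rightarrow> (nat \<Rightarrow> real))" where
  "prod_chart n = (\<lambda>(U, \<phi>) (V, \<psi>).
     (U \<times> V, \<lambda>(a, b) i. if i < n then \<phi> a i else \<psi> b (i - n)))"

definition prod_mfd :: "'a mfd \<Rightarrow> 'b mfd \<Rightarrow> ('a \<times> 'b) mfd" where
  "prod_mfd X Y =
     \<lparr>mtop = prod_topology (mtop X) (mtop Y), mdim = mdim X + mdim Y,
      atlas = compatible_charts (prod_topology (mtop X) (mtop Y)) (mdim X + mdim Y)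
                {prod_chart (mdim X) c d |c d. c \<in> atlas X \<and> d \<in> atlas Y}\<rparr>"

definition Cstar :: "complex mfd" where
  "Cstar =
     \<lparr>mtop = top_of_set (- {0}), mdim = 2,
      atlas = compatible_charts (top_of_set (- {0})) 2
                {(- {0}, \<lambda>z i. if i = 0 then Re z else if i = 1 then Im z else 0)}\<rparr>"

text \<open>
  The base is a subset B of a manifold N, so as to cover bundles over fibre products. The map
  \<open>\<tau>\<close> is a local trivialisation.
\<close>

definition Cstar_bundle ::
    "'b mfd \<Rightarrow> 'b set \<Rightarrow> 'p mfd \<Rightarrow> ('p \<Rightarrow> 'b) \<Rightarrow> ('p \<Rightarrow> complex \<Rightarrow> 'p) \<Rightarrow> bool" where
  "Cstar_bundle N B P q r \<longleftrightarrow>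
     smooth_manifold P \<and> smooth_map P (pts P) N q \<and> q ` pts P = B \<and>
     smooth_map (prod_mfd P Cstar) (pts P \<times> (- {0})) P (\<lambda>(p, z). r p z) \<and>
     (\<forall>p\<in>pts P. r p 1 = p) \<and>
     (\<forall>p\<in>pts P. \<forall>z. \<forall>w. z \<noteq> 0 \<longrightarrow> w \<noteq> 0 \<longrightarrow> r (r p z) w = r p (z * w)) \<and>
     (\<forall>p\<in>pts P. \<forall>z. z \<noteq> 0 \<longrightarrow> q (r p z) = q p) \<and>
     (\<forall>b\<in>B. \<exists>W \<tau>. openin (subtopology (mtop N) B) W \<and> b \<in> W \<and>
        diffeo P {p\<in>pts P. q p \<in> W} (prod_mfd N Cstar) (W \<times> (- {0})) \<tau> \<and>
        (\<forall>p\<in>pts P. q p \<in> W \<longrightarrow> fst (\<tau> p) = q p \<and>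
           (\<forall>z. z \<noteq> 0 \<longrightarrow> snd (\<tau> (r p z)) = snd (\<tau> p) * z)))"

record ('m, 'x, 'p) gerbe =
  gX :: "'x mfd"
  gpi :: "'x \<Rightarrow> 'm"
  gP :: "'p mfd"
  gq :: "'p \<Rightarrow> 'x \<times> 'x"
  gact :: "'p \<Rightarrow> complex \<Rightarrow> 'p"
  gmul :: "'p \<Rightarrow> 'p \<Rightarrow> 'p"

text \<open>
  A local section is asked for near every point of M, not through every point of X; the bundle
  gerbes whose projection is a submersion are a special case.
\<close>

definition admits_local_sections :: "'x mfd \<Rightarrow> 'm mfd \<Rightarrow> ('x \<Rightarrow> 'm) \<Rightarrow> bool" where
  "admits_local_sections X M \<pi> \<longleftrightarrow>
     (\<forall>m\<in>pts M. \<exists>U s. openin (mtop M) U \<and> m \<in> U \<and> smooth_map M U X s \<and> (\<forall>u\<in>U. \<pi> (s u) = u))"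

definition fibre_square :: "('m, 'x, 'p) gerbe \<Rightarrow> ('x \<times> 'x) set" where
  "fibre_square P = {(x1, x2). x1 \<in> pts (gX P) \<and> x2 \<in> pts (gX P) \<and> gpi P x1 = gpi P x2}"

definition gfibre :: "('m, 'x, 'p) gerbe \<Rightarrow> 'x \<Rightarrow> 'x \<Rightarrow> 'p set" where
  "gfibre P x1 x2 = {p \<in> pts (gP P). gq P p = (x1, x2)}"

text \<open>
  Pairs (p, q) that can be multiplied: p lies over (x2, x3) and q over (x1, x2).
\<close>

definition composable :: "('m, 'x, 'p) gerbe \<Rightarrow> ('p \<times> 'p) set" where
  "composable P = {(p, q). \<exists>x1 x2 x3. p \<in> gfibre P x2 x3 \<and> q \<in> gfibre P x1 x2}"

text \<open>
  The product is an isomorphism out of the contracted product of two pullbacks of P to the threefold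
  fibre product. Such a map is the same thing as a smooth, fibre-preserving map on composable pairs
  that is equivariant in both arguments, and every bundle map over the identity is an isomorphism.
\<close>

definition bundle_gerbe :: "'m mfd \<Rightarrow> ('m, 'x, 'p) gerbe \<Rightarrow> bool" where
  "bundle_gerbe M P \<longleftrightarrow>
     smooth_manifold (gX P) \<and>
     smooth_map (gX P) (pts (gX P)) M (gpi P) \<and>
     gpi P ` pts (gX P) = pts M \<and>
     admits_local_sections (gX P) M (gpi P) \<and>
     Cstar_bundle (prod_mfd (gX P) (gX P)) (fibre_square P) (gP P) (gq P) (gact P) \<and>
     smooth_map (prod_mfd (gP P) (gP P)) (composable P) (gP P) (\<lambda>(p, q). gmul P p q) \<and>
     (\<forall>x1 x2 x3. \<forall>p\<in>gfibre P x2 x3. \<forall>q\<in>gfibre P x1 x2.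
        gmul P p q \<in> gfibre P x1 x3 \<and>
        (\<forall>z w. z \<noteq> 0 \<longrightarrow> w \<noteq> 0 \<longrightarrow>
           gmul P (gact P p z) (gact P q w) = gact P (gmul P p q) (z * w))) \<and>
     (\<forall>x1 x2 x3 x4. \<forall>p\<in>gfibre P x3 x4. \<forall>q\<in>gfibre P x2 x3. \<forall>r\<in>gfibre P x1 x2.
        gmul P (gmul P p q) r = gmul P p (gmul P q r))"

definition gunit :: "('m, 'x, 'p) gerbe \<Rightarrow> 'x \<Rightarrow> 'p" where
  "gunit P x = (THE e. e \<in> gfibre P x x \<and>
     (\<forall>y. (\<forall>p\<in>gfibre P y x. gmul P e p = p) \<and> (\<forall>p\<in>gfibre P x y. gmul P p e = p)))"

definition ginv :: "('m, 'x, 'p) gerbe \<Rightarrow> 'p \<Rightarrow> 'p" where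
  "ginv P p = (THE p'. p' \<in> gfibre P (snd (gq P p)) (fst (gq P p)) \<and>
     gmul P p' p = gunit P (fst (gq P p)) \<and> gmul P p p' = gunit P (snd (gq P p)))"

text \<open>
  Morphisms and transformations record their source and target, and the maps they consist of are
  extensional (\<open>undefined\<close> off the manifold), so that equality in HOL is equality of morphisms.
\<close>

record ('m, 'x, 'p) gmor =
  mdom :: "('m, 'x, 'p) gerbe"
  mcod :: "('m, 'x, 'p) gerbe"
  mbase :: "'x \<Rightarrow> 'x"
  mhat :: "'p \<Rightarrow> 'p"

definition gerbe_morphism :: "('m, 'x, 'p) gmor \<Rightarrow> bool" where
  "gerbe_morphism F \<longleftrightarrow> (let P = mdom F; Q = mcod F; f = mbase F; f' = mhat F in
     f \<in> extensional (pts (gX P)) \<and> smooth_map (gX P) (pts (gX P)) (gX Q) f \<and>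
     (\<forall>x\<in>pts (gX P). gpi Q (f x) = gpi P x) \<and>
     f' \<in> extensional (pts (gP P)) \<and> smooth_map (gP P) (pts (gP P)) (gP Q) f' \<and>
     (\<forall>x1 x2. \<forall>p\<in>gfibre P x1 x2. f' p \<in> gfibre Q (f x1) (f x2)) \<and>
     (\<forall>p\<in>pts (gP P). \<forall>z. z \<noteq> 0 \<longrightarrow> f' (gact P p z) = gact Q (f' p) z) \<and>
     (\<forall>(p, q)\<in>composable P. f' (gmul P p q) = gmul Q (f' p) (f' q)))"

definition gerbe_morphisms ::
    "('m, 'x, 'p) gerbe \<Rightarrow> ('m, 'x, 'p) gerbe \<Rightarrow> ('m, 'x, 'p) gmor set" where
  "gerbe_morphisms P Q = {F. gerbe_morphism F \<and> mdom F = P \<and> mcod F = Q}"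

definition id_morphism :: "('m, 'x, 'p) gerbe \<Rightarrow> ('m, 'x, 'p) gmor" where
  "id_morphism P =
     \<lparr>mdom = P, mcod = P, mbase = restrict id (pts (gX P)), mhat = restrict id (pts (gP P))\<rparr>"

definition comp_morphism ::
    "('m, 'x, 'p) gmor \<Rightarrow> ('m, 'x, 'p) gmor \<Rightarrow> ('m, 'x, 'p) gmor" where
  "comp_morphism G F =
     \<lparr>mdom = mdom F, mcod = mcod G,
      mbase = compose (pts (gX (mdom F))) (mbase G) (mbase F),
      mhat = compose (pts (gP (mdom F))) (mhat G) (mhat F)\<rparr>"

record ('m, 'x, 'p) gtrans =
  tdom :: "('m, 'x, 'p) gmor"
  tcod :: "('m, 'x, 'p) gmor"
  tsec :: "'x \<Rightarrow> 'p"

text \<open>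
  \<open>tsec\<close> is the section over X of the pullback of Q along (f1, f2); the last conjunct is its
  compatibility with the descent isomorphism, i.e. that it comes from a section over M of the
  descended bundle.
\<close>

definition transformation :: "('m, 'x, 'p) gtrans \<Rightarrow> bool" where
  "transformation \<theta> \<longleftrightarrow>
     (let F1 = tdom \<theta>; F2 = tcod \<theta>; P = mdom F1; Q = mcod F1; s = tsec \<theta> in
     gerbe_morphism F1 \<and> gerbe_morphism F2 \<and> mdom F2 = P \<and> mcod F2 = Q \<and>
     s \<in> extensional (pts (gX P)) \<and> smooth_map (gX P) (pts (gX P)) (gP Q) s \<and>
     (\<forall>x\<in>pts (gX P). s x \<in> gfibre Q (mbase F1 x) (mbase F2 x)) \<and>
     (\<forall>x1 x2. \<forall>p\<in>gfibre P x1 x2.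
        gmul Q (gmul Q (ginv Q (mhat F2 p)) (s x2)) (mhat F1 p) = s x1))"

definition transformations ::
    "('m, 'x, 'p) gmor \<Rightarrow> ('m, 'x, 'p) gmor \<Rightarrow> ('m, 'x, 'p) gtrans set" where
  "transformations F1 F2 = {\<theta>. transformation \<theta> \<and> tdom \<theta> = F1 \<and> tcod \<theta> = F2}"

definition id_trans :: "('m, 'x, 'p) gmor \<Rightarrow> ('m, 'x, 'p) gtrans" where
  "id_trans F =
     \<lparr>tdom = F, tcod = F,
      tsec = restrict (\<lambda>x. gunit (mcod F) (mbase F x)) (pts (gX (mdom F)))\<rparr>"

definition vert_trans ::
    "('m, 'x, 'p) gtrans \<Rightarrow> ('m, 'x, 'p) gtrans \<Rightarrow> ('m, 'x, 'p) gtrans" where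
  "vert_trans \<theta>' \<theta> =
     \<lparr>tdom = tdom \<theta>, tcod = tcod \<theta>',
      tsec = restrict (\<lambda>x. gmul (mcod (tdom \<theta>)) (tsec \<theta>' x) (tsec \<theta> x))
               (pts (gX (mdom (tdom \<theta>))))\<rparr>"

definition horiz_trans ::
    "('m, 'x, 'p) gtrans \<Rightarrow> ('m, 'x, 'p) gtrans \<Rightarrow> ('m, 'x, 'p) gtrans" where
  "horiz_trans \<rho> \<theta> =
     \<lparr>tdom = comp_morphism (tdom \<rho>) (tdom \<theta>), tcod = comp_morphism (tcod \<rho>) (tcod \<theta>),
      tsec = restrict (\<lambda>x. gmul (mcod (tdom \<rho>))
                             (mhat (tcod \<rho>) (tsec \<theta> x)) (tsec \<rho> (mbase (tdom \<theta>) x)))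
               (pts (gX (mdom (tdom \<theta>))))\<rparr>"

locale category =
  fixes Ob :: "'a set"
    and Hom :: "'a \<Rightarrow> 'a \<Rightarrow> 'c set"
    and idn :: "'a \<Rightarrow> 'c"
    and cmp :: "'c \<Rightarrow> 'c \<Rightarrow> 'c"
  assumes idn_in: "f \<in> Ob \<Longrightarrow> idn f \<in> Hom f f"
    and cmp_in: "\<lbrakk>f \<in> Ob; g \<in> Ob; h \<in> Ob; \<alpha> \<in> Hom f g; \<beta> \<in> Hom g h\<rbrakk> \<Longrightarrow> cmp \<beta> \<alpha> \<in> Hom f h"
    and cmp_idn_left: "\<lbrakk>f \<in> Ob; g \<in> Ob; \<alpha> \<in> Hom f g\<rbrakk> \<Longrightarrow> cmp (idn g) \<alpha> = \<alpha>"
    and cmp_idn_right: "\<lbrakk>f \<in> Ob; g \<in> Ob; \<alpha> \<in> Hom f g\<rbrakk> \<Longrightarrow> cmp \<alpha> (idn f) = \<alpha>"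
    and cmp_assoc: "\<lbrakk>f \<in> Ob; g \<in> Ob; h \<in> Ob; k \<in> Ob; \<alpha> \<in> Hom f g; \<beta> \<in> Hom g h; \<gamma> \<in> Hom h k\<rbrakk>
       \<Longrightarrow> cmp (cmp \<gamma> \<beta>) \<alpha> = cmp \<gamma> (cmp \<beta> \<alpha>)"

definition isos ::
    "('a \<Rightarrow> 'a \<Rightarrow> 'c set) \<Rightarrow> ('a \<Rightarrow> 'c) \<Rightarrow> ('c \<Rightarrow> 'c \<Rightarrow> 'c) \<Rightarrow> 'a \<Rightarrow> 'a \<Rightarrow> 'c set" where
  "isos Hom idn cmp f g =
     {\<alpha> \<in> Hom f g. \<exists>\<beta>\<in>Hom g f. cmp \<beta> \<alpha> = idn f \<and> cmp \<alpha> \<beta> = idn g}"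

text \<open>
  \<open>Arr a b\<close> is the set of 1-arrows from a to b and \<open>Cell f g\<close> the set of 2-arrows from f to g;
  \<open>\<bullet>\<close> is vertical composition, and \<open>\<odot>\<close> and \<open>\<star>\<close> are the composition
  functor on 1-arrows and on 2-arrows (horizontal composition). The associativity constraint
  \<open>asc h g f\<close> goes from \<open>(h \<odot> g) \<odot> f\<close> to \<open>h \<odot> (g \<odot> f)\<close>.
\<close>

locale bicategory =
  fixes Obj :: "'o set"
    and Arr :: "'o \<Rightarrow> 'o \<Rightarrow> 'a set"
    and Cell :: "'a \<Rightarrow> 'a \<Rightarrow> 'c set"
    and id2 :: "'a \<Rightarrow> 'c"
    and vert :: "'c \<Rightarrow> 'c \<Rightarrow> 'c"  (infixr "\<bullet>" 55)
    and id1 :: "'o \<Rightarrow> 'a"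
    and comp1 :: "'a \<Rightarrow> 'a \<Rightarrow> 'a"  (infixr "\<odot>" 60)
    and horiz :: "'c \<Rightarrow> 'c \<Rightarrow> 'c"  (infixr "\<star>" 60)
    and asc :: "'a \<Rightarrow> 'a \<Rightarrow> 'a \<Rightarrow> 'c"
    and lun :: "'a \<Rightarrow> 'c"
    and run :: "'a \<Rightarrow> 'c"
  assumes hom_category: "\<lbrakk>a \<in> Obj; b \<in> Obj\<rbrakk> \<Longrightarrow> category (Arr a b) Cell id2 (\<bullet>)"
    and id1_in: "a \<in> Obj \<Longrightarrow> id1 a \<in> Arr a a"
    and comp1_in: "\<lbrakk>a \<in> Obj; b \<in> Obj; c \<in> Obj; f \<in> Arr a b; g \<in> Arr b c\<rbrakk> \<Longrightarrow> g \<odot> f \<in> Arr a c"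
    and horiz_in: "\<lbrakk>a \<in> Obj; b \<in> Obj; c \<in> Obj; f \<in> Arr a b; f' \<in> Arr a b; g \<in> Arr b c; g' \<in> Arr b c;
        \<alpha> \<in> Cell f f'; \<beta> \<in> Cell g g'\<rbrakk> \<Longrightarrow> \<beta> \<star> \<alpha> \<in> Cell (g \<odot> f) (g' \<odot> f')"
    and horiz_id2: "\<lbrakk>a \<in> Obj; b \<in> Obj; c \<in> Obj; f \<in> Arr a b; g \<in> Arr b c\<rbrakk>
        \<Longrightarrow> id2 g \<star> id2 f = id2 (g \<odot> f)"
    and interchange: "\<lbrakk>a \<in> Obj; b \<in> Obj; c \<in> Obj;
        f \<in> Arr a b; f' \<in> Arr a b; f'' \<in> Arr a b; g \<in> Arr b c; g' \<in> Arr b c; g'' \<in> Arr b c;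
        \<alpha> \<in> Cell f f'; \<alpha>' \<in> Cell f' f''; \<beta> \<in> Cell g g'; \<beta>' \<in> Cell g' g''\<rbrakk>
        \<Longrightarrow> (\<beta>' \<bullet> \<beta>) \<star> (\<alpha>' \<bullet> \<alpha>) = (\<beta>' \<star> \<alpha>') \<bullet> (\<beta> \<star> \<alpha>)"
    and asc_iso: "\<lbrakk>a \<in> Obj; b \<in> Obj; c \<in> Obj; d \<in> Obj; f \<in> Arr a b; g \<in> Arr b c; h \<in> Arr c d\<rbrakk>
        \<Longrightarrow> asc h g f \<in> isos Cell id2 (\<bullet>) ((h \<odot> g) \<odot> f) (h \<odot> (g \<odot> f))"
    and asc_natural: "\<lbrakk>a \<in> Obj; b \<in> Obj; c \<in> Obj; d \<in> Obj; f \<in> Arr a b; f' \<in> Arr a b;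
        g \<in> Arr b c; g' \<in> Arr b c; h \<in> Arr c d; h' \<in> Arr c d;
        \<alpha> \<in> Cell f f'; \<beta> \<in> Cell g g'; \<gamma> \<in> Cell h h'\<rbrakk>
        \<Longrightarrow> asc h' g' f' \<bullet> ((\<gamma> \<star> \<beta>) \<star> \<alpha>) = (\<gamma> \<star> (\<beta> \<star> \<alpha>)) \<bullet> asc h g f"
    and lun_iso: "\<lbrakk>a \<in> Obj; b \<in> Obj; f \<in> Arr a b\<rbrakk> \<Longrightarrow> lun f \<in> isos Cell id2 (\<bullet>) (id1 b \<odot> f) f"
    and lun_natural: "\<lbrakk>a \<in> Obj; b \<in> Obj; f \<in> Arr a b; f' \<in> Arr a b; \<alpha> \<in> Cell f f'\<rbrakk>
        \<Longrightarrow> lun f' \<bullet> (id2 (id1 b) \<star> \<alpha>) = \<alpha> \<bullet> lun f"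
    and run_iso: "\<lbrakk>a \<in> Obj; b \<in> Obj; f \<in> Arr a b\<rbrakk> \<Longrightarrow> run f \<in> isos Cell id2 (\<bullet>) (f \<odot> id1 a) f"
    and run_natural: "\<lbrakk>a \<in> Obj; b \<in> Obj; f \<in> Arr a b; f' \<in> Arr a b; \<alpha> \<in> Cell f f'\<rbrakk>
        \<Longrightarrow> run f' \<bullet> (\<alpha> \<star> id2 (id1 a)) = \<alpha> \<bullet> run f"
    and pentagon: "\<lbrakk>a \<in> Obj; b \<in> Obj; c \<in> Obj; d \<in> Obj; e \<in> Obj;
        f \<in> Arr a b; g \<in> Arr b c; h \<in> Arr c d; k \<in> Arr d e\<rbrakk>
        \<Longrightarrow> (id2 k \<star> asc h g f) \<bullet> asc k (h \<odot> g) f \<bullet> (asc k h g \<star> id2 f)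
            = asc k h (g \<odot> f) \<bullet> asc (k \<odot> h) g f"
    and triangle: "\<lbrakk>a \<in> Obj; b \<in> Obj; c \<in> Obj; f \<in> Arr a b; g \<in> Arr b c\<rbrakk>
        \<Longrightarrow> (id2 g \<star> lun f) \<bullet> asc g (id1 b) f = run g \<star> id2 f"

locale two_category = bicategory +
  assumes comp1_assoc: "\<lbrakk>a \<in> Obj; b \<in> Obj; c \<in> Obj; d \<in> Obj; f \<in> Arr a b; g \<in> Arr b c; h \<in> Arr c d\<rbrakk>
        \<Longrightarrow> (h \<odot> g) \<odot> f = h \<odot> (g \<odot> f)"
    and asc_id2: "\<lbrakk>a \<in> Obj; b \<in> Obj; c \<in> Obj; d \<in> Obj; f \<in> Arr a b; g \<in> Arr b c; h \<in> Arr c d\<rbrakk>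
        \<Longrightarrow> asc h g f = id2 ((h \<odot> g) \<odot> f)"
    and horiz_assoc: "\<lbrakk>a \<in> Obj; b \<in> Obj; c \<in> Obj; d \<in> Obj; f \<in> Arr a b; f' \<in> Arr a b;
        g \<in> Arr b c; g' \<in> Arr b c; h \<in> Arr c d; h' \<in> Arr c d;
        \<alpha> \<in> Cell f f'; \<beta> \<in> Cell g g'; \<gamma> \<in> Cell h h'\<rbrakk>
        \<Longrightarrow> (\<gamma> \<star> \<beta>) \<star> \<alpha> = \<gamma> \<star> (\<beta> \<star> \<alpha>)"
    and id1_comp1: "\<lbrakk>a \<in> Obj; b \<in> Obj; f \<in> Arr a b\<rbrakk> \<Longrightarrow> id1 b \<odot> f = f"
    and comp1_id1: "\<lbrakk>a \<in> Obj; b \<in> Obj; f \<in> Arr a b\<rbrakk> \<Longrightarrow> f \<odot> id1 a = f"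
    and lun_id2: "\<lbrakk>a \<in> Obj; b \<in> Obj; f \<in> Arr a b\<rbrakk> \<Longrightarrow> lun f = id2 f"
    and run_id2: "\<lbrakk>a \<in> Obj; b \<in> Obj; f \<in> Arr a b\<rbrakk> \<Longrightarrow> run f = id2 f"

end

theory Submission
  imports Defs
begin

text \<open>
  A bundle gerbe \<open>P\<close> is a groupoid: its objects are the points of \<open>X\<close>, its arrows from \<open>x1\<close> to \<open>x2\<close>
  are the elements of \<open>P\<close> over \<open>(x1, x2)\<close>, and its composition is the bundle gerbe product. Units
  and inverses come from the action of \<open>\<complex>\<^sup>\<times>\<close>: if \<open>p\<close> lies over \<open>(x, x)\<close>, then \<open>p p = p c\<close> for some
  number \<open>c\<close>, so that \<open>p c\<^sup>-\<^sup>1\<close> is idempotent, and as the fibres are torsors an idempotent is a unit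
  (\<open>idempotent_left\<close>, \<open>gunit_eqI\<close>, \<open>inverse_exists\<close>). Morphisms of bundle gerbes preserve products, hence
  units: they are functors. The condition that a section descends to \<open>M\<close> is the naturality square
  (\<open>descent_iff_natural\<close>), so transformations are natural transformations, and their vertical and
  horizontal compositions are the usual ones. The laws of a 2-category are then those of the
  2-category of groupoids; the only one that needs naturality is interchange (\<open>interchange_trans\<close>).
  Composition of functors is strictly associative and unital, so identities serve as associativity and
  unit constraints, and the coherence conditions reduce to identities (\<open>two_category_strictI\<close>).

  It remains to see that all these constructions are smooth. For compositions this follows from the
  fact that smooth maps are closed under composition and pairing (\<open>smooth_map_compose\<close>,
  \<open>smooth_map_Pair\<close>), which rests on the chain rule for functions with continuous partial derivatives
  (\<open>DERIV_along_curve\<close>, \<open>Ck_on_compose\<close>) and on the product charts being charts of the product manifold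
  (\<open>prod_mfd_structure\<close>). Identity transformations are smooth because the unit of a bundle gerbe is
  smooth (\<open>smooth_map_gunit\<close>): near \<open>(x, x)\<close> a local trivialisation provides a smooth \<open>p\<close> as above, with
  \<open>c\<close> a smooth function of \<open>x\<close>, and inversion of complex numbers is smooth.
\<close>

section \<open>Calculus on open subsets of Euclidean space\<close>

lemma Euclidean_space_top_of_set:
  "Euclidean_space n = top_of_set {x. \<forall>i\<ge>n. x i = 0}"
  by (simp add: Euclidean_space_def euclidean_product_topology)

lemma subtopology_Euclidean_space_eq:
  assumes "U \<subseteq> topspace (Euclidean_space n)"
  shows "subtopology (Euclidean_space n) U = top_of_set U"
  using assms unfolding Euclidean_space_top_of_set
  by (simp add: subtopology_subtopology Int_absorb1)

lemma openin_Euclidean_space_subset: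
  "openin (Euclidean_space n) U \<Longrightarrow> U \<subseteq> topspace (Euclidean_space n)"
  by (rule openin_subset)

text \<open>
  A basic open set of the product topology constrains finitely many coordinates. In Euclidean n-space
  the coordinates from n on vanish, so a cube in the first n coordinates is a neighbourhood.
\<close>

lemma openin_Euclidean_space_box:
  assumes "openin (Euclidean_space n) U" "p \<in> U"
  obtains e where "e > 0"
    "\<And>y. \<lbrakk>y \<in> topspace (Euclidean_space n); \<And>i. i < n \<Longrightarrow> \<bar>y i - p i\<bar> < e\<rbrakk> \<Longrightarrow> y \<in> U"
proof -
  obtain T where T: "open T" "U = {x. \<forall>i\<ge>n. x i = 0} \<inter> T"
    using assms(1) unfolding Euclidean_space_top_of_set openin_open by auto
  have "openin (product_topology (\<lambda>i. euclideanreal) UNIV) T"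
    using T(1) by (simp add: euclidean_product_topology)
  then obtain X where X: "p \<in> Pi\<^sub>E UNIV X" "\<And>i. open (X i)" "Pi\<^sub>E UNIV X \<subseteq> T"
    using product_topology_open_contains_basis[of "\<lambda>i. euclideanreal" UNIV T p] assms(2) T(2)
    by auto
  have "\<exists>e>0. ball (p i) e \<subseteq> X i" for i
    using X(1) X(2)[of i] by (auto simp: open_contains_ball PiE_iff)
  then obtain r where r: "\<And>i. r i > 0" "\<And>i. ball (p i) (r i) \<subseteq> X i"
    by metis
  define e where "e = Min (insert 1 (r ` {..<n}))"
  have e: "e > 0" "\<And>i. i < n \<Longrightarrow> e \<le> r i"
    using r(1) by (auto simp: e_def)
  show thesis
  proof (rule that[OF e(1)])
    fix y assume y: "y \<in> topspace (Euclidean_space n)" "\<And>i. i < n \<Longrightarrow> \<bar>y i - p i\<bar> < e"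
    have "y i \<in> X i" for i
    proof (cases "i < n")
      case True
      then have "\<bar>y i - p i\<bar> < r i" using y(2) e(2) by fastforce
      then show ?thesis using r(2)[of i] by (auto simp: dist_real_def abs_minus_commute)
    next
      case False
      then have "y i = p i" using y(1) T(2) assms(2) by (auto simp: topspace_Euclidean_space)
      then show ?thesis using X(1) by (auto simp: PiE_iff)
    qed
    then have "y \<in> T" using X(3) by (auto simp: PiE_iff)
    then show "y \<in> U" using y(1) T(2) by (auto simp: topspace_Euclidean_space)
  qed
qed

lemma eventually_coordinate_line_in_open:
  assumes "openin (Euclidean_space n) U" "x \<in> U" "i < n"
  shows "\<forall>\<^sub>F t in nhds (x i). x(i := t) \<in> U"
proof -
  obtain e where e: "e > 0"
    "\<And>y. \<lbrakk>y \<in> topspace (Euclidean_space n); \<And>i. i < n \<Longrightarrow> \<bar>y i - x i\<bar> < e\<rbrakk> \<Longrightarrow> y \<in> U"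
    using openin_Euclidean_space_box[OF assms(1,2)] by blast
  have "x \<in> topspace (Euclidean_space n)"
    using assms openin_Euclidean_space_subset by blast
  then have "x(i := t) \<in> U" if "dist t (x i) < e" for t
    using that assms(3) e(1) by (intro e(2)) (auto simp: topspace_Euclidean_space dist_real_def)
  then show ?thesis
    using e(1) by (auto simp: eventually_nhds_metric)
qed

lemma Ck_on_partialE:
  assumes "Ck_on (Suc k) n U f" "i < n"
  obtains f' where "\<And>x. x \<in> U \<Longrightarrow> ((\<lambda>t. f (x(i := t))) has_real_derivative f' x) (at (x i))"
    "Ck_on k n U f'"
  using assms unfolding Ck_on.simps by blast

lemma Ck_on_SucI:
  assumes "continuous_map (subtopology (Euclidean_space n) U) euclideanreal f"
    and "\<And>i. i < n \<Longrightarrow> \<exists>f'. (\<forall>x\<in>U. ((\<lambda>t. f (x(i := t))) has_real_derivative f' x) (at (x i))) \<and>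
           Ck_on k n U f'"
  shows "Ck_on (Suc k) n U f"
  using assms unfolding Ck_on.simps by blast

declare Ck_on.simps(2) [simp del]

lemma Ck_on_continuous:
  "Ck_on k n U f \<Longrightarrow> continuous_map (subtopology (Euclidean_space n) U) euclideanreal f"
  by (cases k) (auto simp: Ck_on.simps)

text \<open>
  Near each of its points, a coordinate line stays inside an open set, so partial derivatives on an
  open set depend only on the values there.
\<close>

lemma Ck_on_cong:
  assumes "openin (Euclidean_space n) U" "\<And>x. x \<in> U \<Longrightarrow> f x = g x" "Ck_on k n U f"
  shows "Ck_on k n U g"
proof -
  have cont: "continuous_map (subtopology (Euclidean_space n) U) euclideanreal g"
    if "continuous_map (subtopology (Euclidean_space n) U) euclideanreal f"
    by (rule continuous_map_eq[OF that]) (use assms(2) in auto)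
  show ?thesis
  proof (cases k)
    case 0
    then show ?thesis using assms cont by simp
  next
    case (Suc l)
    have "\<exists>f'. (\<forall>x\<in>U. ((\<lambda>t. g (x(i := t))) has_real_derivative f' x) (at (x i))) \<and> Ck_on l n U f'"
      if i: "i < n" for i
    proof -
      obtain f' where f': "\<And>x. x\<in>U \<Longrightarrow> ((\<lambda>t. f (x(i := t))) has_real_derivative f' x) (at (x i))"
        "Ck_on l n U f'"
        using Ck_on_partialE[OF _ i] assms(3) Suc by blast
      have "((\<lambda>t. g (x(i := t))) has_real_derivative f' x) (at (x i))" if x: "x \<in> U" for x
      proof (rule DERIV_cong_ev[THEN iffD1, OF refl _ refl f'(1)[OF x]])
        show "\<forall>\<^sub>F t in nhds (x i). f (x(i := t)) = g (x(i := t))"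
          using eventually_coordinate_line_in_open[OF assms(1) x i]
          by eventually_elim (rule assms(2))
      qed
      then show ?thesis using f'(2) by blast
    qed
    then show ?thesis
      using Ck_on_SucI Suc cont[OF Ck_on_continuous[OF assms(3)]] by blast
  qed
qed

lemma Ck_on_subset:
  "Ck_on k n U f \<Longrightarrow> V \<subseteq> U \<Longrightarrow> Ck_on k n V f"
proof (induction k arbitrary: f)
  case 0
  then show ?case by (auto intro: continuous_map_from_subtopology_mono)
next
  case (Suc k)
  have "continuous_map (subtopology (Euclidean_space n) V) euclideanreal f"
    using Ck_on_continuous[OF Suc.prems(1)] Suc.prems(2) by (rule continuous_map_from_subtopology_mono)
  moreover have "\<exists>f'. (\<forall>x\<in>V. ((\<lambda>t. f (x(i := t))) has_real_derivative f' x) (at (x i))) \<and>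
      Ck_on k n V f'" if i: "i < n" for i
    using Ck_on_partialE[OF Suc.prems(1) i] Suc.IH Suc.prems(2) by (metis subsetD)
  ultimately show ?case by (rule Ck_on_SucI)
qed

lemma Ck_on_continuous_on:
  assumes "openin (Euclidean_space n) U" "Ck_on k n U f"
  shows "continuous_on U f"
  using Ck_on_continuous[OF assms(2)] openin_Euclidean_space_subset[OF assms(1)]
  by (simp add: subtopology_Euclidean_space_eq)

lemma Ck_on_Suc_imp: "Ck_on (Suc k) n U f \<Longrightarrow> Ck_on k n U f"
proof (induction k arbitrary: f)
  case (Suc k)
  then show ?case unfolding Ck_on.simps(2)[of "Suc k"] Ck_on.simps(2)[of k] by blast
qed (simp add: Ck_on_continuous)

text \<open>
  Partial derivatives are unique, so those found on the members of an open cover agree on overlaps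
  and are all given by the global formula \<open>deriv\<close>.
\<close>

lemma Ck_on_local:
  assumes "\<And>x. x \<in> U \<Longrightarrow> \<exists>V. x \<in> V \<and> V \<subseteq> U \<and> openin (Euclidean_space n) V \<and> Ck_on k n V f"
  shows "Ck_on k n U f"
  using assms
proof (induction k arbitrary: f)
  case (0 f)
  obtain V where V: "\<And>x. x \<in> U \<Longrightarrow> x \<in> V x \<and> V x \<subseteq> U \<and> openin (Euclidean_space n) (V x) \<and> Ck_on 0 n (V x) f"
    using 0 by metis
  let ?E = "subtopology (Euclidean_space n) U"
  have "continuous_map ?E euclideanreal f"
  proof (rule pasting_lemma[where I=U and T=V and f="\<lambda>_. f"])
    fix x assume x: "x \<in> U"
    show "openin ?E (V x)"
      using V[OF x] by (auto simp: openin_subtopology_alt intro: openin_subset)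
    have "subtopology ?E (V x) = subtopology (Euclidean_space n) (V x)"
      using V[OF x] by (simp add: subtopology_subtopology Int_absorb1)
    then show "continuous_map (subtopology ?E (V x)) euclideanreal f"
      using V[OF x] by simp
  qed (use V in auto)
  then show ?case by simp
next
  case (Suc k f)
  have op: "\<exists>V. x \<in> V \<and> V \<subseteq> U \<and> openin (Euclidean_space n) V \<and> Ck_on (Suc k) n V f" if "x \<in> U" for x
    using Suc.prems that by blast
  have "Ck_on k n U f"
  proof (rule Suc.IH)
    show "\<exists>V. x \<in> V \<and> V \<subseteq> U \<and> openin (Euclidean_space n) V \<and> Ck_on k n V f" if "x \<in> U" for x
      using op[OF that] Ck_on_Suc_imp by blast
  qed
  then have cont: "continuous_map (subtopology (Euclidean_space n) U) euclideanreal f"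
    by (rule Ck_on_continuous)
  have "\<exists>f'. (\<forall>x\<in>U. ((\<lambda>t. f (x(i := t))) has_real_derivative f' x) (at (x i))) \<and> Ck_on k n U f'"
    if i: "i < n" for i
  proof -
    let ?D = "\<lambda>x. deriv (\<lambda>t. f (x(i := t))) (x i)"
    have loc: "\<exists>V f'. x \<in> V \<and> V \<subseteq> U \<and> openin (Euclidean_space n) V \<and> Ck_on k n V f' \<and>
          (\<forall>y\<in>V. ((\<lambda>t. f (y(i := t))) has_real_derivative f' y) (at (y i)))" if x: "x \<in> U" for x
    proof -
      obtain V where V: "x \<in> V" "V \<subseteq> U" "openin (Euclidean_space n) V" "Ck_on (Suc k) n V f"
        using op[OF x] by blast
      show ?thesis by (rule Ck_on_partialE[OF V(4) i]) (use V in blast)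
    qed
    have "((\<lambda>t. f (x(i := t))) has_real_derivative ?D x) (at (x i))" if x: "x \<in> U" for x
    proof -
      obtain d where "((\<lambda>t. f (x(i := t))) has_real_derivative d) (at (x i))"
        using loc[OF x] by blast
      then show ?thesis by (simp add: DERIV_imp_deriv)
    qed
    moreover have "Ck_on k n U ?D"
    proof (rule Suc.IH)
      fix x assume x: "x \<in> U"
      from loc[OF x] obtain V f' where V: "x \<in> V" "V \<subseteq> U" "openin (Euclidean_space n) V" "Ck_on k n V f'"
          "\<forall>y\<in>V. ((\<lambda>t. f (y(i := t))) has_real_derivative f' y) (at (y i))"
        by (elim exE conjE)
      have "f' y = ?D y" if "y \<in> V" for y
        using DERIV_imp_deriv[OF V(5)[rule_format, OF that]] by simp
      then have "Ck_on k n V ?D"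
        by (rule Ck_on_cong[OF V(3) _ V(4)])
      then show "\<exists>V. x \<in> V \<and> V \<subseteq> U \<and> openin (Euclidean_space n) V \<and> Ck_on k n V ?D"
        using V by blast
    qed
    ultimately show ?thesis by (intro exI[of _ ?D]) simp
  qed
  then show ?case using cont Ck_on_SucI by blast
qed

lemma Ck_on_const: "Ck_on k n U (\<lambda>x. c)"
proof (induction k arbitrary: c)
  case (Suc k)
  have "\<exists>f'. (\<forall>x\<in>U. ((\<lambda>t. c) has_real_derivative f' x) (at (x i))) \<and> Ck_on k n U f'" for i
    by (rule exI[of _ "\<lambda>x. 0"]) (use Suc in simp)
  then show ?case by (intro Ck_on_SucI) auto
qed simp

lemma Ck_on_coordinate:
  assumes "openin (Euclidean_space n) U" 
  shows "Ck_on k n U (\<lambda>x. x j)"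
proof -
  have cont: "continuous_map (subtopology (Euclidean_space n) U) euclideanreal (\<lambda>x. x j)"
    using openin_Euclidean_space_subset[OF assms]
    by (simp add: subtopology_Euclidean_space_eq continuous_on_product_coordinates continuous_on_subset[OF continuous_on_product_coordinates])
  show ?thesis
  proof (cases k)
    case (Suc l)
    have "\<exists>f'. (\<forall>x\<in>U. ((\<lambda>t. (x(i := t)) j) has_real_derivative f' x) (at (x i))) \<and>
        Ck_on l n U f'" for i
      by (rule exI[of _ "\<lambda>_. if i = j then 1 else 0"]) (cases "i = j"; simp add: Ck_on_const)
    then show ?thesis unfolding Suc by (intro Ck_on_SucI cont)
  qed (use cont in simp)
qed

lemma Ck_on_add:
  "Ck_on k n U f \<Longrightarrow> Ck_on k n U g \<Longrightarrow> Ck_on k n U (\<lambda>x. f x + g x)"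
proof (induction k arbitrary: f g)
  case 0
  then show ?case by (auto intro: continuous_map_add)
next
  case (Suc k)
  have "\<exists>f'. (\<forall>x\<in>U. ((\<lambda>t. f (x(i := t)) + g (x(i := t))) has_real_derivative f' x) (at (x i))) \<and>
             Ck_on k n U f'" if i: "i < n" for i
  proof -
    obtain f' where d:
       "\<And>x. x \<in> U \<Longrightarrow> ((\<lambda>t. f (x(i := t))) has_real_derivative f' x) (at (x i))" "Ck_on k n U f'"
      using Ck_on_partialE[OF Suc.prems(1) i] by blast
    obtain g' where
       "\<And>x. x \<in> U \<Longrightarrow> ((\<lambda>t. g (x(i := t))) has_real_derivative g' x) (at (x i))" "Ck_on k n U g'"
      using Ck_on_partialE[OF Suc.prems(2) i] by blast
    note d = d this
    show ?thesis
      by (intro exI[of _ "\<lambda>x. f' x + g' x"] conjI ballI DERIV_add Suc.IH d)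
  qed
  then show ?case
    by (intro Ck_on_SucI continuous_map_add Ck_on_continuous[OF Suc.prems(1)]
        Ck_on_continuous[OF Suc.prems(2)])
qed

lemma Ck_on_mult:
  "Ck_on k n U f \<Longrightarrow> Ck_on k n U g \<Longrightarrow> Ck_on k n U (\<lambda>x. f x * g x)"
proof (induction k arbitrary: f g)
  case 0
  then show ?case by (auto intro: continuous_map_real_mult)
next
  case (Suc k)
  have "\<exists>f'. (\<forall>x\<in>U. ((\<lambda>t. f (x(i := t)) * g (x(i := t))) has_real_derivative f' x) (at (x i))) \<and>
             Ck_on k n U f'" if i: "i < n" for i
  proof -
    obtain f' where d:
       "\<And>x. x \<in> U \<Longrightarrow> ((\<lambda>t. f (x(i := t))) has_real_derivative f' x) (at (x i))" "Ck_on k n U f'"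
      using Ck_on_partialE[OF Suc.prems(1) i] by blast
    obtain g' where
       "\<And>x. x \<in> U \<Longrightarrow> ((\<lambda>t. g (x(i := t))) has_real_derivative g' x) (at (x i))" "Ck_on k n U g'"
      using Ck_on_partialE[OF Suc.prems(2) i] by blast
    note d = d this
    have "Ck_on k n U (\<lambda>x. f' x * g x + g' x * f x)"
      using d Suc.prems[THEN Ck_on_Suc_imp] by (intro Ck_on_add Suc.IH)
    moreover have "((\<lambda>t. f (x(i := t)) * g (x(i := t))) has_real_derivative f' x * g x + g' x * f x) (at (x i))"
      if "x \<in> U" for x
      using DERIV_mult[OF d(1)[OF that] d(3)[OF that]] by simp
    ultimately show ?thesis
      by (intro exI[of _ "\<lambda>x. f' x * g x + g' x * f x"]) simp
  qed
  then show ?case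
    by (intro Ck_on_SucI continuous_map_real_mult Ck_on_continuous[OF Suc.prems(1)]
        Ck_on_continuous[OF Suc.prems(2)])
qed

lemma Ck_on_sum:
  "finite I \<Longrightarrow> (\<And>i. i \<in> I \<Longrightarrow> Ck_on k n U (f i)) \<Longrightarrow> Ck_on k n U (\<lambda>x. \<Sum>i\<in>I. f i x)"
  by (induction I rule: finite_induct) (auto intro: Ck_on_const Ck_on_add)

text \<open>
  The partial derivatives of \<open>1/f\<close> are \<open>-(1/f) f' (1/f)\<close>; this product is of the class that the
  induction hypothesis provides for its factors \<open>1/f\<close>.
\<close>

lemma Ck_on_inverse:
  assumes "\<And>x. x \<in> U \<Longrightarrow> f x \<noteq> 0"
  shows "Ck_on k n U f \<Longrightarrow> Ck_on k n U (\<lambda>x. inverse (f x))"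
proof (induction k)
  case 0
  then show ?case using assms by (auto intro!: continuous_map_real_inverse)
next
  case (Suc k)
  note IH = Suc.IH[OF Ck_on_Suc_imp[OF Suc.prems]]
  have "\<exists>f'. (\<forall>x\<in>U. ((\<lambda>t. inverse (f (x(i := t)))) has_real_derivative f' x) (at (x i))) \<and>
             Ck_on k n U f'" if i: "i < n" for i
  proof -
    obtain f' where d:
       "\<And>x. x \<in> U \<Longrightarrow> ((\<lambda>t. f (x(i := t))) has_real_derivative f' x) (at (x i))" "Ck_on k n U f'"
      using Ck_on_partialE[OF Suc.prems(1) i] by blast
    let ?g = "\<lambda>x. - 1 * (inverse (f x) * f' x * inverse (f x))"
    have "Ck_on k n U ?g"
      using d IH by (intro Ck_on_mult Ck_on_const)
    moreover have "((\<lambda>t. inverse (f (x(i := t)))) has_real_derivative ?g x) (at (x i))"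
      if "x \<in> U" for x
      using DERIV_inverse'[OF d(1)[OF that]] assms[OF that] by simp
    ultimately show ?thesis by (intro exI[of _ ?g]) simp
  qed
  moreover have "continuous_map (subtopology (Euclidean_space n) U) euclideanreal (\<lambda>x. inverse (f x))"
    using Ck_on_continuous[OF Suc.prems] assms by (auto intro!: continuous_map_real_inverse)
  ultimately show ?case by (intro Ck_on_SucI)
qed

lemma mean_value_between:
  fixes h h' :: "real \<Rightarrow> real"
  assumes "\<And>u. \<bar>u - a\<bar> \<le> \<bar>b - a\<bar> \<Longrightarrow> (h has_real_derivative h' u) (at u)"
  obtains u where "\<bar>u - a\<bar> \<le> \<bar>b - a\<bar>" "h b - h a = h' u * (b - a)"
proof -
  consider "a = b" | "a < b" | "b < a" by linarith
  then show thesis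
  proof cases
    case 1 then show thesis by (intro that[of a]) auto
  next
    case 2
    have "\<exists>u. a < u \<and> u < b \<and> h b - h a = (b - a) * h' u"
      by (rule MVT2[OF 2]) (use assms in auto)
    then obtain u where "a < u" "u < b" "h b - h a = (b - a) * h' u" by blast
    then show thesis by (intro that[of u]) auto
  next
    case 3
    have "\<exists>u. b < u \<and> u < a \<and> h a - h b = (a - b) * h' u"
      by (rule MVT2[OF 3]) (use assms in auto)
    then obtain u where "b < u" "u < a" "h a - h b = (a - b) * h' u" by blast
    then show thesis by (intro that[of u]) (auto simp: algebra_simps)
  qed
qed

text \<open>
  A function with continuous partial derivatives can be differentiated along a curve. Replace the
  base point by the moving point one coordinate at a time: the step in coordinate \<open>j\<close> is, by the mean
  value theorem, \<open>\<partial>\<^sub>j f\<close> at an intermediate point times the increment of \<open>\<gamma> j\<close>, and the intermediate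
  points converge to the base point.
\<close>

lemma DERIV_along_curve:
  assumes V: "openin (Euclidean_space m) V" and p: "\<gamma> t0 \<in> V"
    and E: "\<And>t. \<gamma> t \<in> topspace (Euclidean_space m)"
    and \<gamma>: "\<And>j. j < m \<Longrightarrow> ((\<lambda>t. \<gamma> t j) has_real_derivative c j) (at t0)"
    and f: "\<And>j x. j < m \<Longrightarrow> x \<in> V \<Longrightarrow> ((\<lambda>t. f (x(j := t))) has_real_derivative g j x) (at (x j))"
    and g: "\<And>j. j < m \<Longrightarrow> continuous_on V (g j)"
  shows "((\<lambda>t. f (\<gamma> t)) has_real_derivative (\<Sum>j<m. g j (\<gamma> t0) * c j)) (at t0)"
proof -
  define p where "p = \<gamma> t0"
  define \<delta> where "\<delta> j t = (\<lambda>i. if i < j then \<gamma> t i else p i)" for j t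
  obtain e where e: "e > 0"
    "\<And>y. \<lbrakk>y \<in> topspace (Euclidean_space m); \<And>i. i < m \<Longrightarrow> \<bar>y i - p i\<bar> < e\<rbrakk> \<Longrightarrow> y \<in> V"
    using openin_Euclidean_space_box[OF V assms(2)] unfolding p_def by blast
  have pE: "\<And>i. i \<ge> m \<Longrightarrow> p i = 0" and \<gamma>E: "\<And>i t. i \<ge> m \<Longrightarrow> \<gamma> t i = 0"
    using E by (auto simp: p_def topspace_Euclidean_space)
  have lim: "((\<lambda>t. \<gamma> t j) \<longlongrightarrow> p j) (at t0)" for j
  proof (cases "j < m")
    case True
    then show ?thesis using DERIV_isCont[OF \<gamma>] by (simp add: isCont_def p_def)
  qed (use pE \<gamma>E in auto)
  have near: "\<forall>\<^sub>F t in at t0. \<forall>j<m. \<bar>\<gamma> t j - p j\<bar> < e"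
  proof -
    have "\<forall>\<^sub>F t in at t0. \<forall>j\<in>{..<m}. \<bar>\<gamma> t j - p j\<bar> < e"
      using lim e(1) by (subst eventually_ball_finite_distrib) (auto simp: tendsto_iff dist_real_def)
    then show ?thesis by (simp add: Ball_def)
  qed
  have "j \<le> m \<Longrightarrow> ((\<lambda>t. f (\<delta> j t)) has_real_derivative (\<Sum>l<j. g l p * c l)) (at t0)" for j
  proof (induction j)
    case 0
    then show ?case by (simp add: \<delta>_def)
  next
    case (Suc j)
    then have j: "j < m" by simp
    \<comment> \<open>the point at which the mean value theorem evaluates the \<open>j\<close>-th partial derivative\<close>
    have "\<exists>u. \<bar>u - p j\<bar> \<le> \<bar>\<gamma> t j - p j\<bar> \<and>
            f (\<delta> (Suc j) t) - f (\<delta> j t) = g j ((\<delta> j t)(j := u)) * (\<gamma> t j - p j)"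
      if t: "\<forall>j<m. \<bar>\<gamma> t j - p j\<bar> < e" for t
    proof -
      have inV: "(\<delta> j t)(j := u) \<in> V" if "\<bar>u - p j\<bar> \<le> \<bar>\<gamma> t j - p j\<bar>" for u
      proof (rule e(2))
        show "(\<delta> j t)(j := u) \<in> topspace (Euclidean_space m)"
          using pE j by (auto simp: \<delta>_def topspace_Euclidean_space)
        show "\<bar>((\<delta> j t)(j := u)) i - p i\<bar> < e" if "i < m" for i
          using t that e(1) \<open>\<bar>u - p j\<bar> \<le> _\<close> j by (auto simp: \<delta>_def intro: le_less_trans)
      qed
      have "((\<lambda>u. f ((\<delta> j t)(j := u))) has_real_derivative g j ((\<delta> j t)(j := u))) (at u)"
        if "\<bar>u - p j\<bar> \<le> \<bar>\<gamma> t j - p j\<bar>" for u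
        using f[OF j inV[OF that]] by simp
      then obtain u where "\<bar>u - p j\<bar> \<le> \<bar>\<gamma> t j - p j\<bar>"
        "f ((\<delta> j t)(j := \<gamma> t j)) - f ((\<delta> j t)(j := p j)) = g j ((\<delta> j t)(j := u)) * (\<gamma> t j - p j)"
        using mean_value_between[where h="\<lambda>u. f ((\<delta> j t)(j := u))" and
          h'="\<lambda>u. g j ((\<delta> j t)(j := u))" and a="p j" and b="\<gamma> t j"] by blast
      moreover have "(\<delta> j t)(j := \<gamma> t j) = \<delta> (Suc j) t" "(\<delta> j t)(j := p j) = \<delta> j t"
        by (auto simp: \<delta>_def fun_eq_iff)
      ultimately show ?thesis by auto
    qed
    then obtain u where u: "\<And>t. \<forall>j<m. \<bar>\<gamma> t j - p j\<bar> < e \<Longrightarrow> \<bar>u t - p j\<bar> \<le> \<bar>\<gamma> t j - p j\<bar>"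
       "\<And>t. \<forall>j<m. \<bar>\<gamma> t j - p j\<bar> < e \<Longrightarrow>
            f (\<delta> (Suc j) t) - f (\<delta> j t) = g j ((\<delta> j t)(j := u t)) * (\<gamma> t j - p j)"
      by metis
    define q where "q t = (\<delta> j t)(j := u t)" for t
    have ulim: "(u \<longlongrightarrow> p j) (at t0)"
    proof (rule Lim_transform_bound[of "\<lambda>t. u t - p j" "\<lambda>t. \<gamma> t j - p j", THEN LIM_zero_cancel])
      show "\<forall>\<^sub>F t in at t0. norm (u t - p j) \<le> norm (\<gamma> t j - p j)"
        using near by eventually_elim (use u(1) in auto)
      show "((\<lambda>t. \<gamma> t j - p j) \<longlongrightarrow> 0) (at t0)" using lim LIM_zero by blast
    qed
    have qlim: "(q \<longlongrightarrow> p) (at t0)"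
      unfolding limitin_canonical_iff[symmetric] euclidean_product_topology[symmetric]
        limitin_componentwise
    proof (intro conjI ballI)
      fix i show "limitin euclidean (\<lambda>t. q t i) (p i) (at t0)"
        using ulim lim[of i]
        by (cases "i = j"; cases "i < j") (simp_all add: q_def \<delta>_def)
    qed auto
    have qV: "\<forall>\<^sub>F t in at t0. q t \<in> V"
      using near
    proof eventually_elim
      case (elim t)
      show ?case
      proof (rule e(2))
        show "q t \<in> topspace (Euclidean_space m)"
          using pE j by (auto simp: \<delta>_def q_def topspace_Euclidean_space)
        show "\<bar>q t i - p i\<bar> < e" if "i < m" for i
          using u(1)[of t] elim that e(1) j
          by (auto simp: \<delta>_def q_def intro: le_less_trans)
      qed
    qed
    have "((\<lambda>t. g j (q t)) \<longlongrightarrow> g j p) (at t0)"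
      using continuous_on_tendsto_compose[OF g[OF j] qlim _ qV] assms(2) p_def by blast
    moreover have "((\<lambda>t. (\<gamma> t j - p j) / (t - t0)) \<longlongrightarrow> c j) (at t0)"
      using \<gamma>[OF j] by (simp add: has_field_derivative_iff p_def)
    ultimately have "((\<lambda>t. g j (q t) * ((\<gamma> t j - p j) / (t - t0))) \<longlongrightarrow> g j p * c j) (at t0)"
      by (rule tendsto_mult)
    moreover have "\<forall>\<^sub>F t in at t0. g j (q t) * ((\<gamma> t j - p j) / (t - t0)) =
        ((f (\<delta> (Suc j) t) - f (\<delta> j t)) - (f (\<delta> (Suc j) t0) - f (\<delta> j t0))) / (t - t0)"
      using near
    proof eventually_elim
      case (elim t)
      have "\<delta> (Suc j) t0 = \<delta> j t0" by (auto simp: \<delta>_def p_def)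
      then show ?case using u(2)[OF elim] by (simp add: q_def)
    qed
    ultimately have "((\<lambda>t. f (\<delta> (Suc j) t) - f (\<delta> j t)) has_real_derivative g j p * c j) (at t0)"
      unfolding has_field_derivative_iff by (rule Lim_transform_eventually)
    from DERIV_add[OF this Suc.IH] j show ?case by (simp add: add.commute)
  qed
  from this[of m] have "((\<lambda>t. f (\<delta> m t)) has_real_derivative (\<Sum>l<m. g l p * c l)) (at t0)" by simp
  moreover have "\<delta> m t = \<gamma> t" for t
    using pE \<gamma>E by (auto simp: \<delta>_def fun_eq_iff)
  ultimately show ?thesis by (simp add: p_def)
qed

lemma continuous_on_coordinates:
  assumes "\<And>x. x \<in> U \<Longrightarrow> F x \<in> topspace (Euclidean_space m)"
    and "\<And>j. j < m \<Longrightarrow> continuous_on U (\<lambda>x. F x j)"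
  shows "continuous_on U F"
proof (rule continuous_on_coordinatewise_then_product)
  fix j
  show "continuous_on U (\<lambda>x. F x j)"
  proof (cases "j < m")
    case False
    then have "continuous_on U (\<lambda>x. F x j) \<longleftrightarrow> continuous_on U (\<lambda>x. 0::real)"
      using assms(1) by (intro continuous_on_cong) (auto simp: topspace_Euclidean_space)
    then show ?thesis by simp
  qed (rule assms(2))
qed

text \<open>
  By the chain rule, the partial derivatives of \<open>f \<circ> F\<close> are \<open>\<Sum>j. (\<partial>\<^sub>j f \<circ> F) \<partial>\<^sub>i F\<^sub>j\<close>; the induction
  hypothesis applies to the first factors, which are composites of a function of one class less.
\<close>

lemma Ck_on_compose:
  assumes U: "openin (Euclidean_space n) U" and V: "openin (Euclidean_space m) V"
    and FV: "\<And>x. x \<in> U \<Longrightarrow> F x \<in> V"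
    and f: "Ck_on k m V f" and F: "\<And>j. j < m \<Longrightarrow> Ck_on k n U (\<lambda>x. F x j)"
  shows "Ck_on k n U (\<lambda>x. f (F x))"
proof -
  have E: "F x \<in> topspace (Euclidean_space m)" if "x \<in> U" for x
    using that FV openin_Euclidean_space_subset[OF V] by blast
  have cont: "continuous_map (subtopology (Euclidean_space n) U) euclideanreal (\<lambda>x. f (F x))"
    if "Ck_on k m V f" "\<And>j. j < m \<Longrightarrow> Ck_on k n U (\<lambda>x. F x j)" for k f
  proof -
    have "continuous_on U F"
      using E that(2) by (intro continuous_on_coordinates Ck_on_continuous_on[OF U]) auto
    moreover have "continuous_on V f" by (rule Ck_on_continuous_on[OF V that(1)])
    ultimately have "continuous_on U (\<lambda>x. f (F x))"
      using FV by (intro continuous_on_compose2[of V f U F]) auto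
    then show ?thesis
      using openin_Euclidean_space_subset[OF U] by (simp add: subtopology_Euclidean_space_eq)
  qed
  show ?thesis
    using f F
  proof (induction k arbitrary: f)
    case 0
    then show ?case using cont[OF 0] by simp
  next
    case (Suc k)
    have "\<forall>j\<in>{..<m}. \<exists>g. (\<forall>x\<in>V. ((\<lambda>t. f (x(j := t))) has_real_derivative g x) (at (x j))) \<and>
        Ck_on k m V g"
      using Suc.prems(1) unfolding Ck_on.simps by simp
    from bchoice[OF this] obtain g where g: "\<And>j x. j < m \<Longrightarrow> x \<in> V \<Longrightarrow> ((\<lambda>t. f (x(j := t))) has_real_derivative g j x) (at (x j))"
      "\<And>j. j < m \<Longrightarrow> Ck_on k m V (g j)"
      by blast
    have "\<exists>h. (\<forall>x\<in>U. ((\<lambda>t. f (F (x(i := t)))) has_real_derivative h x) (at (x i))) \<and> Ck_on k n U h"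
      if i: "i < n" for i
    proof -
      have "\<forall>j\<in>{..<m}. \<exists>c. (\<forall>x\<in>U. ((\<lambda>t. F (x(i := t)) j) has_real_derivative c x) (at (x i))) \<and>
          Ck_on k n U c"
        using Suc.prems(2) i unfolding Ck_on.simps by simp
      from bchoice[OF this] obtain c where c: "\<And>j x. j < m \<Longrightarrow> x \<in> U \<Longrightarrow>
            ((\<lambda>t. F (x(i := t)) j) has_real_derivative c j x) (at (x i))"
        "\<And>j. j < m \<Longrightarrow> Ck_on k n U (c j)"
        by blast
      let ?h = "\<lambda>x. \<Sum>j<m. g j (F x) * c j x"
      have "Ck_on k n U (\<lambda>x. g j (F x))" if "j < m" for j
        using g(2)[OF that] Ck_on_Suc_imp[OF Suc.prems(2)] by (rule Suc.IH)
      then have "Ck_on k n U ?h"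
        using c(2) by (intro Ck_on_sum Ck_on_mult) auto
      moreover have "((\<lambda>t. f (F (x(i := t)))) has_real_derivative ?h x) (at (x i))" if x: "x \<in> U" for x
      proof -
        \<comment> \<open>where the coordinate line is outside \<open>U\<close>, nothing is known about \<open>F\<close>; a constant value
          there keeps the curve in Euclidean space\<close>
        define \<gamma> where "\<gamma> t = (if x(i := t) \<in> U then F (x(i := t)) else F x)" for t
        have ev: "\<forall>\<^sub>F t in nhds (x i). \<gamma> t = F (x(i := t))"
          using eventually_coordinate_line_in_open[OF U x i]
          by eventually_elim (simp add: \<gamma>_def)
        have "((\<lambda>t. f (\<gamma> t)) has_real_derivative (\<Sum>j<m. g j (\<gamma> (x i)) * c j x)) (at (x i))"
        proof (rule DERIV_along_curve[OF V])
          show "\<gamma> (x i) \<in> V" "\<And>t. \<gamma> t \<in> topspace (Euclidean_space m)"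
            using E FV x by (auto simp: \<gamma>_def)
          show "((\<lambda>t. \<gamma> t j) has_real_derivative c j x) (at (x i))" if "j < m" for j
          proof (rule DERIV_cong_ev[THEN iffD2, OF refl _ refl c(1)[OF that x]])
            show "\<forall>\<^sub>F t in nhds (x i). \<gamma> t j = F (x(i := t)) j"
              using ev by eventually_elim simp
          qed
          show "continuous_on V (g j)" if "j < m" for j
            using Ck_on_continuous_on[OF V g(2)[OF that]] .
        qed (rule g(1))
        moreover have "\<gamma> (x i) = F x" using x by (simp add: \<gamma>_def)
        ultimately have D: "((\<lambda>t. f (\<gamma> t)) has_real_derivative ?h x) (at (x i))" by simp
        have ev': "\<forall>\<^sub>F t in nhds (x i). f (\<gamma> t) = f (F (x(i := t)))"
          using ev by eventually_elim simp
        show ?thesis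
          using D unfolding DERIV_cong_ev[OF refl ev' refl] .
      qed
      ultimately show ?thesis by (intro exI[of _ ?h]) simp
    qed
    then show ?case using cont[OF Suc.prems] by (intro Ck_on_SucI)
  qed
qed

lemma Cinf_on_image: "Cinf_on n m U F \<Longrightarrow> x \<in> U \<Longrightarrow> F x \<in> topspace (Euclidean_space m)"
  by (auto simp: Cinf_on_def)

lemma Cinf_onI:
  assumes "\<And>x. x \<in> U \<Longrightarrow> F x \<in> topspace (Euclidean_space m)"
    "\<And>j k. j < m \<Longrightarrow> Ck_on k n U (\<lambda>x. F x j)"
  shows "Cinf_on n m U F"
  using assms by (auto simp: Cinf_on_def)

lemma Cinf_on_cong:
  assumes "openin (Euclidean_space n) U" "Cinf_on n m U F" "\<And>x. x \<in> U \<Longrightarrow> F x = G x"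
  shows "Cinf_on n m U G"
proof (rule Cinf_onI)
  show "G x \<in> topspace (Euclidean_space m)" if "x \<in> U" for x
    using Cinf_on_image[OF assms(2) that] assms(3)[OF that] by simp
  show "Ck_on k n U (\<lambda>x. G x j)" if "j < m" for j k
  proof (rule Ck_on_cong[OF assms(1), of "\<lambda>x. F x j" "\<lambda>x. G x j"])
    show "Ck_on k n U (\<lambda>x. F x j)" using assms(2) that by (simp add: Cinf_on_def)
  qed (simp add: assms(3))
qed

lemma Cinf_on_subset: "Cinf_on n m U F \<Longrightarrow> V \<subseteq> U \<Longrightarrow> Cinf_on n m V F"
proof (rule Cinf_onI)
  assume *: "Cinf_on n m U F" "V \<subseteq> U"
  show "F x \<in> topspace (Euclidean_space m)" if "x \<in> V" for x
    using Cinf_on_image[OF *(1)] *(2) that by blast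
  show "Ck_on k n V (\<lambda>x. F x j)" if "j < m" for j k
    using *(1) that by (intro Ck_on_subset[OF _ *(2)]) (simp add: Cinf_on_def)
qed

lemma Cinf_on_local:
  assumes "\<And>x. x \<in> U \<Longrightarrow> \<exists>V. x \<in> V \<and> V \<subseteq> U \<and> openin (Euclidean_space n) V \<and> Cinf_on n m V F"
  shows "Cinf_on n m U F"
proof (rule Cinf_onI)
  show "F x \<in> topspace (Euclidean_space m)" if "x \<in> U" for x
    using assms[OF that] Cinf_on_image by blast
  show "Ck_on k n U (\<lambda>x. F x j)" if "j < m" for j k
  proof (rule Ck_on_local)
    show "\<exists>V. x \<in> V \<and> V \<subseteq> U \<and> openin (Euclidean_space n) V \<and> Ck_on k n V (\<lambda>x. F x j)"
      if x: "x \<in> U" for x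
    proof -
      obtain V where "x \<in> V" "V \<subseteq> U" "openin (Euclidean_space n) V" "Cinf_on n m V F"
        using assms[OF x] by blast
      then show ?thesis using \<open>j < m\<close> by (intro exI[of _ V]) (simp add: Cinf_on_def)
    qed
  qed
qed

lemma Cinf_on_compose:
  assumes "openin (Euclidean_space n) U" "openin (Euclidean_space m) V"
    and "Cinf_on n m U F" "Cinf_on m l V G" "\<And>x. x \<in> U \<Longrightarrow> F x \<in> V"
  shows "Cinf_on n l U (\<lambda>x. G (F x))"
proof (rule Cinf_onI)
  show "G (F x) \<in> topspace (Euclidean_space l)" if "x \<in> U" for x
    using assms(4,5) that Cinf_on_image by blast
  show "Ck_on k n U (\<lambda>x. G (F x) j)" if "j < l" for j k
  proof (rule Ck_on_compose[OF assms(1,2,5)])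
    show "Ck_on k m V (\<lambda>y. G y j)" "\<And>j. j < m \<Longrightarrow> Ck_on k n U (\<lambda>x. F x j)"
      using assms(3,4) that by (auto simp: Cinf_on_def)
  qed
qed

lemma Cinf_on_continuous_map:
  assumes "openin (Euclidean_space n) U" "Cinf_on n m U F"
  shows "continuous_map (subtopology (Euclidean_space n) U) (Euclidean_space m) F"
proof -
  have "continuous_on U F"
    using assms Ck_on_continuous_on[OF assms(1)]
    by (intro continuous_on_coordinates[of U F m]) (auto simp: Cinf_on_def)
  then show ?thesis
    using openin_Euclidean_space_subset[OF assms(1)] Cinf_on_image[OF assms(2)]
    by (simp add: subtopology_Euclidean_space_eq)
       (auto simp: Euclidean_space_top_of_set topspace_Euclidean_space continuous_map_in_subtopology
          image_subset_iff)
qed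

section \<open>Maps that are smooth in a chart\<close>

lemma is_chart_openin: "is_chart T n (U, \<phi>) \<Longrightarrow> openin T U"
  by (simp add: is_chart_def)

lemma is_chart_inj: "is_chart T n (U, \<phi>) \<Longrightarrow> inj_on \<phi> U"
  unfolding is_chart_def using homeomorphic_imp_injective_map openin_subset
  by (fastforce simp: Int_absorb1)

lemma is_chart_continuous:
  assumes "is_chart T n (U, \<phi>)"
  shows "continuous_map (subtopology T U) (Euclidean_space n) \<phi>"
  using assms continuous_map_in_subtopology homeomorphic_imp_continuous_map
  unfolding is_chart_def by blast

lemma is_chart_image:
  assumes "is_chart T n (U, \<phi>)" "x \<in> U"
  shows "\<phi> x \<in> topspace (Euclidean_space n)"
  using assms openin_subset unfolding is_chart_def by fastforce

lemma is_chart_image_openin: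
  assumes "is_chart T n (U, \<phi>)" "openin T S" "S \<subseteq> U"
  shows "openin (Euclidean_space n) (\<phi> ` S)"
proof -
  have *: "openin T U" "openin (Euclidean_space n) (\<phi> ` U)"
    "homeomorphic_map (subtopology T U) (subtopology (Euclidean_space n) (\<phi> ` U)) \<phi>"
    using assms(1) by (auto simp: is_chart_def)
  have "openin (subtopology T U) S"
    using assms(2,3) *(1) openin_open_subtopology by blast
  then have "openin (subtopology (Euclidean_space n) (\<phi> ` U)) (\<phi> ` S)"
    using homeomorphic_imp_open_map[OF *(3)] by (simp add: open_map_def)
  then show ?thesis using *(2) openin_open_subtopology by blast
qed

lemma is_chart_preimage_openin:
  assumes "is_chart T n (U, \<phi>)" "openin (Euclidean_space n) S"
  shows "openin T {x \<in> U. \<phi> x \<in> S}"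
proof -
  have U: "openin T U" by (rule is_chart_openin[OF assms(1)])
  have "openin (subtopology T U) {x \<in> topspace (subtopology T U). \<phi> x \<in> S}"
    by (rule openin_continuous_map_preimage[OF is_chart_continuous[OF assms(1)] assms(2)])
  moreover have "topspace (subtopology T U) = U"
    using openin_subset[OF U] by auto
  ultimately have "openin (subtopology T U) {x \<in> U. \<phi> x \<in> S}" by (simp only:)
  then show ?thesis using openin_open_subtopology[OF U] by blast
qed

lemma is_chart_subset:
  assumes c: "is_chart T n (U, \<phi>)" and W: "openin T W" "W \<subseteq> U"
  shows "is_chart T n (W, \<phi>)"
proof -
  have "homeomorphic_map (subtopology T U) (subtopology (Euclidean_space n) (\<phi> ` U)) \<phi>"
    using c by (simp add: is_chart_def)
  moreover have "\<phi> ` (topspace (subtopology T U) \<inter> W) =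
      topspace (subtopology (Euclidean_space n) (\<phi> ` U)) \<inter> \<phi> ` W"
    using W openin_subset[OF W(1)] is_chart_image[OF c] by auto
  ultimately have "homeomorphic_map (subtopology (subtopology T U) W)
      (subtopology (subtopology (Euclidean_space n) (\<phi> ` U)) (\<phi> ` W)) \<phi>"
    using homeomorphic_map_subtopologies by blast
  then have "homeomorphic_map (subtopology T W) (subtopology (Euclidean_space n) (\<phi> ` W)) \<phi>"
    using W(2) by (simp add: subtopology_subtopology Int_absorb1 image_mono)
  then show ?thesis
    using W is_chart_image_openin[OF c W] by (simp add: is_chart_def)
qed

text \<open>
  Asking that \<open>h\<close> factor through \<open>\<phi>\<close> on \<open>S\<close>, instead of composing it with the inverse of \<open>\<phi>\<close>, makes
  the condition independent of the domain on which the chart is inverted.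
\<close>

definition chart_smooth ::
    "nat \<Rightarrow> ('a \<Rightarrow> (nat \<Rightarrow> real)) \<Rightarrow> 'a set \<Rightarrow> nat \<Rightarrow> ('a \<Rightarrow> (nat \<Rightarrow> real)) \<Rightarrow> bool" where
  "chart_smooth n \<phi> S m h \<longleftrightarrow> (\<exists>H. Cinf_on n m (\<phi> ` S) H \<and> (\<forall>x\<in>S. H (\<phi> x) = h x))"

lemma chart_smooth_subset:
  "chart_smooth n \<phi> S m h \<Longrightarrow> S' \<subseteq> S \<Longrightarrow> chart_smooth n \<phi> S' m h"
  unfolding chart_smooth_def using Cinf_on_subset image_mono by (metis subsetD)

lemma chart_smooth_compose:
  assumes "openin (Euclidean_space n) (\<phi> ` S)" "openin (Euclidean_space m) (\<psi> ` S')"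
    and "chart_smooth n \<phi> S m (\<lambda>x. \<psi> (F x))" "chart_smooth m \<psi> S' l h" "\<And>x. x \<in> S \<Longrightarrow> F x \<in> S'"
  shows "chart_smooth n \<phi> S l (\<lambda>x. h (F x))"
proof -
  obtain H where H: "Cinf_on n m (\<phi> ` S) H" "\<And>x. x \<in> S \<Longrightarrow> H (\<phi> x) = \<psi> (F x)"
    using assms(3) by (auto simp: chart_smooth_def)
  obtain K where K: "Cinf_on m l (\<psi> ` S') K" "\<And>y. y \<in> S' \<Longrightarrow> K (\<psi> y) = h y"
    using assms(4) by (auto simp: chart_smooth_def)
  have "Cinf_on n l (\<phi> ` S) (\<lambda>x. K (H x))"
    using H(2) assms(5) by (intro Cinf_on_compose[OF assms(1,2) H(1) K(1)]) auto
  then show ?thesis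
    unfolding chart_smooth_def using H(2) K(2) assms(5) by (intro exI[of _ "\<lambda>x. K (H x)"]) auto
qed

lemma chart_smooth_change:
  assumes "openin (Euclidean_space n) (\<phi> ` S)" "openin (Euclidean_space m) (\<psi> ` S')"
    and "chart_smooth n \<phi> S m \<psi>" "chart_smooth m \<psi> S' l h" "S \<subseteq> S'"
  shows "chart_smooth n \<phi> S l h"
  using chart_smooth_compose[OF assms(1,2), where F="\<lambda>x. x" and h=h] assms(3-5) by auto

text \<open>
  Any left inverse of the chart yields the same condition, in particular the inverse on a domain
  \<open>U\<close> larger than \<open>S\<close>, as it occurs in the definitions of smooth transitions and smooth maps.
\<close>

lemma chart_smooth_iff:
  assumes "inj_on \<phi> U" "S \<subseteq> U" "openin (Euclidean_space n) (\<phi> ` S)"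
  shows "chart_smooth n \<phi> S m h \<longleftrightarrow> Cinf_on n m (\<phi> ` S) (\<lambda>y. h (inv_into U \<phi> y))"
proof
  assume "chart_smooth n \<phi> S m h"
  then obtain H where H: "Cinf_on n m (\<phi> ` S) H" "\<And>x. x \<in> S \<Longrightarrow> H (\<phi> x) = h x"
    by (auto simp: chart_smooth_def)
  have "H y = h (inv_into U \<phi> y)" if "y \<in> \<phi> ` S" for y
    using that H(2) assms(1,2) by (auto simp: inv_into_f_f subset_iff)
  then show "Cinf_on n m (\<phi> ` S) (\<lambda>y. h (inv_into U \<phi> y))"
    by (rule Cinf_on_cong[OF assms(3) H(1)])
next
  assume "Cinf_on n m (\<phi> ` S) (\<lambda>y. h (inv_into U \<phi> y))"
  then show "chart_smooth n \<phi> S m h"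
    unfolding chart_smooth_def using assms(1,2)
    by (intro exI[of _ "\<lambda>y. h (inv_into U \<phi> y)"]) (auto simp: inv_into_f_f subset_iff)
qed

lemma chart_smooth_local:
  assumes \<phi>: "inj_on \<phi> S"
    and "\<And>x. x \<in> S \<Longrightarrow> \<exists>S'\<subseteq>S. x \<in> S' \<and> openin (Euclidean_space n) (\<phi> ` S') \<and> chart_smooth n \<phi> S' m h"
  shows "chart_smooth n \<phi> S m h"
proof -
  have "Cinf_on n m (\<phi> ` S) (\<lambda>y. h (inv_into S \<phi> y))"
  proof (rule Cinf_on_local)
    fix y assume "y \<in> \<phi> ` S"
    then obtain x where x: "x \<in> S" "y = \<phi> x" by auto
    obtain S' where S': "S' \<subseteq> S" "x \<in> S'" "openin (Euclidean_space n) (\<phi> ` S')" "chart_smooth n \<phi> S' m h"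
      using assms(2)[OF x(1)] by blast
    have "Cinf_on n m (\<phi> ` S') (\<lambda>y. h (inv_into S \<phi> y))"
      using S'(4) chart_smooth_iff[OF \<phi> S'(1,3)] by simp
    then show "\<exists>V. y \<in> V \<and> V \<subseteq> \<phi> ` S \<and> openin (Euclidean_space n) V \<and>
        Cinf_on n m V (\<lambda>y. h (inv_into S \<phi> y))"
      using S' x(2) by (intro exI[of _ "\<phi> ` S'"]) auto
  qed
  then show ?thesis
    unfolding chart_smooth_def using \<phi>
    by (intro exI[of _ "\<lambda>y. h (inv_into S \<phi> y)"]) (auto simp: inv_into_f_f)
qed

lemma chart_smooth_id: "openin (Euclidean_space n) (\<phi> ` S) \<Longrightarrow> chart_smooth n \<phi> S n \<phi>"
  unfolding chart_smooth_def using openin_Euclidean_space_subset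
  by (intro exI[of _ "\<lambda>x. x"]) (auto intro!: Cinf_onI Ck_on_coordinate)

lemma chart_smooth_const:
  "c \<in> topspace (Euclidean_space m) \<Longrightarrow> chart_smooth n \<phi> S m (\<lambda>_. c)"
  unfolding chart_smooth_def
  by (intro exI[of _ "\<lambda>x. c"]) (auto intro!: Cinf_onI Ck_on_const)

lemma smooth_transition_iff:
  assumes "is_chart T n (U, \<phi>)" "is_chart T n (V, \<psi>)"
  shows "smooth_transition n (U, \<phi>) (V, \<psi>) \<longleftrightarrow> chart_smooth n \<phi> (U \<inter> V) n \<psi>"
proof -
  have "openin (Euclidean_space n) (\<phi> ` (U \<inter> V))"
    using assms by (intro is_chart_image_openin[OF assms(1)] openin_Int) (auto intro: is_chart_openin)
  then have "chart_smooth n \<phi> (U \<inter> V) n \<psi> \<longleftrightarrow> Cinf_on n n (\<phi> ` (U \<inter> V)) (\<lambda>y. \<psi> (inv_into U \<phi> y))"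
    by (intro chart_smooth_iff is_chart_inj[OF assms(1)]) auto
  then show ?thesis by (simp add: smooth_transition_def comp_def)
qed

section \<open>Smooth structures and smooth maps\<close>

text \<open>
  The part of the definition of a manifold that concerns the atlas. It stands on its own because it
  can be verified on a covering family of charts.
\<close>

definition smooth_structure :: "'a mfd \<Rightarrow> bool" where
  "smooth_structure X \<longleftrightarrow>
     (\<Union>(U, \<phi>)\<in>atlas X. U) = pts X \<and> atlas X = compatible_charts (mtop X) (mdim X) (atlas X)"

lemma smooth_manifold_imp_structure: "smooth_manifold X \<Longrightarrow> smooth_structure X"
  by (simp add: smooth_manifold_def smooth_structure_def)

context
  fixes X :: "'a mfd"
  assumes X: "smooth_structure X"
begin

lemma atlas_iff: "c \<in> atlas X \<longleftrightarrow> c \<in> compatible_charts (mtop X) (mdim X) (atlas X)"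
  using X unfolding smooth_structure_def by metis

lemma atlas_is_chart: "(U, \<phi>) \<in> atlas X \<Longrightarrow> is_chart (mtop X) (mdim X) (U, \<phi>)"
  by (drule atlas_iff[THEN iffD1]) (simp add: compatible_charts_def)

lemma atlas_smooth_transition:
  assumes U: "(U, \<phi>) \<in> atlas X" and V: "(V, \<psi>) \<in> atlas X"
  shows "chart_smooth (mdim X) \<phi> (U \<inter> V) (mdim X) \<psi>"
proof -
  have "smooth_transition (mdim X) (U, \<phi>) (V, \<psi>)"
    using atlas_iff[THEN iffD1, OF U] V by (simp add: compatible_charts_def)
  then show ?thesis
    using smooth_transition_iff[OF atlas_is_chart[OF U] atlas_is_chart[OF V]] by simp
qed

lemma atlasI:
  assumes "is_chart (mtop X) (mdim X) (U, \<phi>)"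
    and "\<And>V \<psi>. (V, \<psi>) \<in> atlas X \<Longrightarrow> chart_smooth (mdim X) \<phi> (U \<inter> V) (mdim X) \<psi>"
    and "\<And>V \<psi>. (V, \<psi>) \<in> atlas X \<Longrightarrow> chart_smooth (mdim X) \<psi> (U \<inter> V) (mdim X) \<phi>"
  shows "(U, \<phi>) \<in> atlas X"
proof -
  have "(U, \<phi>) \<in> compatible_charts (mtop X) (mdim X) (atlas X)"
    using assms atlas_is_chart smooth_transition_iff[OF assms(1)] smooth_transition_iff[OF _ assms(1)]
    by (auto simp: compatible_charts_def Int_commute)
  then show ?thesis using atlas_iff by blast
qed

lemma chart_at:
  assumes "a \<in> pts X"
  obtains U \<phi> where "(U, \<phi>) \<in> atlas X" "a \<in> U"
  using X assms unfolding smooth_structure_def by blast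

lemma atlas_openin: "(U, \<phi>) \<in> atlas X \<Longrightarrow> openin (mtop X) U"
  using atlas_is_chart is_chart_openin by blast

lemma atlas_image_openin:
  "\<lbrakk>(U, \<phi>) \<in> atlas X; openin (mtop X) S; S \<subseteq> U\<rbrakk> \<Longrightarrow> openin (Euclidean_space (mdim X)) (\<phi> ` S)"
  using atlas_is_chart is_chart_image_openin by blast

text \<open>
  The atlas is maximal, so it contains the restrictions of its charts to open subsets.
\<close>

lemma atlas_subset:
  assumes U: "(U, \<phi>) \<in> atlas X" and W: "openin (mtop X) W" "W \<subseteq> U"
  shows "(W, \<phi>) \<in> atlas X"
proof (rule atlasI)
  fix V \<psi> assume V: "(V, \<psi>) \<in> atlas X"
  show "chart_smooth (mdim X) \<phi> (W \<inter> V) (mdim X) \<psi>"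
    by (rule chart_smooth_subset[OF atlas_smooth_transition[OF U V]]) (use W in auto)
  show "chart_smooth (mdim X) \<psi> (W \<inter> V) (mdim X) \<phi>"
    by (rule chart_smooth_subset[OF atlas_smooth_transition[OF V U]]) (use W in auto)
qed (rule is_chart_subset[OF atlas_is_chart[OF U] W])

end

text \<open>
  Two charts that are compatible with a covering family are compatible with each other, because near
  each point the transition between them factors through a member of the family.
\<close>

lemma smooth_structure_generated:
  assumes top: "mtop X = T" and dim: "mdim X = n" and at: "atlas X = compatible_charts T n B"
    and B: "\<And>U \<phi>. (U, \<phi>) \<in> B \<Longrightarrow> is_chart T n (U, \<phi>)"
    and trans: "\<And>U \<phi> V \<psi>. \<lbrakk>(U, \<phi>) \<in> B; (V, \<psi>) \<in> B\<rbrakk> \<Longrightarrow> chart_smooth n \<phi> (U \<inter> V) n \<psi>"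
    and cover: "\<And>x. x \<in> topspace T \<Longrightarrow> \<exists>(U, \<phi>)\<in>B. x \<in> U"
  shows "smooth_structure X" "B \<subseteq> atlas X"
proof -
  let ?A = "compatible_charts T n B"
  have chart: "is_chart T n (U, \<phi>)" if "(U, \<phi>) \<in> ?A" for U \<phi>
    using that by (simp add: compatible_charts_def)
  have toB: "chart_smooth n \<phi> (U \<inter> V) n \<psi>" "chart_smooth n \<psi> (U \<inter> V) n \<phi>"
    if "(U, \<phi>) \<in> ?A" "(V, \<psi>) \<in> B" for U \<phi> V \<psi>
    using that smooth_transition_iff[OF chart[OF that(1)] B[OF that(2)]]
      smooth_transition_iff[OF B[OF that(2)] chart[OF that(1)]]
    by (auto simp: compatible_charts_def Int_commute)
  have BA: "B \<subseteq> ?A"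
    using B trans smooth_transition_iff[OF B B] by (auto simp: compatible_charts_def)
  then show "B \<subseteq> atlas X" using at by simp
  have "chart_smooth n \<phi> (U \<inter> V) n \<psi>" if U: "(U, \<phi>) \<in> ?A" and V: "(V, \<psi>) \<in> ?A" for U \<phi> V \<psi>
  proof (rule chart_smooth_local)
    show "inj_on \<phi> (U \<inter> V)"
      using is_chart_inj[OF chart[OF U]] inj_on_subset by blast
    fix x assume x: "x \<in> U \<inter> V"
    then obtain W \<beta> where W: "(W, \<beta>) \<in> B" "x \<in> W"
      using cover openin_subset[OF is_chart_openin[OF chart[OF U]]] by blast
    have op: "openin T (U \<inter> V \<inter> W)" "openin T (V \<inter> W)"
      using is_chart_openin[OF chart[OF U]] is_chart_openin[OF chart[OF V]] is_chart_openin[OF B[OF W(1)]]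
      by auto
    have im: "openin (Euclidean_space n) (\<phi> ` (U \<inter> V \<inter> W))" "openin (Euclidean_space n) (\<beta> ` (V \<inter> W))"
      by (rule is_chart_image_openin[OF chart[OF U] op(1)], blast)
         (rule is_chart_image_openin[OF B[OF W(1)] op(2)], blast)
    have "chart_smooth n \<phi> (U \<inter> V \<inter> W) n \<beta>"
      by (rule chart_smooth_subset[OF toB(1)[OF U W(1)]]) auto
    then have "chart_smooth n \<phi> (U \<inter> V \<inter> W) n \<psi>"
      by (rule chart_smooth_change[OF im _ toB(2)[OF V W(1)]]) auto
    then show "\<exists>S'\<subseteq>U \<inter> V. x \<in> S' \<and> openin (Euclidean_space n) (\<phi> ` S') \<and> chart_smooth n \<phi> S' n \<psi>"
      using x W(2) is_chart_image_openin[OF chart[OF U] op(1)] by (intro exI[of _ "U \<inter> V \<inter> W"]) auto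
  qed
  then have "?A \<subseteq> compatible_charts T n ?A"
    using chart smooth_transition_iff[OF chart chart]
    by (auto simp: compatible_charts_def[of T n ?A])
  moreover have "compatible_charts T n A' \<subseteq> compatible_charts T n B" if "B \<subseteq> A'" for A'
    using that unfolding compatible_charts_def by blast
  from this[OF BA] have "compatible_charts T n ?A \<subseteq> ?A" .
  moreover have "(\<Union>(U, \<phi>)\<in>?A. U) = topspace T"
  proof
    show "(\<Union>(U, \<phi>)\<in>?A. U) \<subseteq> topspace T"
      using openin_subset[OF is_chart_openin[OF chart]] by blast
    show "topspace T \<subseteq> (\<Union>(U, \<phi>)\<in>?A. U)"
      using cover BA by fastforce
  qed
  ultimately show "smooth_structure X"
    unfolding smooth_structure_def top dim at by blast
qed

lemma smooth_on_open_openin: "smooth_on_open X W Y F \<Longrightarrow> openin (mtop X) W"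
  by (simp add: smooth_on_open_def)

lemma smooth_on_open_image: "smooth_on_open X W Y F \<Longrightarrow> x \<in> W \<Longrightarrow> F x \<in> pts Y"
  by (auto simp: smooth_on_open_def)

lemma smooth_on_open_chartsE:
  assumes X: "smooth_structure X" and F: "smooth_on_open X W Y F" and a: "a \<in> W"
  obtains U \<phi> V \<psi> where "(U, \<phi>) \<in> atlas X" "(V, \<psi>) \<in> atlas Y" "a \<in> U" "U \<subseteq> W" "F ` U \<subseteq> V"
    "chart_smooth (mdim X) \<phi> U (mdim Y) (\<lambda>x. \<psi> (F x))"
proof -
  obtain U \<phi> V \<psi> where *: "(U, \<phi>) \<in> atlas X" "(V, \<psi>) \<in> atlas Y" "a \<in> U" "U \<subseteq> W" "F ` U \<subseteq> V"
    "Cinf_on (mdim X) (mdim Y) (\<phi> ` U) (\<psi> \<circ> F \<circ> inv_into U \<phi>)"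
    using F a unfolding smooth_on_open_def by blast
  have "chart_smooth (mdim X) \<phi> U (mdim Y) (\<lambda>x. \<psi> (F x))"
    using *(6) chart_smooth_iff[OF is_chart_inj[OF atlas_is_chart[OF X *(1)]] subset_refl
        atlas_image_openin[OF X *(1) atlas_openin[OF X *(1)] subset_refl],
        of "mdim Y" "\<lambda>x. \<psi> (F x)"]
    by (simp add: comp_def)
  then show thesis using that * by blast
qed

lemma smooth_on_openI:
  assumes X: "smooth_structure X" and "openin (mtop X) W" "\<And>x. x \<in> W \<Longrightarrow> F x \<in> pts Y"
    and loc: "\<And>a. a \<in> W \<Longrightarrow> \<exists>U \<phi> V \<psi>. (U, \<phi>) \<in> atlas X \<and> (V, \<psi>) \<in> atlas Y \<and> a \<in> U \<and> U \<subseteq> W \<and>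
      F ` U \<subseteq> V \<and> chart_smooth (mdim X) \<phi> U (mdim Y) (\<lambda>x. \<psi> (F x))"
  shows "smooth_on_open X W Y F"
proof -
  have "\<exists>(U, \<phi>)\<in>atlas X. \<exists>(V, \<psi>)\<in>atlas Y. a \<in> U \<and> U \<subseteq> W \<and> F ` U \<subseteq> V \<and>
      Cinf_on (mdim X) (mdim Y) (\<phi> ` U) (\<psi> \<circ> F \<circ> inv_into U \<phi>)" if "a \<in> W" for a
  proof -
    obtain U \<phi> V \<psi> where *: "(U, \<phi>) \<in> atlas X" "(V, \<psi>) \<in> atlas Y" "a \<in> U" "U \<subseteq> W" "F ` U \<subseteq> V"
      "chart_smooth (mdim X) \<phi> U (mdim Y) (\<lambda>x. \<psi> (F x))"
      using loc[OF \<open>a \<in> W\<close>] by blast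
    have "Cinf_on (mdim X) (mdim Y) (\<phi> ` U) (\<psi> \<circ> F \<circ> inv_into U \<phi>)"
      using *(6) chart_smooth_iff[OF is_chart_inj[OF atlas_is_chart[OF X *(1)]] subset_refl
          atlas_image_openin[OF X *(1) atlas_openin[OF X *(1)] subset_refl],
          of "mdim Y" "\<lambda>x. \<psi> (F x)"]
      by (simp add: comp_def)
    then show ?thesis using * by blast
  qed
  then show ?thesis using assms(2,3) unfolding smooth_on_open_def by blast
qed

text \<open>
  Smooth maps are continuous, because they are so when read in charts.
\<close>

lemma smooth_on_open_preimage_openin:
  assumes X: "smooth_structure X" and Y: "smooth_structure Y"
    and F: "smooth_on_open X W Y F" and O: "openin (mtop Y) O'"
  shows "openin (mtop X) {x \<in> W. F x \<in> O'}"
proof (subst openin_subopen, intro ballI)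
  fix a assume a: "a \<in> {x \<in> W. F x \<in> O'}"
  then have "a \<in> W" by simp
  then obtain U \<phi> V \<psi> where *: "(U, \<phi>) \<in> atlas X" "(V, \<psi>) \<in> atlas Y" "a \<in> U" "U \<subseteq> W" "F ` U \<subseteq> V"
    "chart_smooth (mdim X) \<phi> U (mdim Y) (\<lambda>x. \<psi> (F x))"
    using smooth_on_open_chartsE[OF X F] by metis
  obtain H where H: "Cinf_on (mdim X) (mdim Y) (\<phi> ` U) H" "\<And>x. x \<in> U \<Longrightarrow> H (\<phi> x) = \<psi> (F x)"
    using *(6) by (auto simp: chart_smooth_def)
  let ?E = "Euclidean_space (mdim X)"
  have U: "openin ?E (\<phi> ` U)"
    by (rule atlas_image_openin[OF X *(1) atlas_openin[OF X *(1)] subset_refl])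
  have VO: "openin (Euclidean_space (mdim Y)) (\<psi> ` (V \<inter> O'))"
    using O atlas_openin[OF Y *(2)] by (intro atlas_image_openin[OF Y *(2)]) auto
  have "openin (subtopology ?E (\<phi> ` U)) {z \<in> topspace (subtopology ?E (\<phi> ` U)). H z \<in> \<psi> ` (V \<inter> O')}"
    by (rule openin_continuous_map_preimage[OF Cinf_on_continuous_map[OF U H(1)] VO])
  then have "openin ?E {z \<in> topspace (subtopology ?E (\<phi> ` U)). H z \<in> \<psi> ` (V \<inter> O')}"
    using openin_open_subtopology[OF U] by blast
  then have "openin (mtop X) {x \<in> U. \<phi> x \<in> {z \<in> topspace (subtopology ?E (\<phi> ` U)). H z \<in> \<psi> ` (V \<inter> O')}}"
    by (rule is_chart_preimage_openin[OF atlas_is_chart[OF X *(1)]])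
  moreover have "{x \<in> U. \<phi> x \<in> {z \<in> topspace (subtopology ?E (\<phi> ` U)). H z \<in> \<psi> ` (V \<inter> O')}} =
      {x \<in> U. F x \<in> O'}" (is "?A = ?B")
  proof
    show "?A \<subseteq> ?B"
      using *(5) H(2) inj_onD[OF is_chart_inj[OF atlas_is_chart[OF Y *(2)]]] by fastforce
    show "?B \<subseteq> ?A"
      using *(5) H(2) openin_subset[OF U] by auto
  qed
  ultimately show "\<exists>T. openin (mtop X) T \<and> a \<in> T \<and> T \<subseteq> {x \<in> W. F x \<in> O'}"
    using *(3,4) a by (intro exI[of _ ?B]) auto
qed

text \<open>
  Smoothness is witnessed by some charts around each point; since transitions are smooth, it can be
  read in any charts.
\<close>

lemma smooth_on_open_in_charts:
  assumes X: "smooth_structure X" and Y: "smooth_structure Y" and F: "smooth_on_open X W Y F"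
    and U: "(U, \<phi>) \<in> atlas X" and V: "(V, \<psi>) \<in> atlas Y"
    and S: "openin (mtop X) S" "S \<subseteq> U" "S \<subseteq> W" "F ` S \<subseteq> V"
  shows "chart_smooth (mdim X) \<phi> S (mdim Y) (\<lambda>x. \<psi> (F x))"
proof (rule chart_smooth_local)
  show "inj_on \<phi> S"
    using is_chart_inj[OF atlas_is_chart[OF X U]] S(2) inj_on_subset by blast
  fix x assume x: "x \<in> S"
  then have "x \<in> W" using S(3) by blast
  then obtain U1 \<phi>1 V1 \<psi>1 where *: "(U1, \<phi>1) \<in> atlas X" "(V1, \<psi>1) \<in> atlas Y" "x \<in> U1" "U1 \<subseteq> W" "F ` U1 \<subseteq> V1"
    "chart_smooth (mdim X) \<phi>1 U1 (mdim Y) (\<lambda>x. \<psi>1 (F x))"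
    using smooth_on_open_chartsE[OF X F] by metis
  let ?S = "S \<inter> U1"
  have op: "openin (mtop X) ?S" using S(1) atlas_openin[OF X *(1)] by auto
  have im: "openin (Euclidean_space (mdim X)) (\<phi> ` ?S)" "openin (Euclidean_space (mdim X)) (\<phi>1 ` ?S)"
    using S(2) by (auto intro!: atlas_image_openin[OF X U op] atlas_image_openin[OF X *(1) op])
  have imV: "openin (Euclidean_space (mdim Y)) (\<psi>1 ` (V1 \<inter> V))"
    using atlas_openin[OF Y *(2)] atlas_openin[OF Y V] by (intro atlas_image_openin[OF Y *(2)]) auto
  have "chart_smooth (mdim X) \<phi>1 ?S (mdim Y) (\<lambda>x. \<psi>1 (F x))"
    by (rule chart_smooth_subset[OF *(6)]) auto
  then have 1: "chart_smooth (mdim X) \<phi>1 ?S (mdim Y) (\<lambda>x. \<psi> (F x))"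
    by (rule chart_smooth_compose[OF im(2) imV _ atlas_smooth_transition[OF Y *(2) V]])
       (use *(5) S(4) in auto)
  have 2: "chart_smooth (mdim X) \<phi> ?S (mdim X) \<phi>1"
    by (rule chart_smooth_subset[OF atlas_smooth_transition[OF X U *(1)]]) (use S(2) in auto)
  have "chart_smooth (mdim X) \<phi> ?S (mdim Y) (\<lambda>x. \<psi> (F x))"
    by (rule chart_smooth_change[OF im 2 1 subset_refl])
  then show "\<exists>S'\<subseteq>S. x \<in> S' \<and> openin (Euclidean_space (mdim X)) (\<phi> ` S') \<and>
      chart_smooth (mdim X) \<phi> S' (mdim Y) (\<lambda>x. \<psi> (F x))"
    using x *(3) im(1) by (intro exI[of _ ?S]) auto
qed

lemma smooth_on_open_subset:
  assumes X: "smooth_structure X" and Y: "smooth_structure Y" and F: "smooth_on_open X W Y F"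
    and W': "openin (mtop X) W'" "W' \<subseteq> W"
  shows "smooth_on_open X W' Y F"
proof (rule smooth_on_openI[OF X W'(1)])
  show "F x \<in> pts Y" if "x \<in> W'" for x
    using that W'(2) smooth_on_open_image[OF F] by blast
  fix a assume a: "a \<in> W'"
  then have "a \<in> W" using W'(2) by blast
  then obtain U \<phi> V \<psi> where *: "(U, \<phi>) \<in> atlas X" "(V, \<psi>) \<in> atlas Y" "a \<in> U" "U \<subseteq> W" "F ` U \<subseteq> V"
    "chart_smooth (mdim X) \<phi> U (mdim Y) (\<lambda>x. \<psi> (F x))"
    using smooth_on_open_chartsE[OF X F] by metis
  have op: "openin (mtop X) (U \<inter> W')" using atlas_openin[OF X *(1)] W'(1) by auto
  show "\<exists>U \<phi> V \<psi>. (U, \<phi>) \<in> atlas X \<and> (V, \<psi>) \<in> atlas Y \<and> a \<in> U \<and> U \<subseteq> W' \<and>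
      F ` U \<subseteq> V \<and> chart_smooth (mdim X) \<phi> U (mdim Y) (\<lambda>x. \<psi> (F x))"
    using * a atlas_subset[OF X *(1) op] chart_smooth_subset[OF *(6), of "U \<inter> W'"]
    by (intro exI[of _ "U \<inter> W'"] exI[of _ \<phi>] exI[of _ V] exI[of _ \<psi>]) auto
qed

lemma smooth_on_open_compose:
  assumes X: "smooth_structure X" and Y: "smooth_structure Y" and Z: "smooth_structure Z"
    and F: "smooth_on_open X W Y F" and G: "smooth_on_open Y W' Z G"
  shows "smooth_on_open X {x \<in> W. F x \<in> W'} Z (\<lambda>x. G (F x))"
proof (rule smooth_on_openI[OF X])
  show "openin (mtop X) {x \<in> W. F x \<in> W'}"
    by (rule smooth_on_open_preimage_openin[OF X Y F smooth_on_open_openin[OF G]])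
  show "G (F x) \<in> pts Z" if "x \<in> {x \<in> W. F x \<in> W'}" for x
    using that smooth_on_open_image[OF G] by blast
  fix a assume a: "a \<in> {x \<in> W. F x \<in> W'}"
  then have "F a \<in> W'" by simp
  then obtain V \<psi> V' \<xi> where *: "(V, \<psi>) \<in> atlas Y" "(V', \<xi>) \<in> atlas Z" "F a \<in> V" "V \<subseteq> W'" "G ` V \<subseteq> V'"
    "chart_smooth (mdim Y) \<psi> V (mdim Z) (\<lambda>y. \<xi> (G y))"
    using smooth_on_open_chartsE[OF Y G] by metis
  have "a \<in> pts X" using a openin_subset[OF smooth_on_open_openin[OF F]] by auto
  then obtain U0 \<phi> where U0: "(U0, \<phi>) \<in> atlas X" "a \<in> U0"
    using chart_at[OF X] by metis
  define U where "U = U0 \<inter> {x \<in> W. F x \<in> V}"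
  have Uop: "openin (mtop X) U"
    unfolding U_def using atlas_openin[OF X U0(1)] atlas_openin[OF Y *(1)]
    by (intro openin_Int smooth_on_open_preimage_openin[OF X Y F]) auto
  have U: "(U, \<phi>) \<in> atlas X"
    by (rule atlas_subset[OF X U0(1) Uop]) (auto simp: U_def)
  have "chart_smooth (mdim X) \<phi> U (mdim Y) (\<lambda>x. \<psi> (F x))"
    by (rule smooth_on_open_in_charts[OF X Y F U *(1) Uop subset_refl]) (auto simp: U_def)
  then have "chart_smooth (mdim X) \<phi> U (mdim Z) (\<lambda>x. \<xi> (G (F x)))"
    by (rule chart_smooth_compose[OF atlas_image_openin[OF X U Uop subset_refl]
          atlas_image_openin[OF Y *(1) atlas_openin[OF Y *(1)] subset_refl] _ *(6)])
       (auto simp: U_def)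
  then show "\<exists>U \<phi> V \<psi>. (U, \<phi>) \<in> atlas X \<and> (V, \<psi>) \<in> atlas Z \<and> a \<in> U \<and> U \<subseteq> {x \<in> W. F x \<in> W'} \<and>
      (\<lambda>x. G (F x)) ` U \<subseteq> V \<and> chart_smooth (mdim X) \<phi> U (mdim Z) (\<lambda>x. \<psi> (G (F x)))"
    using U *(2-5) a U0(2)
    by (intro exI[of _ U] exI[of _ \<phi>] exI[of _ V'] exI[of _ \<xi>]) (auto simp: U_def)
qed

lemma smooth_map_image: "smooth_map X A Y F \<Longrightarrow> x \<in> A \<Longrightarrow> F x \<in> pts Y"
  by (auto simp: smooth_map_def)

lemma smooth_mapE:
  assumes "smooth_map X A Y F" "a \<in> A"
  obtains W G where "a \<in> W" "smooth_on_open X W Y G" "\<And>x. x \<in> A \<Longrightarrow> x \<in> W \<Longrightarrow> F x = G x"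
  using assms unfolding smooth_map_def by (metis IntI)

lemma smooth_mapI:
  assumes "A \<subseteq> pts X" "\<And>x. x \<in> A \<Longrightarrow> F x \<in> pts Y"
    and "\<And>a. a \<in> A \<Longrightarrow> \<exists>W G. a \<in> W \<and> smooth_on_open X W Y G \<and> (\<forall>x\<in>A \<inter> W. F x = G x)"
  shows "smooth_map X A Y F"
  using assms unfolding smooth_map_def by auto

lemma smooth_map_cong:
  assumes "smooth_map X A Y F" "\<And>x. x \<in> A \<Longrightarrow> F x = G x"
  shows "smooth_map X A Y G"
  using assms unfolding smooth_map_def by (simp add: image_subset_iff)

lemma smooth_map_compose:
  assumes X: "smooth_structure X" and Y: "smooth_structure Y" and Z: "smooth_structure Z"
    and F: "smooth_map X A Y F" and G: "smooth_map Y B Z G" and FB: "\<And>x. x \<in> A \<Longrightarrow> F x \<in> B"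
  shows "smooth_map X A Z (\<lambda>x. G (F x))"
proof (rule smooth_mapI)
  show "A \<subseteq> pts X" using F by (simp add: smooth_map_def)
  show "G (F x) \<in> pts Z" if "x \<in> A" for x using that FB smooth_map_image[OF G] by blast
  fix a assume a: "a \<in> A"
  obtain W F' where F': "a \<in> W" "smooth_on_open X W Y F'" "\<And>x. x \<in> A \<Longrightarrow> x \<in> W \<Longrightarrow> F x = F' x"
    using smooth_mapE[OF F a] by metis
  obtain W' G' where G': "F a \<in> W'" "smooth_on_open Y W' Z G'" "\<And>y. y \<in> B \<Longrightarrow> y \<in> W' \<Longrightarrow> G y = G' y"
    using smooth_mapE[OF G FB[OF a]] by metis
  have "G (F x) = G' (F' x)" if "x \<in> A" "x \<in> W" "F' x \<in> W'" for x
    using F'(3)[OF that(1,2)] G'(3)[OF FB[OF that(1)]] that(3) by simp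
  then show "\<exists>W H. a \<in> W \<and> smooth_on_open X W Z H \<and> (\<forall>x\<in>A \<inter> W. G (F x) = H x)"
    using smooth_on_open_compose[OF X Y Z F'(2) G'(2)] F'(1,3) G'(1) a
    by (intro exI[of _ "{x \<in> W. F' x \<in> W'}"] exI[of _ "\<lambda>x. G' (F' x)"]) auto
qed

text \<open>
  The maps that witness smoothness on \<open>A \<inter> O'\<close> are restricted to the open set \<open>O'\<close>, so as to
  agree with \<open>F\<close> on all points of \<open>A\<close> in their domain.
\<close>

lemma smooth_map_local:
  assumes X: "smooth_structure X" and Y: "smooth_structure Y"
    and "A \<subseteq> pts X" "\<And>a. a \<in> A \<Longrightarrow> \<exists>O'. a \<in> O' \<and> openin (mtop X) O' \<and> smooth_map X (A \<inter> O') Y F"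
  shows "smooth_map X A Y F"
proof (rule smooth_mapI[OF assms(3)])
  fix a assume a: "a \<in> A"
  then obtain O' where O': "a \<in> O'" "openin (mtop X) O'" "smooth_map X (A \<inter> O') Y F"
    using assms(4) by blast
  then show "F a \<in> pts Y" using a smooth_map_image by fastforce
  obtain W G where G: "a \<in> W" "smooth_on_open X W Y G" "\<And>x. x \<in> A \<inter> O' \<Longrightarrow> x \<in> W \<Longrightarrow> F x = G x"
    using smooth_mapE[OF O'(3), of a] a O'(1) by auto
  have "smooth_on_open X (W \<inter> O') Y G"
    using O'(2) smooth_on_open_openin[OF G(2)] by (intro smooth_on_open_subset[OF X Y G(2)]) auto
  then show "\<exists>W G. a \<in> W \<and> smooth_on_open X W Y G \<and> (\<forall>x\<in>A \<inter> W. F x = G x)"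
    using G O'(1) by (intro exI[of _ "W \<inter> O'"] exI[of _ G]) auto
qed

lemma smooth_map_id:
  assumes X: "smooth_structure X" and "A \<subseteq> pts X"
  shows "smooth_map X A X (\<lambda>x. x)"
proof -
  have "smooth_on_open X (pts X) X (\<lambda>x. x)"
  proof (rule smooth_on_openI[OF X])
    fix a assume a: "a \<in> pts X"
    obtain U \<phi> where U: "(U, \<phi>) \<in> atlas X" "a \<in> U" using chart_at[OF X a] .
    show "\<exists>U \<phi> V \<psi>. (U, \<phi>) \<in> atlas X \<and> (V, \<psi>) \<in> atlas X \<and> a \<in> U \<and> U \<subseteq> pts X \<and> (\<lambda>x. x) ` U \<subseteq> V \<and>
      chart_smooth (mdim X) \<phi> U (mdim X) (\<lambda>x. \<psi> x)"
      using U chart_smooth_id[OF atlas_image_openin[OF X U(1) atlas_openin[OF X U(1)] subset_refl]]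
        openin_subset[OF atlas_openin[OF X U(1)]]
      by (intro exI[of _ U] exI[of _ \<phi>]) auto
  qed auto
  then show ?thesis using assms(2) by (intro smooth_mapI) auto
qed

lemma smooth_map_const:
  assumes X: "smooth_structure X" and Y: "smooth_structure Y" and "A \<subseteq> pts X" and c: "c \<in> pts Y"
  shows "smooth_map X A Y (\<lambda>_. c)"
proof -
  obtain V \<psi> where V: "(V, \<psi>) \<in> atlas Y" "c \<in> V" using chart_at[OF Y c] .
  have "smooth_on_open X (pts X) Y (\<lambda>_. c)"
  proof (rule smooth_on_openI[OF X])
    fix a assume a: "a \<in> pts X"
    obtain U \<phi> where U: "(U, \<phi>) \<in> atlas X" "a \<in> U" using chart_at[OF X a] .
    have "chart_smooth (mdim X) \<phi> U (mdim Y) (\<lambda>_. \<psi> c)"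
      by (intro chart_smooth_const is_chart_image[OF atlas_is_chart[OF Y V(1)] V(2)])
    then show "\<exists>U \<phi> V \<psi>. (U, \<phi>) \<in> atlas X \<and> (V, \<psi>) \<in> atlas Y \<and> a \<in> U \<and> U \<subseteq> pts X \<and> (\<lambda>x. c) ` U \<subseteq> V \<and>
      chart_smooth (mdim X) \<phi> U (mdim Y) (\<lambda>x. \<psi> c)"
      using U V openin_subset[OF atlas_openin[OF X U(1)]]
      by (intro exI[of _ U] exI[of _ \<phi>] exI[of _ V] exI[of _ \<psi>]) auto
  qed (use c in auto)
  then show ?thesis using assms(3) c by (intro smooth_mapI) auto
qed

section \<open>Products and the multiplicative group\<close>

text \<open>
  The identification of pairs of points of Euclidean m-space and n-space with points of Euclidean
  (m+n)-space that product charts use, and its two projections.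
\<close>

definition euclid_join :: "nat \<Rightarrow> (nat \<Rightarrow> real) \<Rightarrow> (nat \<Rightarrow> real) \<Rightarrow> (nat \<Rightarrow> real)" where
  "euclid_join m u v = (\<lambda>i. if i < m then u i else v (i - m))"

definition euclid_left :: "nat \<Rightarrow> (nat \<Rightarrow> real) \<Rightarrow> (nat \<Rightarrow> real)" where
  "euclid_left m z = (\<lambda>i. if i < m then z i else 0)"

definition euclid_right :: "nat \<Rightarrow> (nat \<Rightarrow> real) \<Rightarrow> (nat \<Rightarrow> real)" where
  "euclid_right m z = (\<lambda>i. z (i + m))"

lemma euclid_join_in:
  "v \<in> topspace (Euclidean_space n) \<Longrightarrow> euclid_join m u v \<in> topspace (Euclidean_space (m + n))"
  by (auto simp: topspace_Euclidean_space euclid_join_def)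

lemma euclid_left_in: "euclid_left m z \<in> topspace (Euclidean_space m)"
  by (auto simp: topspace_Euclidean_space euclid_left_def)

lemma euclid_right_in:
  "z \<in> topspace (Euclidean_space (m + n)) \<Longrightarrow> euclid_right m z \<in> topspace (Euclidean_space n)"
  by (auto simp: topspace_Euclidean_space euclid_right_def)

lemma euclid_left_join:
  "u \<in> topspace (Euclidean_space m) \<Longrightarrow> euclid_left m (euclid_join m u v) = u"
  by (auto simp: topspace_Euclidean_space euclid_left_def euclid_join_def fun_eq_iff)

lemma euclid_right_join: "euclid_right m (euclid_join m u v) = v"
  by (auto simp: euclid_right_def euclid_join_def fun_eq_iff)

lemma euclid_join_left_right: "euclid_join m (euclid_left m z) (euclid_right m z) = z"
  by (auto simp: euclid_right_def euclid_left_def euclid_join_def fun_eq_iff)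

lemma Cinf_on_euclid_left:
  "openin (Euclidean_space n) U \<Longrightarrow> Cinf_on n m U (euclid_left m)"
  using euclid_left_in
  by (intro Cinf_onI) (simp_all add: euclid_left_def Ck_on_coordinate)

lemma Cinf_on_euclid_right:
  "openin (Euclidean_space (m + n)) U \<Longrightarrow> Cinf_on (m + n) n U (euclid_right m)"
  using euclid_right_in openin_Euclidean_space_subset
  by (intro Cinf_onI) (blast, simp add: euclid_right_def Ck_on_coordinate)

lemma chart_smooth_join:
  assumes "chart_smooth k \<phi> S m f" "chart_smooth k \<phi> S n g"
  shows "chart_smooth k \<phi> S (m + n) (\<lambda>x. euclid_join m (f x) (g x))"
proof -
  obtain H where H: "Cinf_on k m (\<phi> ` S) H" "\<And>x. x \<in> S \<Longrightarrow> H (\<phi> x) = f x"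
    using assms(1) by (auto simp: chart_smooth_def)
  obtain K where K: "Cinf_on k n (\<phi> ` S) K" "\<And>x. x \<in> S \<Longrightarrow> K (\<phi> x) = g x"
    using assms(2) by (auto simp: chart_smooth_def)
  have "Cinf_on k (m + n) (\<phi> ` S) (\<lambda>z. euclid_join m (H z) (K z))"
  proof (rule Cinf_onI)
    show "euclid_join m (H z) (K z) \<in> topspace (Euclidean_space (m + n))" if "z \<in> \<phi> ` S" for z
      using Cinf_on_image[OF K(1) that] by (rule euclid_join_in)
    show "Ck_on l k (\<phi> ` S) (\<lambda>z. euclid_join m (H z) (K z) j)" if "j < m + n" for j l
      using that H(1) K(1) by (cases "j < m") (simp_all add: euclid_join_def Cinf_on_def)
  qed
  then show ?thesis
    unfolding chart_smooth_def using H(2) K(2)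
    by (intro exI[of _ "\<lambda>z. euclid_join m (H z) (K z)"]) simp
qed

lemma prod_chart_eq:
  "prod_chart m (U, \<phi>) (V, \<psi>) = (U \<times> V, \<lambda>x. euclid_join m (\<phi> (fst x)) (\<psi> (snd x)))"
  by (auto simp: prod_chart_def euclid_join_def fun_eq_iff)

lemma is_chart_prod_chart:
  assumes c: "is_chart T m (U, \<phi>)" and d: "is_chart T' n (V, \<psi>)"
  shows "is_chart (prod_topology T T') (m + n) (prod_chart m (U, \<phi>) (V, \<psi>))"
proof -
  let ?j = "\<lambda>x. euclid_join m (\<phi> (fst x)) (\<psi> (snd x))"
  let ?E = "Euclidean_space (m + n)"
  define I where "I = {z \<in> topspace ?E. euclid_left m z \<in> \<phi> ` U \<and> euclid_right m z \<in> \<psi> ` V}"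
  have UV: "openin T U" "openin T' V" "openin (Euclidean_space m) (\<phi> ` U)" "openin (Euclidean_space n) (\<psi> ` V)"
    using c d by (auto simp: is_chart_def)
  have cl: "continuous_map ?E (Euclidean_space m) (euclid_left m)"
    using Cinf_on_continuous_map[OF openin_topspace Cinf_on_euclid_left[OF openin_topspace]] by simp
  have cr: "continuous_map ?E (Euclidean_space n) (euclid_right m)"
    using Cinf_on_continuous_map[OF openin_topspace Cinf_on_euclid_right[OF openin_topspace]] by simp
  have "I = {z \<in> topspace ?E. euclid_left m z \<in> \<phi> ` U} \<inter> {z \<in> topspace ?E. euclid_right m z \<in> \<psi> ` V}"
    by (auto simp: I_def)
  then have I: "openin ?E I"
    using openin_continuous_map_preimage[OF cl UV(3)] openin_continuous_map_preimage[OF cr UV(4)]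
    by auto
  have img: "?j ` (U \<times> V) = I"
  proof
    show "?j ` (U \<times> V) \<subseteq> I"
      using is_chart_image[OF c] is_chart_image[OF d]
      by (auto simp: I_def euclid_join_in euclid_left_join euclid_right_join)
    show "I \<subseteq> ?j ` (U \<times> V)"
    proof
      fix z assume "z \<in> I"
      then obtain u v where uv: "u \<in> U" "v \<in> V" "euclid_left m z = \<phi> u" "euclid_right m z = \<psi> v"
        by (auto simp: I_def)
      then have "z = ?j (u, v)" using euclid_join_left_right[of m z] by simp
      then show "z \<in> ?j ` (U \<times> V)" using uv by blast
    qed
  qed
  obtain f where f: "homeomorphic_maps (subtopology T U) (subtopology (Euclidean_space m) (\<phi> ` U)) \<phi> f"
    using c homeomorphic_map_maps unfolding is_chart_def by blast
  obtain g where g: "homeomorphic_maps (subtopology T' V) (subtopology (Euclidean_space n) (\<psi> ` V)) \<psi> g"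
    using d homeomorphic_map_maps unfolding is_chart_def by blast
  have tops: "topspace T \<inter> U = U" "topspace T' \<inter> V = V"
    using openin_subset[OF UV(1)] openin_subset[OF UV(2)] by auto
  have "homeomorphic_maps (subtopology (prod_topology T T') (U \<times> V)) (subtopology ?E I) ?j
      (\<lambda>z. (f (euclid_left m z), g (euclid_right m z)))"
    unfolding homeomorphic_maps_def
  proof (intro conjI ballI)
    let ?P = "prod_topology (subtopology T U) (subtopology T' V)"
    have P: "subtopology (prod_topology T T') (U \<times> V) = ?P"
      by (simp add: subtopology_Times)
    have 1: "continuous_map ?P (Euclidean_space m) (\<lambda>x. \<phi> (fst x))"
      using continuous_map_compose[OF continuous_map_fst is_chart_continuous[OF c]] by (simp add: comp_def)
    have 2: "continuous_map ?P (Euclidean_space n) (\<lambda>x. \<psi> (snd x))"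
      using continuous_map_compose[OF continuous_map_snd is_chart_continuous[OF d]] by (simp add: comp_def)
    have "continuous_map ?P ?E ?j"
    proof -
      have "continuous_map ?P euclideanreal (\<lambda>x. euclid_join m (\<phi> (fst x)) (\<psi> (snd x)) i)" for i
        using 1 2 unfolding Euclidean_space_def continuous_map_in_subtopology continuous_map_componentwise_UNIV
        by (simp add: euclid_join_def)
      moreover have "?j \<in> topspace ?P \<rightarrow> topspace ?E"
        using is_chart_image[OF d] by (auto intro!: euclid_join_in)
      ultimately show ?thesis
        unfolding Euclidean_space_def continuous_map_in_subtopology continuous_map_componentwise_UNIV
        by (auto simp: topspace_Euclidean_space)
    qed
    moreover have "?j \<in> topspace ?P \<rightarrow> I"
      using img by auto
    ultimately show "continuous_map (subtopology (prod_topology T T') (U \<times> V)) (subtopology ?E I) ?j"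
      unfolding P continuous_map_in_subtopology by auto
    have l: "continuous_map (subtopology ?E I) (subtopology (Euclidean_space m) (\<phi> ` U)) (euclid_left m)"
      using cl by (auto simp: continuous_map_in_subtopology I_def intro: continuous_map_from_subtopology)
    have r: "continuous_map (subtopology ?E I) (subtopology (Euclidean_space n) (\<psi> ` V)) (euclid_right m)"
      using cr by (auto simp: continuous_map_in_subtopology I_def intro: continuous_map_from_subtopology)
    have "continuous_map (subtopology ?E I) (subtopology T U) (f \<circ> euclid_left m)"
      using f by (intro continuous_map_compose[OF l]) (simp add: homeomorphic_maps_def)
    moreover have "continuous_map (subtopology ?E I) (subtopology T' V) (g \<circ> euclid_right m)"
      using g by (intro continuous_map_compose[OF r]) (simp add: homeomorphic_maps_def)
    ultimately show "continuous_map (subtopology ?E I) (subtopology (prod_topology T T') (U \<times> V))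
        (\<lambda>z. (f (euclid_left m z), g (euclid_right m z)))"
      unfolding P by (simp add: continuous_map_pairwise comp_def)
    show "(f (euclid_left m (?j x)), g (euclid_right m (?j x))) = x"
      if "x \<in> topspace (subtopology (prod_topology T T') (U \<times> V))" for x
      using that f g is_chart_image[OF c] tops unfolding homeomorphic_maps_def
      by (auto simp: euclid_left_join euclid_right_join)
    show "?j (f (euclid_left m z), g (euclid_right m z)) = z"
      if "z \<in> topspace (subtopology ?E I)" for z
    proof -
      have "euclid_left m z \<in> topspace (subtopology (Euclidean_space m) (\<phi> ` U))"
        "euclid_right m z \<in> topspace (subtopology (Euclidean_space n) (\<psi> ` V))"
        using that euclid_left_in euclid_right_in by (auto simp: I_def)
      then have "\<phi> (f (euclid_left m z)) = euclid_left m z" "\<psi> (g (euclid_right m z)) = euclid_right m z"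
        using f g unfolding homeomorphic_maps_def by blast+
      then show ?thesis by (simp add: euclid_join_left_right)
    qed
  qed
  then have "homeomorphic_map (subtopology (prod_topology T T') (U \<times> V)) (subtopology ?E I) ?j"
    using homeomorphic_map_maps by blast
  then show ?thesis
    using UV I img unfolding prod_chart_eq is_chart_def by (simp add: openin_prod_Times_iff)
qed

context
  fixes X :: "'a mfd" and Y :: "'b mfd"
  assumes X: "smooth_structure X" and Y: "smooth_structure Y"
begin

lemma mtop_prod_mfd: "mtop (prod_mfd X Y) = prod_topology (mtop X) (mtop Y)"
  and mdim_prod_mfd: "mdim (prod_mfd X Y) = mdim X + mdim Y"
  by (simp_all add: prod_mfd_def)

abbreviation "join_chart \<phi> \<psi> \<equiv> \<lambda>x. euclid_join (mdim X) (\<phi> (fst x)) (\<psi> (snd x))"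

lemma join_chart_image_openin:
  assumes "(U, \<phi>) \<in> atlas X" "(V, \<psi>) \<in> atlas Y"
    and "openin (prod_topology (mtop X) (mtop Y)) S" "S \<subseteq> U \<times> V"
  shows "openin (Euclidean_space (mdim X + mdim Y)) (join_chart \<phi> \<psi> ` S)"
  using is_chart_image_openin[OF is_chart_prod_chart[OF atlas_is_chart[OF X assms(1)] atlas_is_chart[OF Y assms(2)],
      unfolded prod_chart_eq] assms(3,4)] .

lemma chart_smooth_fst_snd:
  assumes U: "(U, \<phi>) \<in> atlas X" and V: "(V, \<psi>) \<in> atlas Y"
    and S: "openin (prod_topology (mtop X) (mtop Y)) S" "S \<subseteq> U \<times> V"
  shows "chart_smooth (mdim X + mdim Y) (join_chart \<phi> \<psi>) S (mdim X) (\<lambda>x. \<phi> (fst x))"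
    and "chart_smooth (mdim X + mdim Y) (join_chart \<phi> \<psi>) S (mdim Y) (\<lambda>x. \<psi> (snd x))"
proof -
  note op = join_chart_image_openin[OF U V S]
  show "chart_smooth (mdim X + mdim Y) (join_chart \<phi> \<psi>) S (mdim X) (\<lambda>x. \<phi> (fst x))"
    unfolding chart_smooth_def
    using Cinf_on_euclid_left[OF op] is_chart_image[OF atlas_is_chart[OF X U]] S(2)
    by (intro exI[of _ "euclid_left (mdim X)"]) (auto intro!: euclid_left_join)
  show "chart_smooth (mdim X + mdim Y) (join_chart \<phi> \<psi>) S (mdim Y) (\<lambda>x. \<psi> (snd x))"
    unfolding chart_smooth_def
    using Cinf_on_euclid_right[OF op]
    by (intro exI[of _ "euclid_right (mdim X)"]) (simp add: euclid_right_join)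
qed

text \<open>
  Transitions between product charts are pairs of transitions, each composed with a projection.
\<close>

lemma prod_mfd_structure: "smooth_structure (prod_mfd X Y)"
  and prod_mfd_atlas: "\<lbrakk>(U, \<phi>) \<in> atlas X; (V, \<psi>) \<in> atlas Y\<rbrakk> \<Longrightarrow> (U \<times> V, join_chart \<phi> \<psi>) \<in> atlas (prod_mfd X Y)"
proof -
  let ?B = "{prod_chart (mdim X) c d |c d. c \<in> atlas X \<and> d \<in> atlas Y}"
  have BE: "\<exists>U \<phi> V \<psi>. (U, \<phi>) \<in> atlas X \<and> (V, \<psi>) \<in> atlas Y \<and> W = U \<times> V \<and> \<beta> = join_chart \<phi> \<psi>"
    if "(W, \<beta>) \<in> ?B" for W \<beta>
    using that by (auto simp: prod_chart_eq)
  have BI: "(U \<times> V, join_chart \<phi> \<psi>) \<in> ?B" if "(U, \<phi>) \<in> atlas X" "(V, \<psi>) \<in> atlas Y" for U \<phi> V \<psi>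
    using that prod_chart_eq[of "mdim X" U \<phi> V \<psi>] by (intro CollectI exI conjI) auto
  have 1: "is_chart (prod_topology (mtop X) (mtop Y)) (mdim X + mdim Y) (W, \<beta>)" if "(W, \<beta>) \<in> ?B" for W \<beta>
    using that is_chart_prod_chart atlas_is_chart[OF X] atlas_is_chart[OF Y] by fastforce
  have 2: "chart_smooth (mdim X + mdim Y) \<beta> (W \<inter> W') (mdim X + mdim Y) \<beta>'"
    if W: "(W, \<beta>) \<in> ?B" and W': "(W', \<beta>') \<in> ?B" for W \<beta> W' \<beta>'
  proof -
    obtain U \<phi> V \<psi> where c: "(U, \<phi>) \<in> atlas X" "(V, \<psi>) \<in> atlas Y" "W = U \<times> V" "\<beta> = join_chart \<phi> \<psi>"
      using BE[OF W] by blast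
    obtain U' \<phi>' V' \<psi>' where c': "(U', \<phi>') \<in> atlas X" "(V', \<psi>') \<in> atlas Y" "W' = U' \<times> V'" "\<beta>' = join_chart \<phi>' \<psi>'"
      using BE[OF W'] by blast
    have S: "openin (prod_topology (mtop X) (mtop Y)) (W \<inter> W')" "W \<inter> W' \<subseteq> U \<times> V"
      using is_chart_openin[OF 1[OF W]] is_chart_openin[OF 1[OF W']] c(3) by auto
    note op = join_chart_image_openin[OF c(1,2) S]
    have UU: "openin (Euclidean_space (mdim X)) (\<phi> ` (U \<inter> U'))"
      using atlas_openin[OF X c(1)] atlas_openin[OF X c'(1)] by (intro atlas_image_openin[OF X c(1)]) auto
    have VV: "openin (Euclidean_space (mdim Y)) (\<psi> ` (V \<inter> V'))"
      using atlas_openin[OF Y c(2)] atlas_openin[OF Y c'(2)] by (intro atlas_image_openin[OF Y c(2)]) auto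
    have "chart_smooth (mdim X + mdim Y) \<beta> (W \<inter> W') (mdim X) (\<lambda>x. \<phi>' (fst x))"
      unfolding c(4)
      by (rule chart_smooth_compose[OF op UU chart_smooth_fst_snd(1)[OF c(1,2) S] atlas_smooth_transition[OF X c(1) c'(1)]])
         (auto simp: c(3) c'(3))
    moreover have "chart_smooth (mdim X + mdim Y) \<beta> (W \<inter> W') (mdim Y) (\<lambda>x. \<psi>' (snd x))"
      unfolding c(4)
      by (rule chart_smooth_compose[OF op VV chart_smooth_fst_snd(2)[OF c(1,2) S] atlas_smooth_transition[OF Y c(2) c'(2)]])
         (auto simp: c(3) c'(3))
    ultimately show ?thesis unfolding c'(4) by (rule chart_smooth_join)
  qed
  have 3: "\<exists>(W, \<beta>)\<in>?B. x \<in> W" if "x \<in> topspace (prod_topology (mtop X) (mtop Y))" for x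
  proof -
    have "fst x \<in> pts X" "snd x \<in> pts Y" using that by auto
    then obtain U \<phi> V \<psi> where U: "(U, \<phi>) \<in> atlas X" "fst x \<in> U" and V: "(V, \<psi>) \<in> atlas Y" "snd x \<in> V"
      using chart_at[OF X] chart_at[OF Y] by metis
    show ?thesis
      using BI[OF U(1) V(1)] U(2) V(2) by (intro bexI[of _ "(U \<times> V, join_chart \<phi> \<psi>)"]) (auto simp: mem_Times_iff)
  qed
  have at: "atlas (prod_mfd X Y) = compatible_charts (prod_topology (mtop X) (mtop Y)) (mdim X + mdim Y) ?B"
    by (simp add: prod_mfd_def)
  note gen = smooth_structure_generated[OF mtop_prod_mfd mdim_prod_mfd at 1 2 3]
  show "smooth_structure (prod_mfd X Y)" by (rule gen(1))
  show "(U \<times> V, join_chart \<phi> \<psi>) \<in> atlas (prod_mfd X Y)" if "(U, \<phi>) \<in> atlas X" "(V, \<psi>) \<in> atlas Y"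
    using gen(2) BI[OF that] by blast
qed

lemma smooth_map_snd: "smooth_map (prod_mfd X Y) (pts X \<times> pts Y) Y snd"
proof -
  have pts: "pts (prod_mfd X Y) = pts X \<times> pts Y" by (simp add: mtop_prod_mfd)
  have charts: "\<exists>U \<phi> V \<psi>. (U, \<phi>) \<in> atlas X \<and> (V, \<psi>) \<in> atlas Y \<and> a \<in> U \<times> V \<and> U \<times> V \<subseteq> pts X \<times> pts Y \<and>
      (U \<times> V, join_chart \<phi> \<psi>) \<in> atlas (prod_mfd X Y) \<and> openin (prod_topology (mtop X) (mtop Y)) (U \<times> V)"
    if "a \<in> pts X \<times> pts Y" for a
  proof -
    have "fst a \<in> pts X" "snd a \<in> pts Y" using that by auto
    then obtain U \<phi> V \<psi> where U: "(U, \<phi>) \<in> atlas X" "fst a \<in> U" and V: "(V, \<psi>) \<in> atlas Y" "snd a \<in> V"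
      using chart_at[OF X] chart_at[OF Y] by metis
    show ?thesis
      using U V atlas_openin[OF X U(1)] atlas_openin[OF Y V(1)] prod_mfd_atlas[OF U(1) V(1)]
        openin_subset[of "mtop X"] openin_subset[of "mtop Y"]
      by (intro exI[of _ U] exI[of _ \<phi>] exI[of _ V] exI[of _ \<psi>])
         (auto simp: mem_Times_iff openin_prod_Times_iff)
  qed
  have "smooth_on_open (prod_mfd X Y) (pts X \<times> pts Y) Y snd"
  proof (rule smooth_on_openI[OF prod_mfd_structure])
    fix a assume "a \<in> pts X \<times> pts Y"
    then obtain U \<phi> V \<psi> where c: "(U, \<phi>) \<in> atlas X" "(V, \<psi>) \<in> atlas Y" "a \<in> U \<times> V" "U \<times> V \<subseteq> pts X \<times> pts Y"
      "(U \<times> V, join_chart \<phi> \<psi>) \<in> atlas (prod_mfd X Y)" "openin (prod_topology (mtop X) (mtop Y)) (U \<times> V)"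
      using charts by blast
    show "\<exists>W \<beta> V \<psi>. (W, \<beta>) \<in> atlas (prod_mfd X Y) \<and> (V, \<psi>) \<in> atlas Y \<and> a \<in> W \<and> W \<subseteq> pts X \<times> pts Y \<and> snd ` W \<subseteq> V \<and>
        chart_smooth (mdim (prod_mfd X Y)) \<beta> W (mdim Y) (\<lambda>x. \<psi> (snd x))"
      using c chart_smooth_fst_snd(2)[OF c(1,2,6) subset_refl] unfolding mdim_prod_mfd
      by (intro exI[of _ "U \<times> V"] exI[of _ "join_chart \<phi> \<psi>"] exI[of _ V] exI[of _ \<psi>]) auto
  qed (auto simp: mtop_prod_mfd openin_prod_Times_iff)
  then show "smooth_map (prod_mfd X Y) (pts X \<times> pts Y) Y snd"
    by (intro smooth_mapI) (auto simp: pts)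
qed

lemma smooth_on_open_Pair:
  assumes Z: "smooth_structure Z" and F: "smooth_on_open Z W X F" and G: "smooth_on_open Z W Y G"
  shows "smooth_on_open Z W (prod_mfd X Y) (\<lambda>x. (F x, G x))"
proof (rule smooth_on_openI[OF Z smooth_on_open_openin[OF F]])
  show "(F x, G x) \<in> pts (prod_mfd X Y)" if "x \<in> W" for x
    using smooth_on_open_image[OF F that] smooth_on_open_image[OF G that] by (simp add: mtop_prod_mfd)
  fix a assume a: "a \<in> W"
  have "a \<in> pts Z" using a openin_subset[OF smooth_on_open_openin[OF F]] by auto
  then obtain U0 \<phi> where U0: "(U0, \<phi>) \<in> atlas Z" "a \<in> U0" using chart_at[OF Z] by metis
  obtain V \<psi> where V: "(V, \<psi>) \<in> atlas X" "F a \<in> V" using chart_at[OF X smooth_on_open_image[OF F a]] .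
  obtain V' \<psi>' where V': "(V', \<psi>') \<in> atlas Y" "G a \<in> V'" using chart_at[OF Y smooth_on_open_image[OF G a]] .
  define U where "U = U0 \<inter> {x \<in> W. F x \<in> V} \<inter> {x \<in> W. G x \<in> V'}"
  have Uop: "openin (mtop Z) U"
    unfolding U_def using atlas_openin[OF Z U0(1)] atlas_openin[OF X V(1)] atlas_openin[OF Y V'(1)]
    by (intro openin_Int smooth_on_open_preimage_openin[OF Z X F] smooth_on_open_preimage_openin[OF Z Y G])
  have U: "(U, \<phi>) \<in> atlas Z"
    by (rule atlas_subset[OF Z U0(1) Uop]) (auto simp: U_def)
  have "chart_smooth (mdim Z) \<phi> U (mdim X) (\<lambda>x. \<psi> (F x))"
    by (rule smooth_on_open_in_charts[OF Z X F U V(1) Uop subset_refl]) (auto simp: U_def)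
  moreover have "chart_smooth (mdim Z) \<phi> U (mdim Y) (\<lambda>x. \<psi>' (G x))"
    by (rule smooth_on_open_in_charts[OF Z Y G U V'(1) Uop subset_refl]) (auto simp: U_def)
  ultimately have "chart_smooth (mdim Z) \<phi> U (mdim X + mdim Y) (\<lambda>x. euclid_join (mdim X) (\<psi> (F x)) (\<psi>' (G x)))"
    by (rule chart_smooth_join)
  then show "\<exists>U \<phi> V \<psi>. (U, \<phi>) \<in> atlas Z \<and> (V, \<psi>) \<in> atlas (prod_mfd X Y) \<and> a \<in> U \<and> U \<subseteq> W \<and>
      (\<lambda>x. (F x, G x)) ` U \<subseteq> V \<and>
      chart_smooth (mdim Z) \<phi> U (mdim (prod_mfd X Y)) (\<lambda>x. \<psi> (F x, G x))"
    using U a U0(2) V(2) V'(2) prod_mfd_atlas[OF V(1) V'(1)] unfolding mdim_prod_mfd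
    by (intro exI[of _ U] exI[of _ \<phi>] exI[of _ "V \<times> V'"] exI[of _ "join_chart \<psi> \<psi>'"])
       (auto simp: U_def)
qed

lemma smooth_map_Pair:
  assumes Z: "smooth_structure Z" and F: "smooth_map Z A X F" and G: "smooth_map Z A Y G"
  shows "smooth_map Z A (prod_mfd X Y) (\<lambda>x. (F x, G x))"
proof (rule smooth_mapI)
  show "A \<subseteq> pts Z" using F by (simp add: smooth_map_def)
  show "(F x, G x) \<in> pts (prod_mfd X Y)" if "x \<in> A" for x
    using smooth_map_image[OF F that] smooth_map_image[OF G that] by (simp add: mtop_prod_mfd)
  fix a assume a: "a \<in> A"
  obtain W F' where F': "a \<in> W" "smooth_on_open Z W X F'" "\<And>x. x \<in> A \<Longrightarrow> x \<in> W \<Longrightarrow> F x = F' x"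
    using smooth_mapE[OF F a] by metis
  obtain W' G' where G': "a \<in> W'" "smooth_on_open Z W' Y G'" "\<And>x. x \<in> A \<Longrightarrow> x \<in> W' \<Longrightarrow> G x = G' x"
    using smooth_mapE[OF G a] by metis
  have op: "openin (mtop Z) (W \<inter> W')"
    using smooth_on_open_openin[OF F'(2)] smooth_on_open_openin[OF G'(2)] by auto
  have "smooth_on_open Z (W \<inter> W') (prod_mfd X Y) (\<lambda>x. (F' x, G' x))"
    by (intro smooth_on_open_Pair[OF Z] smooth_on_open_subset[OF Z X F'(2) op]
        smooth_on_open_subset[OF Z Y G'(2) op]) auto
  then show "\<exists>W H. a \<in> W \<and> smooth_on_open Z W (prod_mfd X Y) H \<and> (\<forall>x\<in>A \<inter> W. (F x, G x) = H x)"
    using F'(1,3) G'(1,3) by (intro exI[of _ "W \<inter> W'"] exI[of _ "\<lambda>x. (F' x, G' x)"]) auto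
qed

end

definition Cstar_coords :: "complex \<Rightarrow> nat \<Rightarrow> real" where
  "Cstar_coords z = (\<lambda>i. if i = 0 then Re z else if i = 1 then Im z else 0)"

lemma Cstar_coords_image: "Cstar_coords ` (- {0}) = {x \<in> topspace (Euclidean_space 2). x 0 \<noteq> 0 \<or> x 1 \<noteq> 0}"
proof
  show "Cstar_coords ` (- {0}) \<subseteq> {x \<in> topspace (Euclidean_space 2). x 0 \<noteq> 0 \<or> x 1 \<noteq> 0}"
    by (auto simp: Cstar_coords_def topspace_Euclidean_space complex_eq_iff)
  show "{x \<in> topspace (Euclidean_space 2). x 0 \<noteq> 0 \<or> x 1 \<noteq> 0} \<subseteq> Cstar_coords ` (- {0})"
  proof
    fix x assume x: "x \<in> {x \<in> topspace (Euclidean_space 2). x 0 \<noteq> 0 \<or> x 1 \<noteq> 0}"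
    then have "x = Cstar_coords (Complex (x 0) (x 1))"
      by (auto simp: Cstar_coords_def topspace_Euclidean_space fun_eq_iff)
    moreover have "Complex (x 0) (x 1) \<in> - {0}" using x by (auto simp: complex_eq_iff)
    ultimately show "x \<in> Cstar_coords ` (- {0})" by blast
  qed
qed

lemma Cstar_coords_image_openin: "openin (Euclidean_space 2) (Cstar_coords ` (- {0}))"
proof -
  have "openin (Euclidean_space 2) {x \<in> topspace (Euclidean_space 2). x i \<in> - {0}}" for i
  proof (rule openin_continuous_map_preimage[where Y=euclideanreal])
    show "continuous_map (Euclidean_space 2) euclideanreal (\<lambda>x. x i)"
      using Ck_on_continuous[OF Ck_on_coordinate[OF openin_topspace]] by (metis subtopology_topspace)
  qed auto
  from openin_Un[OF this[of 0] this[of 1]] show ?thesis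
    unfolding Cstar_coords_image by (rule back_subst[of "openin _"]) auto
qed

lemma is_chart_Cstar_coords: "is_chart (top_of_set (- {0})) 2 (- {0}, Cstar_coords)"
proof -
  let ?I = "Cstar_coords ` (- {0})"
  have "continuous_on (- {0}) (\<lambda>z. Cstar_coords z j)" for j
    by (cases "j = 0"; cases "j = 1") (auto simp: Cstar_coords_def intro!: continuous_intros)
  then have 1: "continuous_on (- {0}) Cstar_coords"
    by (rule continuous_on_coordinatewise_then_product)
  have 2: "continuous_on ?I (\<lambda>x. Complex (x 0) (x 1))"
    unfolding Complex_eq
    by (intro continuous_intros continuous_on_subset[OF continuous_on_product_coordinates]) auto
  have "homeomorphic_maps (top_of_set (- {0})) (top_of_set ?I) Cstar_coords (\<lambda>x. Complex (x 0) (x 1))"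
    unfolding homeomorphic_maps_def using 1 2
    by (auto simp: continuous_map_in_subtopology Cstar_coords_def complex_eq_iff)
  then have "homeomorphic_map (top_of_set (- {0})) (top_of_set ?I) Cstar_coords"
    using homeomorphic_map_maps by blast
  then show ?thesis
    using Cstar_coords_image_openin openin_Euclidean_space_subset[OF Cstar_coords_image_openin]
    by (simp add: is_chart_def subtopology_Euclidean_space_eq subtopology_subtopology)
qed

lemma mdim_Cstar: "mdim Cstar = 2" and mtop_Cstar: "mtop Cstar = top_of_set (- {0})"
  by (simp_all add: Cstar_def)

lemma Cstar_structure: "smooth_structure Cstar"
  and Cstar_atlas: "(- {0}, Cstar_coords) \<in> atlas Cstar"
proof -
  let ?B = "{(- {0}, Cstar_coords)}"
  have at: "atlas Cstar = compatible_charts (top_of_set (- {0})) 2 ?B"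
    by (simp add: Cstar_def Cstar_coords_def[abs_def])
  have 1: "is_chart (top_of_set (- {0})) 2 (U, \<phi>)" if "(U, \<phi>) \<in> ?B" for U \<phi>
    using that is_chart_Cstar_coords by simp
  have 2: "chart_smooth 2 \<phi> (U \<inter> V) 2 \<psi>" if "(U, \<phi>) \<in> ?B" "(V, \<psi>) \<in> ?B" for U \<phi> V \<psi>
    using that chart_smooth_id[OF Cstar_coords_image_openin] by simp
  have 3: "\<exists>(U, \<phi>)\<in>?B. x \<in> U" if "x \<in> topspace (top_of_set (- {0 :: complex}))" for x
    using that by simp
  note gen = smooth_structure_generated[OF mtop_Cstar mdim_Cstar at 1 2 3]
  show "smooth_structure Cstar" by (rule gen(1))
  show "(- {0}, Cstar_coords) \<in> atlas Cstar" using gen(2) by simp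
qed

text \<open>
  In coordinates, the inverse is \<open>(x, y) \<mapsto> (x / (x\<^sup>2 + y\<^sup>2), - y / (x\<^sup>2 + y\<^sup>2))\<close>.
\<close>

lemma smooth_map_inverse: "smooth_map Cstar (- {0}) Cstar inverse"
proof -
  let ?U = "Cstar_coords ` (- {0})"
  let ?N = "\<lambda>x :: nat \<Rightarrow> real. x 0 * x 0 + x 1 * x 1"
  let ?H = "\<lambda>x :: nat \<Rightarrow> real. \<lambda>i :: nat.
    if i = 0 then x 0 * inverse (?N x) else if i = 1 then (- 1 * x 1) * inverse (?N x) else 0"
  have N: "?N x \<noteq> 0" if "x \<in> ?U" for x
    using that unfolding Cstar_coords_image by (auto simp: sum_squares_eq_zero_iff)
  have inv: "Ck_on k 2 ?U (\<lambda>x. inverse (?N x))" for k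
    by (rule Ck_on_inverse[OF N])
      (assumption, intro Ck_on_add Ck_on_mult Ck_on_coordinate Cstar_coords_image_openin)
  have "Cinf_on 2 2 ?U ?H"
  proof (rule Cinf_onI)
    show "?H x \<in> topspace (Euclidean_space 2)" for x by (auto simp: topspace_Euclidean_space)
    show "Ck_on k 2 ?U (\<lambda>x. ?H x j)" if "j < 2" for j k
    proof -
      have a: "Ck_on k 2 ?U (\<lambda>x. x 0 * inverse (?N x))"
        by (intro Ck_on_mult inv Ck_on_coordinate Cstar_coords_image_openin)
      have b: "Ck_on k 2 ?U (\<lambda>x. (- 1 * x 1) * inverse (?N x))"
        by (intro Ck_on_mult inv Ck_on_coordinate Ck_on_const Cstar_coords_image_openin)
      from that have "j = 0 \<or> j = 1" by auto
      then show ?thesis using a b by auto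
    qed
  qed
  moreover have "?H (Cstar_coords z) = Cstar_coords (inverse z)" if "z \<in> - {0}" for z
    by (auto simp: Cstar_coords_def fun_eq_iff power2_eq_square divide_inverse)
  ultimately have "chart_smooth 2 Cstar_coords (- {0}) 2 (\<lambda>z. Cstar_coords (inverse z))"
    unfolding chart_smooth_def by (intro exI[of _ ?H]) simp
  then have "smooth_on_open Cstar (- {0}) Cstar inverse"
    using Cstar_atlas
    by (intro smooth_on_openI[OF Cstar_structure])
       (auto simp: mtop_Cstar mdim_Cstar intro!: exI[of _ "- {0}"] exI[of _ Cstar_coords])
  then have "\<exists>W G. a \<in> W \<and> smooth_on_open Cstar W Cstar G \<and> (\<forall>x\<in>- {0} \<inter> W. inverse x = G x)"
    if "a \<noteq> 0" for a
    using that by (intro exI[of _ "- {0}"] exI[of _ inverse]) simp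
  then show ?thesis by (intro smooth_mapI) (simp_all add: mtop_Cstar)
qed

section \<open>A bundle gerbe is a Lie groupoid\<close>

lemma gfibreI: "p \<in> pts (gP P) \<Longrightarrow> gq P p = (x1, x2) \<Longrightarrow> p \<in> gfibre P x1 x2"
  by (simp add: gfibre_def)

lemma gfibre_pts: "p \<in> gfibre P x1 x2 \<Longrightarrow> p \<in> pts (gP P)"
  by (simp add: gfibre_def)

lemma gfibre_gq: "p \<in> gfibre P x1 x2 \<Longrightarrow> gq P p = (x1, x2)"
  by (simp add: gfibre_def)

context
  fixes M :: "'m mfd" and P :: "('m, 'x, 'p) gerbe"
  assumes P: "bundle_gerbe M P"
begin

lemma gX_structure: "smooth_structure (gX P)"
  using P by (simp add: bundle_gerbe_def smooth_manifold_imp_structure)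

lemma gerbe_bundle:
  "Cstar_bundle (prod_mfd (gX P) (gX P)) (fibre_square P) (gP P) (gq P) (gact P)"
  using P by (simp add: bundle_gerbe_def)

lemma gP_structure: "smooth_structure (gP P)"
  using gerbe_bundle by (simp add: Cstar_bundle_def smooth_manifold_imp_structure)

lemma smooth_map_gmul:
  "smooth_map (prod_mfd (gP P) (gP P)) (composable P) (gP P) (\<lambda>(p, q). gmul P p q)"
  using P by (simp add: bundle_gerbe_def)

lemma smooth_map_gact:
  "smooth_map (prod_mfd (gP P) Cstar) (pts (gP P) \<times> (- {0})) (gP P) (\<lambda>(p, z). gact P p z)"
  using gerbe_bundle by (simp add: Cstar_bundle_def)

lemma gact_one: "p \<in> pts (gP P) \<Longrightarrow> gact P p 1 = p"
  using gerbe_bundle by (simp add: Cstar_bundle_def)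

lemma gact_gact:
  "\<lbrakk>p \<in> pts (gP P); z \<noteq> 0; w \<noteq> 0\<rbrakk> \<Longrightarrow> gact P (gact P p z) w = gact P p (z * w)"
  using gerbe_bundle by (simp add: Cstar_bundle_def)

lemma gact_in:
  assumes "p \<in> gfibre P x1 x2" "z \<noteq> 0"
  shows "gact P p z \<in> gfibre P x1 x2"
proof (rule gfibreI)
  have p: "p \<in> pts (gP P)" "gq P p = (x1, x2)" using assms(1) by (auto simp: gfibre_def)
  show "gact P p z \<in> pts (gP P)"
    using smooth_map_image[OF smooth_map_gact, of "(p, z)"] p(1) assms(2) by simp
  show "gq P (gact P p z) = (x1, x2)"
    using gerbe_bundle p assms(2) by (simp add: Cstar_bundle_def)
qed

lemma gq_image: "gq P ` pts (gP P) = fibre_square P"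
  using gerbe_bundle by (simp add: Cstar_bundle_def)

lemma gfibre_nonempty:
  assumes "(x1, x2) \<in> fibre_square P"
  obtains p where "p \<in> gfibre P x1 x2"
proof -
  have "(x1, x2) \<in> gq P ` pts (gP P)" using assms gq_image by simp
  then obtain p where "p \<in> pts (gP P)" "gq P p = (x1, x2)" by auto
  then show thesis by (intro that[OF gfibreI])
qed

lemma gfibre_square: "p \<in> gfibre P x1 x2 \<Longrightarrow> (x1, x2) \<in> fibre_square P"
  using imageI[of p "pts (gP P)" "gq P"] by (simp add: gfibre_def gq_image)

lemma gfibre_base:
  assumes "p \<in> gfibre P x1 x2"
  shows "x1 \<in> pts (gX P)" "x2 \<in> pts (gX P)" "gpi P x1 = gpi P x2"
  using gfibre_square[OF assms] by (auto simp: fibre_square_def)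

lemma diagonal_in_square: "x \<in> pts (gX P) \<Longrightarrow> (x, x) \<in> fibre_square P"
  by (simp add: fibre_square_def)

lemma local_trivialisation:
  assumes "b \<in> fibre_square P"
  obtains W \<tau> where "openin (subtopology (prod_topology (mtop (gX P)) (mtop (gX P))) (fibre_square P)) W" "b \<in> W"
    "diffeo (gP P) {p \<in> pts (gP P). gq P p \<in> W} (prod_mfd (prod_mfd (gX P) (gX P)) Cstar) (W \<times> (- {0})) \<tau>"
    "\<forall>p\<in>pts (gP P). gq P p \<in> W \<longrightarrow> fst (\<tau> p) = gq P p"
    "\<forall>p\<in>pts (gP P). \<forall>z. gq P p \<in> W \<longrightarrow> z \<noteq> 0 \<longrightarrow> snd (\<tau> (gact P p z)) = snd (\<tau> p) * z"
proof -
  have "\<forall>b\<in>fibre_square P. \<exists>W \<tau>. openin (subtopology (mtop (prod_mfd (gX P) (gX P))) (fibre_square P)) W \<and> b \<in> W \<and>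
        diffeo (gP P) {p\<in>pts (gP P). gq P p \<in> W} (prod_mfd (prod_mfd (gX P) (gX P)) Cstar) (W \<times> (- {0})) \<tau> \<and>
        (\<forall>p\<in>pts (gP P). gq P p \<in> W \<longrightarrow> fst (\<tau> p) = gq P p \<and>
           (\<forall>z. z \<noteq> 0 \<longrightarrow> snd (\<tau> (gact P p z)) = snd (\<tau> p) * z))"
    using gerbe_bundle unfolding Cstar_bundle_def by (elim conjE)
  from bspec[OF this assms] obtain W \<tau> where
    "openin (subtopology (mtop (prod_mfd (gX P) (gX P))) (fibre_square P)) W" "b \<in> W"
    "diffeo (gP P) {p\<in>pts (gP P). gq P p \<in> W} (prod_mfd (prod_mfd (gX P) (gX P)) Cstar) (W \<times> (- {0})) \<tau>"
    "\<forall>p\<in>pts (gP P). gq P p \<in> W \<longrightarrow> fst (\<tau> p) = gq P p \<and>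
           (\<forall>z. z \<noteq> 0 \<longrightarrow> snd (\<tau> (gact P p z)) = snd (\<tau> p) * z)"
    by (elim exE conjE)
  then show thesis
    by (intro that[of W \<tau>]) (simp_all add: mtop_prod_mfd[OF gX_structure gX_structure])
qed

text \<open>
  Each fibre is a torsor of the multiplicative group: a local trivialisation turns the action into
  multiplication of the second coordinate.
\<close>

lemma gact_free:
  assumes p: "p \<in> gfibre P x1 x2" and z: "z \<noteq> 0" "w \<noteq> 0" and eq: "gact P p z = gact P p w"
  shows "z = w"
proof -
  have p': "p \<in> pts (gP P)" "gq P p = (x1, x2)" using p by (auto simp: gfibre_def)
  obtain W \<tau> where "openin (subtopology (prod_topology (mtop (gX P)) (mtop (gX P))) (fibre_square P)) W" and \<tau>: "(x1, x2) \<in> W"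
    "diffeo (gP P) {p \<in> pts (gP P). gq P p \<in> W} (prod_mfd (prod_mfd (gX P) (gX P)) Cstar) (W \<times> (- {0})) \<tau>"
    "\<forall>p\<in>pts (gP P). gq P p \<in> W \<longrightarrow> fst (\<tau> p) = gq P p"
    "\<forall>p\<in>pts (gP P). \<forall>z. gq P p \<in> W \<longrightarrow> z \<noteq> 0 \<longrightarrow> snd (\<tau> (gact P p z)) = snd (\<tau> p) * z"
    using local_trivialisation[OF gfibre_square[OF p]] .
  have "\<tau> p \<in> W \<times> (- {0})"
  proof -
    have "bij_betw \<tau> {p \<in> pts (gP P). gq P p \<in> W} (W \<times> (- {0}))"
      using \<tau>(2) by (simp add: diffeo_def)
    moreover have "p \<in> {p \<in> pts (gP P). gq P p \<in> W}" using p' \<tau>(1) by simp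
    ultimately show ?thesis by (rule bij_betw_apply)
  qed
  then have "snd (\<tau> p) \<noteq> 0" by auto
  moreover have "snd (\<tau> p) * z = snd (\<tau> p) * w"
    using \<tau>(4)[rule_format, of p z] \<tau>(4)[rule_format, of p w] p' \<tau>(1) z eq by auto
  ultimately show ?thesis by simp
qed

lemma gact_transitive:
  assumes p: "p \<in> gfibre P x1 x2" and r: "r \<in> gfibre P x1 x2"
  obtains z where "z \<noteq> 0" "r = gact P p z"
proof -
  obtain W \<tau> where "openin (subtopology (prod_topology (mtop (gX P)) (mtop (gX P))) (fibre_square P)) W" and \<tau>: "(x1, x2) \<in> W"
    "diffeo (gP P) {p \<in> pts (gP P). gq P p \<in> W} (prod_mfd (prod_mfd (gX P) (gX P)) Cstar) (W \<times> (- {0})) \<tau>"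
    "\<forall>p\<in>pts (gP P). gq P p \<in> W \<longrightarrow> fst (\<tau> p) = gq P p"
    "\<forall>p\<in>pts (gP P). \<forall>z. gq P p \<in> W \<longrightarrow> z \<noteq> 0 \<longrightarrow> snd (\<tau> (gact P p z)) = snd (\<tau> p) * z"
    using local_trivialisation[OF gfibre_square[OF p]] .
  have bij: "bij_betw \<tau> {p \<in> pts (gP P). gq P p \<in> W} (W \<times> (- {0}))"
    using \<tau>(2) by (simp add: diffeo_def)
  note inj = bij_betw_imp_inj_on[OF bij]
  have img: "\<tau> p \<in> W \<times> (- {0})" if "p \<in> pts (gP P)" "gq P p \<in> W" for p
    using bij_betwE[OF bij] that by blast
  have W: "s \<in> pts (gP P)" "gq P s = (x1, x2)" "gq P s \<in> W" if "s \<in> gfibre P x1 x2" for s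
    using that \<tau>(1) by (auto simp: gfibre_def)
  have nz: "snd (\<tau> p) \<noteq> 0" "snd (\<tau> r) \<noteq> 0"
    using img[OF W(1,3)[OF p]] img[OF W(1,3)[OF r]] by auto
  let ?z = "snd (\<tau> r) / snd (\<tau> p)"
  have z: "?z \<noteq> 0" using nz by simp
  have "\<tau> (gact P p ?z) = \<tau> r"
    using \<tau>(3)[rule_format, OF W(1,3)[OF gact_in[OF p z]]] \<tau>(3)[rule_format, OF W(1,3)[OF r]] \<tau>(4)[rule_format, OF W(1,3)[OF p] z]
      W(2)[OF gact_in[OF p z]] W(2)[OF r] nz by (intro prod_eqI) simp_all
  then have "gact P p ?z = r"
    using inj W[OF gact_in[OF p z]] W[OF r] unfolding inj_on_def by blast
  then show thesis using that[OF z] by simp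
qed

lemma gmul_in: "\<lbrakk>p \<in> gfibre P x2 x3; q \<in> gfibre P x1 x2\<rbrakk> \<Longrightarrow> gmul P p q \<in> gfibre P x1 x3"
  using P unfolding bundle_gerbe_def by blast

lemma gmul_gact:
  "\<lbrakk>p \<in> gfibre P x2 x3; q \<in> gfibre P x1 x2; z \<noteq> 0; w \<noteq> 0\<rbrakk>
    \<Longrightarrow> gmul P (gact P p z) (gact P q w) = gact P (gmul P p q) (z * w)"
  using P unfolding bundle_gerbe_def by blast

lemma gmul_gact_left:
  "\<lbrakk>p \<in> gfibre P x2 x3; q \<in> gfibre P x1 x2; z \<noteq> 0\<rbrakk>
    \<Longrightarrow> gmul P (gact P p z) q = gact P (gmul P p q) z"
  using gmul_gact[of p x2 x3 q x1 z 1] gact_one[OF gfibre_pts, of q x1 x2] by simp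

lemma gmul_gact_right:
  "\<lbrakk>p \<in> gfibre P x2 x3; q \<in> gfibre P x1 x2; z \<noteq> 0\<rbrakk>
    \<Longrightarrow> gmul P p (gact P q z) = gact P (gmul P p q) z"
  using gmul_gact[of p x2 x3 q x1 1 z] gact_one[OF gfibre_pts, of p x2 x3] by simp

lemma gmul_assoc:
  "\<lbrakk>p \<in> gfibre P x3 x4; q \<in> gfibre P x2 x3; r \<in> gfibre P x1 x2\<rbrakk>
    \<Longrightarrow> gmul P (gmul P p q) r = gmul P p (gmul P q r)"
  using P unfolding bundle_gerbe_def by blast

text \<open>
  The square of \<open>p c\<^sup>-\<^sup>1\<close> is \<open>(p p) c\<^sup>-\<^sup>2\<close>, which is \<open>(p c) c\<^sup>-\<^sup>2\<close>. This is how units arise: if \<open>p\<close>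
  lies over \<open>(x, x)\<close>, then so does \<open>p p\<close>, and the two differ by some \<open>c\<close>.
\<close>

lemma idempotent_from_square:
  assumes p: "p \<in> gfibre P x x" and c: "c \<noteq> 0" "gmul P p p = gact P p c"
  shows "gmul P (gact P p (inverse c)) (gact P p (inverse c)) = gact P p (inverse c)"
  using gmul_gact[OF p p, of "inverse c" "inverse c"] gact_gact[OF gfibre_pts[OF p], of c "inverse c * inverse c"] c
  by (simp flip: mult.assoc)

lemma idempotent_exists:
  assumes "x \<in> pts (gX P)"
  obtains e where "e \<in> gfibre P x x" "gmul P e e = e"
proof -
  obtain p where p: "p \<in> gfibre P x x"
    using gfibre_nonempty[OF diagonal_in_square[OF assms]] .
  obtain c where c: "c \<noteq> 0" "gmul P p p = gact P p c"
    using gact_transitive[OF p gmul_in[OF p p]] .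
  show thesis
    by (rule that[OF gact_in[OF p] idempotent_from_square[OF p c]]) (use c in simp)
qed

text \<open>
  Left multiplication by an idempotent over \<open>(x, x)\<close> scales each element of a torsor and is its own
  square; a nonzero scalar that equals its square is 1.
\<close>

lemma idempotent_left:
  assumes e: "e \<in> gfibre P x x" "gmul P e e = e" and p: "p \<in> gfibre P y x"
  shows "gmul P e p = p"
proof -
  obtain z where z: "z \<noteq> 0" "gmul P e p = gact P p z"
    using gact_transitive[OF p gmul_in[OF e(1) p]] .
  have "gact P p z = gmul P (gmul P e e) p" using e(2) z by simp
  also have "\<dots> = gact P p (z * z)"
    using gmul_assoc[OF e(1) e(1) p] z gmul_gact_right[OF e(1) p z(1)] gact_gact[OF gfibre_pts[OF p]] by simp
  finally have "z = z * z" by (rule gact_free[OF p z(1), rotated]) (use z(1) in simp)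
  then have "z = 1" using z(1) by simp
  then show ?thesis using z gact_one[OF gfibre_pts[OF p]] by simp
qed

lemma idempotent_right:
  assumes e: "e \<in> gfibre P x x" "gmul P e e = e" and p: "p \<in> gfibre P x y"
  shows "gmul P p e = p"
proof -
  obtain z where z: "z \<noteq> 0" "gmul P p e = gact P p z"
    using gact_transitive[OF p gmul_in[OF p e(1)]] .
  have "gact P p z = gmul P p (gmul P e e)" using e(2) z by simp
  also have "\<dots> = gact P p (z * z)"
    using gmul_assoc[OF p e(1) e(1)] z gmul_gact_left[OF p e(1) z(1)] gact_gact[OF gfibre_pts[OF p]] by simp
  finally have "z = z * z" by (rule gact_free[OF p z(1), rotated]) (use z(1) in simp)
  then have "z = 1" using z(1) by simp
  then show ?thesis using z gact_one[OF gfibre_pts[OF p]] by simp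
qed

text \<open>
  An idempotent is a two-sided unit, and two-sided units are unique; so idempotence is all that has
  to be checked in order to recognise the unit.
\<close>

lemma gunit_eqI:
  assumes e: "e \<in> gfibre P x x" "gmul P e e = e"
  shows "gunit P x = e"
  unfolding gunit_def
proof (rule the_equality)
  show "e \<in> gfibre P x x \<and> (\<forall>y. (\<forall>p\<in>gfibre P y x. gmul P e p = p) \<and> (\<forall>p\<in>gfibre P x y. gmul P p e = p))"
    using e idempotent_left[OF e] idempotent_right[OF e] by blast
  fix e' assume "e' \<in> gfibre P x x \<and> (\<forall>y. (\<forall>p\<in>gfibre P y x. gmul P e' p = p) \<and> (\<forall>p\<in>gfibre P x y. gmul P p e' = p))"
  then show "e' = e" using e(1) idempotent_left[OF e, of e' x] by metis
qed

lemma gunit_props: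
  assumes "x \<in> pts (gX P)"
  shows gunit_in: "gunit P x \<in> gfibre P x x" and gunit_idem: "gmul P (gunit P x) (gunit P x) = gunit P x"
  using idempotent_exists[OF assms] gunit_eqI by metis+

lemma gunit_left: "p \<in> gfibre P y x \<Longrightarrow> gmul P (gunit P x) p = p"
  using idempotent_left gunit_in gunit_idem gfibre_base(2) by blast

lemma gunit_right: "p \<in> gfibre P x y \<Longrightarrow> gmul P p (gunit P x) = p"
  using idempotent_right gunit_in gunit_idem gfibre_base(1) by blast

text \<open>
  A multiple \<open>r\<close> of any element of the opposite fibre is a left inverse of \<open>p\<close>. It is a right inverse
  as well, since \<open>p r\<close> is then idempotent.
\<close>

lemma inverse_exists:
  assumes p: "p \<in> gfibre P x1 x2"
  obtains r where "r \<in> gfibre P x2 x1" "gmul P r p = gunit P x1" "gmul P p r = gunit P x2"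
proof -
  have "(x2, x1) \<in> fibre_square P" using gfibre_base[OF p] by (simp add: fibre_square_def)
  then obtain q where q: "q \<in> gfibre P x2 x1" using gfibre_nonempty by blast
  note u = gunit_in[OF gfibre_base(1)[OF p]]
  obtain z where z: "z \<noteq> 0" "gmul P q p = gact P (gunit P x1) z"
    using gact_transitive[OF u gmul_in[OF q p]] .
  define r where "r = gact P q (inverse z)"
  have r: "r \<in> gfibre P x2 x1" unfolding r_def using z(1) by (intro gact_in[OF q]) simp
  have 1: "gmul P r p = gunit P x1"
    unfolding r_def using z gmul_gact_left[OF q p, of "inverse z"] gact_gact[OF gfibre_pts[OF u]]
      gact_one[OF gfibre_pts[OF u]] by simp
  have "gmul P (gmul P p r) (gmul P p r) = gmul P p (gmul P (gmul P r p) r)"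
    using gmul_assoc[OF p r gmul_in[OF p r]] gmul_assoc[OF r p r] by simp
  also have "\<dots> = gmul P p r" using 1 gunit_left[OF r] by simp
  finally have "gmul P p r = gunit P x2" using gunit_eqI[OF gmul_in[OF p r]] by simp
  then show thesis using that[OF r 1] by simp
qed

lemma ginv_props:
  assumes p: "p \<in> gfibre P x1 x2"
  shows ginv_in: "ginv P p \<in> gfibre P x2 x1" and ginv_left: "gmul P (ginv P p) p = gunit P x1"
    and ginv_right: "gmul P p (ginv P p) = gunit P x2"
proof -
  obtain r where r: "r \<in> gfibre P x2 x1" "gmul P r p = gunit P x1" "gmul P p r = gunit P x2"
    using inverse_exists[OF p] .
  have "ginv P p = r"
    unfolding ginv_def gfibre_gq[OF p]
  proof (rule the_equality)
    fix r' assume r': "r' \<in> gfibre P (snd (x1, x2)) (fst (x1, x2)) \<and>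
      gmul P r' p = gunit P (fst (x1, x2)) \<and> gmul P p r' = gunit P (snd (x1, x2))"
    then have r'_in: "r' \<in> gfibre P x2 x1" by simp
    have "r' = gmul P r' (gmul P p r)" using r gunit_right[OF r'_in] by simp
    also have "\<dots> = gmul P (gmul P r' p) r" using gmul_assoc[OF r'_in p r(1)] by simp
    also have "\<dots> = r" using r' gunit_left[OF r(1)] by simp
    finally show "r' = r" .
  qed (use r in simp)
  then show "ginv P p \<in> gfibre P x2 x1" "gmul P (ginv P p) p = gunit P x1"
    "gmul P p (ginv P p) = gunit P x2" using r by simp_all
qed

text \<open>
  Compatibility with descent says that a transformation is a natural transformation of functors
  between groupoids: \<open>r\<^sup>-\<^sup>1 s\<^sub>2 p = s\<^sub>1\<close> is the naturality square \<open>s\<^sub>2 p = r s\<^sub>1\<close>.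
\<close>

lemma descent_iff_natural:
  assumes p: "p \<in> gfibre P a1 a2" and r: "r \<in> gfibre P b1 b2"
    and s1: "s1 \<in> gfibre P a1 b1" and s2: "s2 \<in> gfibre P a2 b2"
  shows "gmul P (gmul P (ginv P r) s2) p = s1 \<longleftrightarrow> gmul P s2 p = gmul P r s1"
proof -
  note i = ginv_in[OF r]
  have "gmul P (gmul P (ginv P r) s2) p = gmul P (ginv P r) (gmul P s2 p)"
    by (rule gmul_assoc[OF i s2 p])
  moreover have "gmul P r (gmul P (ginv P r) (gmul P s2 p)) = gmul P s2 p"
    using gmul_assoc[OF r i gmul_in[OF s2 p]] ginv_right[OF r] gunit_left[OF gmul_in[OF s2 p]] by simp
  moreover have "gmul P (ginv P r) (gmul P r s1) = s1"
    using gmul_assoc[OF i r s1] ginv_left[OF r] gunit_left[OF s1] by simp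
  ultimately show ?thesis by metis
qed

lemma smooth_map_gmul_compose:
  assumes Z: "smooth_structure Z" and F: "smooth_map Z A (gP P) F" and G: "smooth_map Z A (gP P) G"
    and comp: "\<And>x. x \<in> A \<Longrightarrow> (F x, G x) \<in> composable P"
  shows "smooth_map Z A (gP P) (\<lambda>x. gmul P (F x) (G x))"
proof -
  have "smooth_map Z A (gP P) (\<lambda>x. (\<lambda>(p, q). gmul P p q) (F x, G x))"
    by (rule smooth_map_compose[OF Z prod_mfd_structure[OF gP_structure gP_structure] gP_structure
          smooth_map_Pair[OF gP_structure gP_structure Z F G] smooth_map_gmul comp])
  then show ?thesis by simp
qed

text \<open>
  Near a point of the diagonal, a trivialisation provides a smooth section \<open>\<sigma>\<close> of the bundle with
  coordinate 1, so that \<open>\<sigma> \<sigma> = \<sigma> c\<close> with \<open>c\<close> the coordinate of \<open>\<sigma> \<sigma>\<close>, and the unit is \<open>\<sigma> c\<^sup>-\<^sup>1\<close>.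
\<close>

lemma smooth_map_gunit: "smooth_map (gX P) (pts (gX P)) (gP P) (gunit P)"
proof (rule smooth_map_local[OF gX_structure gP_structure subset_refl])
  let ?X = "gX P" and ?P = "gP P"
  let ?T = "prod_topology (mtop (gX P)) (mtop (gX P))"
  let ?N = "prod_mfd (prod_mfd ?X ?X) Cstar"
  note XX = prod_mfd_structure[OF gX_structure gX_structure]
  note N = prod_mfd_structure[OF XX Cstar_structure]
  note PC = prod_mfd_structure[OF gP_structure Cstar_structure]
  fix a assume a: "a \<in> pts ?X"
  obtain W \<tau> where W: "openin (subtopology ?T (fibre_square P)) W" "(a, a) \<in> W"
    and diff: "diffeo ?P {p \<in> pts ?P. gq P p \<in> W} ?N (W \<times> (- {0})) \<tau>"
    and fst_\<tau>: "\<forall>p\<in>pts (gP P). gq P p \<in> W \<longrightarrow> fst (\<tau> p) = gq P p"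
    and snd_\<tau>: "\<forall>p\<in>pts (gP P). \<forall>z. gq P p \<in> W \<longrightarrow> z \<noteq> 0 \<longrightarrow> snd (\<tau> (gact P p z)) = snd (\<tau> p) * z"
    using local_trivialisation[OF diagonal_in_square[OF a]] .
  let ?S = "{p \<in> pts ?P. gq P p \<in> W}"
  have \<tau>: "bij_betw \<tau> ?S (W \<times> (- {0}))" "smooth_map ?P ?S ?N \<tau>"
    "smooth_map ?N (W \<times> (- {0})) ?P (inv_into ?S \<tau>)"
    using diff by (auto simp: diffeo_def)
  obtain V where V: "openin ?T V" "W = V \<inter> fibre_square P"
    using W(1) by (auto simp: openin_subtopology)
  define A where "A = {x \<in> pts ?X. (x, x) \<in> V}"
  have "continuous_map (mtop ?X) ?T (\<lambda>x. (x, x))"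
    by (simp add: continuous_map_pairwise comp_def)
  then have A: "openin (mtop ?X) A"
    unfolding A_def by (rule openin_continuous_map_preimage[OF _ V(1)])
  have AW: "(x, x) \<in> W" if "x \<in> A" for x
    using that V(2) diagonal_in_square by (auto simp: A_def)
  have AX: "A \<subseteq> pts ?X" by (auto simp: A_def)
  define \<sigma> where "\<sigma> x = inv_into ?S \<tau> ((x, x), 1)" for x
  have \<sigma>1: "\<sigma> x \<in> ?S" "\<tau> (\<sigma> x) = ((x, x), 1)" if "x \<in> A" for x
  proof -
    have "((x, x), 1) \<in> \<tau> ` ?S" using AW[OF that] \<tau>(1) by (simp add: bij_betw_def)
    then show "\<sigma> x \<in> ?S" "\<tau> (\<sigma> x) = ((x, x), 1)"
      unfolding \<sigma>_def by (rule inv_into_into, rule f_inv_into_f)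
  qed
  have \<sigma>_in: "\<sigma> x \<in> gfibre P x x" if "x \<in> A" for x
  proof (rule gfibreI)
    show "\<sigma> x \<in> pts ?P" using \<sigma>1[OF that] by simp
    show "gq P (\<sigma> x) = (x, x)" using \<sigma>1[OF that] fst_\<tau>[rule_format, of "\<sigma> x"] by simp
  qed
  have id: "smooth_map ?X A ?X (\<lambda>x. x)" by (rule smooth_map_id[OF gX_structure AX])
  have one: "smooth_map ?X A Cstar (\<lambda>_. 1)"
    by (rule smooth_map_const[OF gX_structure Cstar_structure AX]) (simp add: mtop_Cstar)
  have "smooth_map ?X A ?N (\<lambda>x. ((x, x), 1))"
    by (intro smooth_map_Pair gX_structure Cstar_structure XX id one)
  then have \<sigma>: "smooth_map ?X A ?P \<sigma>"
    unfolding \<sigma>_def by (rule smooth_map_compose[OF gX_structure N gP_structure _ \<tau>(3)]) (simp add: AW)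
  have \<sigma>\<sigma>_in: "gmul P (\<sigma> x) (\<sigma> x) \<in> gfibre P x x" if "x \<in> A" for x
    by (rule gmul_in[OF \<sigma>_in[OF that] \<sigma>_in[OF that]])
  have \<sigma>\<sigma>: "smooth_map ?X A ?P (\<lambda>x. gmul P (\<sigma> x) (\<sigma> x))"
  proof (rule smooth_map_gmul_compose[OF gX_structure \<sigma> \<sigma>])
    show "(\<sigma> x, \<sigma> x) \<in> composable P" if "x \<in> A" for x
      using \<sigma>_in[OF that] unfolding composable_def by blast
  qed
  define c where "c x = snd (\<tau> (gmul P (\<sigma> x) (\<sigma> x)))" for x
  have \<sigma>\<sigma>S: "gmul P (\<sigma> x) (\<sigma> x) \<in> ?S" if "x \<in> A" for x
    using \<sigma>\<sigma>_in[OF that] AW[OF that] by (simp add: gfibre_def)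
  have \<tau>\<sigma>\<sigma>: "\<tau> (gmul P (\<sigma> x) (\<sigma> x)) \<in> W \<times> (- {0})" if "x \<in> A" for x
    using \<tau>(1) \<sigma>\<sigma>S[OF that] by (rule bij_betwE[THEN bspec])
  have "W \<times> (- {0}) \<subseteq> pts (prod_mfd ?X ?X) \<times> pts Cstar"
    using V(2) openin_subset[OF V(1)] by (auto simp: mtop_Cstar mtop_prod_mfd[OF gX_structure gX_structure])
  then have in_N: "\<tau> (gmul P (\<sigma> x) (\<sigma> x)) \<in> pts (prod_mfd ?X ?X) \<times> pts Cstar" if "x \<in> A" for x
    by (rule subsetD[OF _ \<tau>\<sigma>\<sigma>[OF that]])
  have "smooth_map ?X A ?N (\<lambda>x. \<tau> (gmul P (\<sigma> x) (\<sigma> x)))"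
    by (rule smooth_map_compose[OF gX_structure gP_structure N \<sigma>\<sigma> \<tau>(2) \<sigma>\<sigma>S])
  then have c: "smooth_map ?X A Cstar c"
    unfolding c_def
    by (rule smooth_map_compose[OF gX_structure N Cstar_structure _ smooth_map_snd[OF XX Cstar_structure] in_N])
  have c0: "c x \<noteq> 0" if "x \<in> A" for x
    using \<tau>\<sigma>\<sigma>[OF that] by (auto simp: c_def)
  have "smooth_map ?X A Cstar (\<lambda>x. inverse (c x))"
    by (rule smooth_map_compose[OF gX_structure Cstar_structure Cstar_structure c smooth_map_inverse])
       (simp add: c0)
  then have "smooth_map ?X A (prod_mfd ?P Cstar) (\<lambda>x. (\<sigma> x, inverse (c x)))"
    by (intro smooth_map_Pair gP_structure gX_structure Cstar_structure \<sigma>)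
  then have e: "smooth_map ?X A ?P (\<lambda>x. (\<lambda>(p, z). gact P p z) (\<sigma> x, inverse (c x)))"
    by (rule smooth_map_compose[OF gX_structure PC gP_structure _ smooth_map_gact])
       (use \<sigma>1 c0 in auto)
  have e_eq: "gact P (\<sigma> x) (inverse (c x)) = gunit P x" if x: "x \<in> A" for x
  proof -
    obtain z where z: "z \<noteq> 0" "gmul P (\<sigma> x) (\<sigma> x) = gact P (\<sigma> x) z"
      using gact_transitive[OF \<sigma>_in[OF x] \<sigma>\<sigma>_in[OF x]] .
    have "c x = z" using snd_\<tau>[rule_format, of "\<sigma> x" z] \<sigma>1[OF x] z by (simp add: c_def)
    then have "gmul P (\<sigma> x) (\<sigma> x) = gact P (\<sigma> x) (c x)" using z by simp
    from idempotent_from_square[OF \<sigma>_in[OF x] c0[OF x] this] gact_in[OF \<sigma>_in[OF x], of "inverse (c x)"] c0[OF x]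
    show ?thesis by (intro gunit_eqI[symmetric]) auto
  qed
  have "smooth_map ?X A ?P (gunit P)"
    by (rule smooth_map_cong[OF e]) (simp add: e_eq)
  then show "\<exists>O'. a \<in> O' \<and> openin (mtop ?X) O' \<and> smooth_map ?X (pts ?X \<inter> O') ?P (gunit P)"
    using A AX a W(2) V(2) by (intro exI[of _ A]) (auto simp: A_def Int_absorb1)
qed

end

section \<open>Morphisms are functors and transformations are natural transformations\<close>

lemma gerbe_morphismsD:
  assumes "F \<in> gerbe_morphisms P Q"
  shows mor_dom: "mdom F = P" and mor_cod: "mcod F = Q"
    and mor_base_ext: "mbase F \<in> extensional (pts (gX P))"
    and mor_base_smooth: "smooth_map (gX P) (pts (gX P)) (gX Q) (mbase F)"
    and mor_base_proj: "\<And>x. x \<in> pts (gX P) \<Longrightarrow> gpi Q (mbase F x) = gpi P x"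
    and mor_hat_ext: "mhat F \<in> extensional (pts (gP P))"
    and mor_hat_smooth: "smooth_map (gP P) (pts (gP P)) (gP Q) (mhat F)"
    and mor_hat_in: "\<And>p x1 x2. p \<in> gfibre P x1 x2 \<Longrightarrow> mhat F p \<in> gfibre Q (mbase F x1) (mbase F x2)"
    and mor_hat_act: "\<And>p z. p \<in> pts (gP P) \<Longrightarrow> z \<noteq> 0 \<Longrightarrow> mhat F (gact P p z) = gact Q (mhat F p) z"
    and mor_hat_mul': "\<And>p q. (p, q) \<in> composable P \<Longrightarrow> mhat F (gmul P p q) = gmul Q (mhat F p) (mhat F q)"
  using assms by (auto simp: gerbe_morphisms_def gerbe_morphism_def Let_def)

lemma gerbe_morphismsI:
  assumes "mdom F = P" "mcod F = Q"
    and "mbase F \<in> extensional (pts (gX P))" "smooth_map (gX P) (pts (gX P)) (gX Q) (mbase F)"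
    and "\<And>x. x \<in> pts (gX P) \<Longrightarrow> gpi Q (mbase F x) = gpi P x"
    and "mhat F \<in> extensional (pts (gP P))" "smooth_map (gP P) (pts (gP P)) (gP Q) (mhat F)"
    and "\<And>p x1 x2. p \<in> gfibre P x1 x2 \<Longrightarrow> mhat F p \<in> gfibre Q (mbase F x1) (mbase F x2)"
    and "\<And>p z. p \<in> pts (gP P) \<Longrightarrow> z \<noteq> 0 \<Longrightarrow> mhat F (gact P p z) = gact Q (mhat F p) z"
    and "\<And>p q. (p, q) \<in> composable P \<Longrightarrow> mhat F (gmul P p q) = gmul Q (mhat F p) (mhat F q)"
  shows "F \<in> gerbe_morphisms P Q"
  using assms by (auto simp: gerbe_morphisms_def gerbe_morphism_def Let_def)

lemma composableI: "p \<in> gfibre P x2 x3 \<Longrightarrow> q \<in> gfibre P x1 x2 \<Longrightarrow> (p, q) \<in> composable P"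
  by (auto simp: composable_def)

lemma composableE:
  assumes "(p, q) \<in> composable P"
  obtains x1 x2 x3 where "p \<in> gfibre P x2 x3" "q \<in> gfibre P x1 x2"
  using assms by (auto simp: composable_def)

lemma mor_hat_mul:
  "\<lbrakk>F \<in> gerbe_morphisms P Q; p \<in> gfibre P x2 x3; q \<in> gfibre P x1 x2\<rbrakk>
    \<Longrightarrow> mhat F (gmul P p q) = gmul Q (mhat F p) (mhat F q)"
  by (rule mor_hat_mul'[OF _ composableI])

lemma mor_base_in: "F \<in> gerbe_morphisms P Q \<Longrightarrow> x \<in> pts (gX P) \<Longrightarrow> mbase F x \<in> pts (gX Q)"
  by (rule smooth_map_image[OF mor_base_smooth])

text \<open>The image of a unit is idempotent.\<close>

lemma mor_hat_unit:
  assumes P: "bundle_gerbe M P" and Q: "bundle_gerbe M Q" and F: "F \<in> gerbe_morphisms P Q"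
    and x: "x \<in> pts (gX P)"
  shows "mhat F (gunit P x) = gunit Q (mbase F x)"
proof -
  note u = gunit_in[OF P x]
  have "gmul Q (mhat F (gunit P x)) (mhat F (gunit P x)) = mhat F (gunit P x)"
    using mor_hat_mul[OF F u u] gunit_idem[OF P x] by simp
  then show ?thesis by (rule gunit_eqI[OF Q mor_hat_in[OF F u], symmetric])
qed

lemma id_morphism_in:
  assumes P: "bundle_gerbe M P"
  shows "id_morphism P \<in> gerbe_morphisms P P"
proof (rule gerbe_morphismsI)
  have "smooth_map (gX P) (pts (gX P)) (gX P) (\<lambda>x. x)"
    by (rule smooth_map_id[OF gX_structure[OF P] subset_refl])
  then show "smooth_map (gX P) (pts (gX P)) (gX P) (mbase (id_morphism P))"
    by (rule smooth_map_cong) (simp add: id_morphism_def)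
  have "smooth_map (gP P) (pts (gP P)) (gP P) (\<lambda>x. x)"
    by (rule smooth_map_id[OF gP_structure[OF P] subset_refl])
  then show "smooth_map (gP P) (pts (gP P)) (gP P) (mhat (id_morphism P))"
    by (rule smooth_map_cong) (simp add: id_morphism_def)
  show "mhat (id_morphism P) p \<in> gfibre P (mbase (id_morphism P) x1) (mbase (id_morphism P) x2)"
    if "p \<in> gfibre P x1 x2" for p x1 x2
    using that gfibre_base[OF P that] gfibre_pts[OF that] by (simp add: id_morphism_def)
  show "mhat (id_morphism P) (gact P p z) = gact P (mhat (id_morphism P) p) z"
    if p: "p \<in> pts (gP P)" and z: "z \<noteq> 0" for p z
  proof -
    have "p \<in> gfibre P (fst (gq P p)) (snd (gq P p))" using p by (intro gfibreI) auto
    from gfibre_pts[OF gact_in[OF P this z]] p show ?thesis by (simp add: id_morphism_def)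
  qed
  show "mhat (id_morphism P) (gmul P p q) = gmul P (mhat (id_morphism P) p) (mhat (id_morphism P) q)"
    if comp: "(p, q) \<in> composable P" for p q
  proof -
    obtain x1 x2 x3 where "p \<in> gfibre P x2 x3" "q \<in> gfibre P x1 x2"
      using composableE[OF comp] .
    from gfibre_pts[OF gmul_in[OF P this]] this[THEN gfibre_pts] show ?thesis by (simp add: id_morphism_def)
  qed
qed (simp_all add: id_morphism_def)

lemma comp_morphism_base: "x \<in> pts (gX (mdom F)) \<Longrightarrow> mbase (comp_morphism G F) x = mbase G (mbase F x)"
  and comp_morphism_hat: "p \<in> pts (gP (mdom F)) \<Longrightarrow> mhat (comp_morphism G F) p = mhat G (mhat F p)"
  by (simp_all add: comp_morphism_def compose_def)

lemma comp_morphism_in: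
  assumes P: "bundle_gerbe M P" and Q: "bundle_gerbe M Q" and R: "bundle_gerbe M R"
    and F: "F \<in> gerbe_morphisms P Q" and G: "G \<in> gerbe_morphisms Q R"
  shows "comp_morphism G F \<in> gerbe_morphisms P R"
proof (rule gerbe_morphismsI)
  note dom = mor_dom[OF F]
  show "mdom (comp_morphism G F) = P" "mcod (comp_morphism G F) = R"
    "mbase (comp_morphism G F) \<in> extensional (pts (gX P))" "mhat (comp_morphism G F) \<in> extensional (pts (gP P))"
    using dom mor_cod[OF G] by (simp_all add: comp_morphism_def compose_def)
  have "smooth_map (gX P) (pts (gX P)) (gX R) (\<lambda>x. mbase G (mbase F x))"
    by (rule smooth_map_compose[OF gX_structure[OF P] gX_structure[OF Q] gX_structure[OF R]
          mor_base_smooth[OF F] mor_base_smooth[OF G] mor_base_in[OF F]])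
  then show "smooth_map (gX P) (pts (gX P)) (gX R) (mbase (comp_morphism G F))"
    by (rule smooth_map_cong) (simp add: comp_morphism_base dom)
  have "smooth_map (gP P) (pts (gP P)) (gP R) (\<lambda>x. mhat G (mhat F x))"
    by (rule smooth_map_compose[OF gP_structure[OF P] gP_structure[OF Q] gP_structure[OF R]
          mor_hat_smooth[OF F] mor_hat_smooth[OF G] smooth_map_image[OF mor_hat_smooth[OF F]]])
  then show "smooth_map (gP P) (pts (gP P)) (gP R) (mhat (comp_morphism G F))"
    by (rule smooth_map_cong) (simp add: comp_morphism_hat dom)
  show "gpi R (mbase (comp_morphism G F) x) = gpi P x" if "x \<in> pts (gX P)" for x
    using that mor_base_proj[OF G mor_base_in[OF F that]] mor_base_proj[OF F that]
    by (simp add: comp_morphism_base dom)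
  show "mhat (comp_morphism G F) p \<in> gfibre R (mbase (comp_morphism G F) x1) (mbase (comp_morphism G F) x2)"
    if "p \<in> gfibre P x1 x2" for p x1 x2
    using mor_hat_in[OF G mor_hat_in[OF F that]] gfibre_base[OF P that] gfibre_pts[OF that]
    by (simp add: comp_morphism_base comp_morphism_hat dom)
  show "mhat (comp_morphism G F) (gact P p z) = gact R (mhat (comp_morphism G F) p) z"
    if p: "p \<in> pts (gP P)" and z: "z \<noteq> 0" for p z
  proof -
    have "p \<in> gfibre P (fst (gq P p)) (snd (gq P p))" using p by (intro gfibreI) auto
    from gfibre_pts[OF gact_in[OF P this z]] show ?thesis
      using p mor_hat_act[OF F p z] mor_hat_act[OF G smooth_map_image[OF mor_hat_smooth[OF F] p] z]
      by (simp add: comp_morphism_hat dom)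
  qed
  show "mhat (comp_morphism G F) (gmul P p q) = gmul R (mhat (comp_morphism G F) p) (mhat (comp_morphism G F) q)"
    if comp: "(p, q) \<in> composable P" for p q
  proof -
    obtain x1 x2 x3 where pq: "p \<in> gfibre P x2 x3" "q \<in> gfibre P x1 x2"
      using composableE[OF comp] .
    show ?thesis
      using gfibre_pts[OF gmul_in[OF P pq]] pq[THEN gfibre_pts] mor_hat_mul[OF F pq]
        mor_hat_mul[OF G mor_hat_in[OF F pq(1)] mor_hat_in[OF F pq(2)]]
      by (simp add: comp_morphism_hat dom)
  qed
qed

lemma comp_morphism_assoc:
  assumes F: "F \<in> gerbe_morphisms P Q" and G: "G \<in> gerbe_morphisms Q R" and H: "H \<in> gerbe_morphisms R S"
  shows "comp_morphism (comp_morphism H G) F = comp_morphism H (comp_morphism G F)"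
  using mor_base_in[OF F] smooth_map_image[OF mor_hat_smooth[OF F]] mor_dom[OF F] mor_dom[OF G]
  by (simp add: comp_morphism_def compose_def restrict_def fun_eq_iff)

lemma comp_id_morphism:
  assumes F: "F \<in> gerbe_morphisms P Q"
  shows "comp_morphism (id_morphism Q) F = F" "comp_morphism F (id_morphism P) = F"
proof -
  have ext: "mbase F x = undefined" if "x \<notin> pts (gX P)" for x
    using mor_base_ext[OF F] that by (rule extensional_arb)
  have ext': "mhat F x = undefined" if "x \<notin> pts (gP P)" for x
    using mor_hat_ext[OF F] that by (rule extensional_arb)
  show "comp_morphism (id_morphism Q) F = F"
    using mor_base_in[OF F] smooth_map_image[OF mor_hat_smooth[OF F]] mor_dom[OF F] mor_cod[OF F] ext ext'
    by (intro gmor.equality) (auto simp: comp_morphism_def id_morphism_def compose_def restrict_def fun_eq_iff)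
  show "comp_morphism F (id_morphism P) = F"
    using mor_dom[OF F] mor_cod[OF F] ext ext'
    by (intro gmor.equality) (auto simp: comp_morphism_def id_morphism_def compose_def restrict_def fun_eq_iff)
qed

lemma transformationsD:
  assumes \<theta>: "\<theta> \<in> transformations F1 F2" and Q: "bundle_gerbe M Q"
    and F1: "F1 \<in> gerbe_morphisms P Q" and F2: "F2 \<in> gerbe_morphisms P Q"
  shows trans_dom: "tdom \<theta> = F1" and trans_cod: "tcod \<theta> = F2"
    and trans_ext: "tsec \<theta> \<in> extensional (pts (gX P))"
    and trans_smooth: "smooth_map (gX P) (pts (gX P)) (gP Q) (tsec \<theta>)"
    and trans_in: "\<And>x. x \<in> pts (gX P) \<Longrightarrow> tsec \<theta> x \<in> gfibre Q (mbase F1 x) (mbase F2 x)"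
    and trans_natural: "\<And>p x1 x2. \<lbrakk>p \<in> gfibre P x1 x2; x1 \<in> pts (gX P); x2 \<in> pts (gX P)\<rbrakk>
      \<Longrightarrow> gmul Q (tsec \<theta> x2) (mhat F1 p) = gmul Q (mhat F2 p) (tsec \<theta> x1)"
proof -
  have t: "transformation \<theta>" and dc: "tdom \<theta> = F1" "tcod \<theta> = F2"
    using \<theta> by (auto simp: transformations_def)
  then show "tdom \<theta> = F1" "tcod \<theta> = F2" by auto
  have 1: "tsec \<theta> \<in> extensional (pts (gX P)) \<and> smooth_map (gX P) (pts (gX P)) (gP Q) (tsec \<theta>) \<and>
     (\<forall>x\<in>pts (gX P). tsec \<theta> x \<in> gfibre Q (mbase F1 x) (mbase F2 x)) \<and>
     (\<forall>x1 x2. \<forall>p\<in>gfibre P x1 x2.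
        gmul Q (gmul Q (ginv Q (mhat F2 p)) (tsec \<theta> x2)) (mhat F1 p) = tsec \<theta> x1)"
    using t mor_dom[OF F1] mor_cod[OF F1] unfolding transformation_def Let_def dc by simp
  then show "tsec \<theta> \<in> extensional (pts (gX P))" "smooth_map (gX P) (pts (gX P)) (gP Q) (tsec \<theta>)" by auto
  show in': "tsec \<theta> x \<in> gfibre Q (mbase F1 x) (mbase F2 x)" if "x \<in> pts (gX P)" for x
    using 1 that by blast
  show "gmul Q (tsec \<theta> x2) (mhat F1 p) = gmul Q (mhat F2 p) (tsec \<theta> x1)"
    if p: "p \<in> gfibre P x1 x2" and x: "x1 \<in> pts (gX P)" "x2 \<in> pts (gX P)" for p x1 x2
    using 1 p descent_iff_natural[OF Q mor_hat_in[OF F1 p] mor_hat_in[OF F2 p] in'[OF x(1)] in'[OF x(2)]]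
    by blast
qed

lemma transformationsI:
  assumes P: "bundle_gerbe M P" and Q: "bundle_gerbe M Q"
    and F1: "F1 \<in> gerbe_morphisms P Q" and F2: "F2 \<in> gerbe_morphisms P Q"
    and dc: "tdom \<theta> = F1" "tcod \<theta> = F2"
    and sec: "tsec \<theta> = restrict s (pts (gX P))" and smooth: "smooth_map (gX P) (pts (gX P)) (gP Q) s"
    and s_in: "\<And>x. x \<in> pts (gX P) \<Longrightarrow> s x \<in> gfibre Q (mbase F1 x) (mbase F2 x)"
    and nat: "\<And>p x1 x2. \<lbrakk>p \<in> gfibre P x1 x2; x1 \<in> pts (gX P); x2 \<in> pts (gX P)\<rbrakk>
      \<Longrightarrow> gmul Q (s x2) (mhat F1 p) = gmul Q (mhat F2 p) (s x1)"
  shows "\<theta> \<in> transformations F1 F2"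
proof -
  have "smooth_map (gX P) (pts (gX P)) (gP Q) (tsec \<theta>)"
    using smooth by (rule smooth_map_cong) (simp add: sec)
  moreover have "gmul Q (gmul Q (ginv Q (mhat F2 p)) (tsec \<theta> x2)) (mhat F1 p) = tsec \<theta> x1"
    if p: "p \<in> gfibre P x1 x2" for p x1 x2
  proof -
    note x = gfibre_base(1,2)[OF P p]
    show ?thesis
      using nat[OF p x] descent_iff_natural[OF Q mor_hat_in[OF F1 p] mor_hat_in[OF F2 p] s_in[OF x(1)] s_in[OF x(2)]] x
      by (simp add: sec)
  qed
  ultimately show ?thesis
    using F1 F2 dc s_in mor_dom[OF F1] mor_cod[OF F1] mor_dom[OF F2] mor_cod[OF F2]
    by (auto simp: transformations_def transformation_def Let_def sec gerbe_morphisms_def)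
qed

lemma transformation_eqI:
  assumes Q: "bundle_gerbe M Q" and F1: "F1 \<in> gerbe_morphisms P Q" and F2: "F2 \<in> gerbe_morphisms P Q"
    and \<theta>: "\<theta> \<in> transformations F1 F2" and \<eta>: "\<eta> \<in> transformations F1 F2"
    and eq: "\<And>x. x \<in> pts (gX P) \<Longrightarrow> tsec \<theta> x = tsec \<eta> x"
  shows "\<theta> = (\<eta> :: ('m, 'x, 'p) gtrans)"
proof (rule gtrans.equality)
  show "tsec \<theta> = tsec \<eta>"
    by (rule extensionalityI[OF trans_ext[OF \<theta> Q F1 F2] trans_ext[OF \<eta> Q F1 F2] eq])
qed (use trans_dom[OF \<theta> Q F1 F2] trans_dom[OF \<eta> Q F1 F2] trans_cod[OF \<theta> Q F1 F2] trans_cod[OF \<eta> Q F1 F2] in simp_all)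

lemma id_trans_sec: "\<lbrakk>F \<in> gerbe_morphisms P Q; x \<in> pts (gX P)\<rbrakk> \<Longrightarrow> tsec (id_trans F) x = gunit Q (mbase F x)"
  by (simp add: id_trans_def mor_dom mor_cod)

lemma id_trans_in:
  assumes P: "bundle_gerbe M P" and Q: "bundle_gerbe M Q" and F: "F \<in> gerbe_morphisms P Q"
  shows "id_trans F \<in> transformations F F"
proof (rule transformationsI[OF P Q F F])
  show "tsec (id_trans F) = restrict (\<lambda>x. gunit Q (mbase F x)) (pts (gX P))"
    by (simp add: id_trans_def mor_dom[OF F] mor_cod[OF F])
  show "smooth_map (gX P) (pts (gX P)) (gP Q) (\<lambda>x. gunit Q (mbase F x))"
    by (rule smooth_map_compose[OF gX_structure[OF P] gX_structure[OF Q] gP_structure[OF Q]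
          mor_base_smooth[OF F] smooth_map_gunit[OF Q] mor_base_in[OF F]])
  show "gunit Q (mbase F x) \<in> gfibre Q (mbase F x) (mbase F x)" if "x \<in> pts (gX P)" for x
    by (rule gunit_in[OF Q mor_base_in[OF F that]])
  show "gmul Q (gunit Q (mbase F x2)) (mhat F p) = gmul Q (mhat F p) (gunit Q (mbase F x1))"
    if "p \<in> gfibre P x1 x2" for p x1 x2
    using gunit_left[OF Q mor_hat_in[OF F that]] gunit_right[OF Q mor_hat_in[OF F that]] by simp
qed (simp_all add: id_trans_def)

context
  fixes M :: "'m mfd" and P Q :: "('m, 'x, 'p) gerbe" and F1 F2 F3 \<theta> \<theta>'
  assumes P: "bundle_gerbe M P" and Q: "bundle_gerbe M Q"
    and F1: "F1 \<in> gerbe_morphisms P Q" and F2: "F2 \<in> gerbe_morphisms P Q" and F3: "F3 \<in> gerbe_morphisms P Q"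
    and \<theta>: "\<theta> \<in> transformations F1 F2" and \<theta>': "\<theta>' \<in> transformations F2 F3"
begin

lemma vert_trans_sec: "x \<in> pts (gX P) \<Longrightarrow> tsec (vert_trans \<theta>' \<theta>) x = gmul Q (tsec \<theta>' x) (tsec \<theta> x)"
  by (simp add: vert_trans_def trans_dom[OF \<theta> Q F1 F2] mor_dom[OF F1] mor_cod[OF F1])

lemma vert_trans_in: "vert_trans \<theta>' \<theta> \<in> transformations F1 F3"
proof (rule transformationsI[OF P Q F1 F3])
  note in1 = trans_in[OF \<theta> Q F1 F2] and in2 = trans_in[OF \<theta>' Q F2 F3]
  show "tdom (vert_trans \<theta>' \<theta>) = F1" "tcod (vert_trans \<theta>' \<theta>) = F3"
    by (simp_all add: vert_trans_def trans_dom[OF \<theta> Q F1 F2] trans_cod[OF \<theta>' Q F2 F3])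
  show "tsec (vert_trans \<theta>' \<theta>) = restrict (\<lambda>x. gmul Q (tsec \<theta>' x) (tsec \<theta> x)) (pts (gX P))"
    by (simp add: vert_trans_def trans_dom[OF \<theta> Q F1 F2] mor_dom[OF F1] mor_cod[OF F1])
  show "smooth_map (gX P) (pts (gX P)) (gP Q) (\<lambda>x. gmul Q (tsec \<theta>' x) (tsec \<theta> x))"
    by (rule smooth_map_gmul_compose[OF Q gX_structure[OF P] trans_smooth[OF \<theta>' Q F2 F3] trans_smooth[OF \<theta> Q F1 F2]
          composableI[OF in2 in1]])
  show "gmul Q (tsec \<theta>' x) (tsec \<theta> x) \<in> gfibre Q (mbase F1 x) (mbase F3 x)" if "x \<in> pts (gX P)" for x
    by (rule gmul_in[OF Q in2[OF that] in1[OF that]])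
  show "gmul Q (gmul Q (tsec \<theta>' x2) (tsec \<theta> x2)) (mhat F1 p) = gmul Q (mhat F3 p) (gmul Q (tsec \<theta>' x1) (tsec \<theta> x1))"
    if p: "p \<in> gfibre P x1 x2" and x: "x1 \<in> pts (gX P)" "x2 \<in> pts (gX P)" for p x1 x2
  proof -
    note assoc = gmul_assoc[OF Q]
    note p1 = mor_hat_in[OF F1 p] and p2 = mor_hat_in[OF F2 p] and p3 = mor_hat_in[OF F3 p]
    have "gmul Q (gmul Q (tsec \<theta>' x2) (tsec \<theta> x2)) (mhat F1 p) = gmul Q (tsec \<theta>' x2) (gmul Q (mhat F2 p) (tsec \<theta> x1))"
      using assoc[OF in2[OF x(2)] in1[OF x(2)] p1] trans_natural[OF \<theta> Q F1 F2 p x] by simp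
    also have "\<dots> = gmul Q (gmul Q (mhat F3 p) (tsec \<theta>' x1)) (tsec \<theta> x1)"
      using assoc[OF in2[OF x(2)] p2 in1[OF x(1)]] trans_natural[OF \<theta>' Q F2 F3 p x] by simp
    also have "\<dots> = gmul Q (mhat F3 p) (gmul Q (tsec \<theta>' x1) (tsec \<theta> x1))"
      by (rule assoc[OF p3 in2[OF x(1)] in1[OF x(1)]])
    finally show ?thesis .
  qed
qed

end

context
  fixes M :: "'m mfd" and P Q R :: "('m, 'x, 'p) gerbe" and F1 F2 G1 G2 \<theta> \<rho>
  assumes P: "bundle_gerbe M P" and Q: "bundle_gerbe M Q" and R: "bundle_gerbe M R"
    and F1: "F1 \<in> gerbe_morphisms P Q" and F2: "F2 \<in> gerbe_morphisms P Q"
    and G1: "G1 \<in> gerbe_morphisms Q R" and G2: "G2 \<in> gerbe_morphisms Q R"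
    and \<theta>: "\<theta> \<in> transformations F1 F2" and \<rho>: "\<rho> \<in> transformations G1 G2"
begin

lemma horiz_trans_sec:
  "x \<in> pts (gX P) \<Longrightarrow> tsec (horiz_trans \<rho> \<theta>) x = gmul R (mhat G2 (tsec \<theta> x)) (tsec \<rho> (mbase F1 x))"
  by (simp add: horiz_trans_def trans_dom[OF \<theta> Q F1 F2] trans_dom[OF \<rho> R G1 G2] trans_cod[OF \<rho> R G1 G2]
      mor_dom[OF F1] mor_cod[OF G1])

text \<open>
  Naturality of the horizontal composite is obtained by pasting the square of \<open>\<rho>\<close> at the arrow
  \<open>F1 p\<close> and the image under \<open>G2\<close> of the square of \<open>\<theta>\<close> at \<open>p\<close>.
\<close>

lemma horiz_trans_in: "horiz_trans \<rho> \<theta> \<in> transformations (comp_morphism G1 F1) (comp_morphism G2 F2)"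
proof (rule transformationsI[OF P R comp_morphism_in[OF P Q R F1 G1] comp_morphism_in[OF P Q R F2 G2]])
  let ?s = "\<lambda>x. gmul R (mhat G2 (tsec \<theta> x)) (tsec \<rho> (mbase F1 x))"
  show "tdom (horiz_trans \<rho> \<theta>) = comp_morphism G1 F1" "tcod (horiz_trans \<rho> \<theta>) = comp_morphism G2 F2"
    by (simp_all add: horiz_trans_def trans_dom[OF \<theta> Q F1 F2] trans_dom[OF \<rho> R G1 G2]
        trans_cod[OF \<theta> Q F1 F2] trans_cod[OF \<rho> R G1 G2])
  show "tsec (horiz_trans \<rho> \<theta>) = restrict ?s (pts (gX P))"
    by (simp add: horiz_trans_def trans_dom[OF \<theta> Q F1 F2] trans_dom[OF \<rho> R G1 G2] trans_cod[OF \<rho> R G1 G2]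
      mor_dom[OF F1] mor_cod[OF G1])
  have in1: "mhat G2 (tsec \<theta> x) \<in> gfibre R (mbase G2 (mbase F1 x)) (mbase G2 (mbase F2 x))"
    if "x \<in> pts (gX P)" for x
    by (rule mor_hat_in[OF G2 trans_in[OF \<theta> Q F1 F2 that]])
  have in2: "tsec \<rho> (mbase F1 x) \<in> gfibre R (mbase G1 (mbase F1 x)) (mbase G2 (mbase F1 x))"
    if "x \<in> pts (gX P)" for x
    by (rule trans_in[OF \<rho> R G1 G2 mor_base_in[OF F1 that]])
  have "smooth_map (gX P) (pts (gX P)) (gP R) (\<lambda>x. mhat G2 (tsec \<theta> x))"
    by (rule smooth_map_compose[OF gX_structure[OF P] gP_structure[OF Q] gP_structure[OF R]
          trans_smooth[OF \<theta> Q F1 F2] mor_hat_smooth[OF G2] smooth_map_image[OF trans_smooth[OF \<theta> Q F1 F2]]])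
  moreover have "smooth_map (gX P) (pts (gX P)) (gP R) (\<lambda>x. tsec \<rho> (mbase F1 x))"
    by (rule smooth_map_compose[OF gX_structure[OF P] gX_structure[OF Q] gP_structure[OF R]
          mor_base_smooth[OF F1] trans_smooth[OF \<rho> R G1 G2] mor_base_in[OF F1]])
  ultimately show "smooth_map (gX P) (pts (gX P)) (gP R) ?s"
    by (rule smooth_map_gmul_compose[OF R gX_structure[OF P] _ _ composableI[OF in1 in2]])
  show "?s x \<in> gfibre R (mbase (comp_morphism G1 F1) x) (mbase (comp_morphism G2 F2) x)" if "x \<in> pts (gX P)" for x
    using gmul_in[OF R in1[OF that] in2[OF that]] that
    by (simp add: comp_morphism_base mor_dom[OF F1] mor_dom[OF F2])
  show "gmul R (?s x2) (mhat (comp_morphism G1 F1) p) = gmul R (mhat (comp_morphism G2 F2) p) (?s x1)"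
    if p: "p \<in> gfibre P x1 x2" and x: "x1 \<in> pts (gX P)" "x2 \<in> pts (gX P)" for p x1 x2
  proof -
    note assoc = gmul_assoc[OF R]
    note p1 = mor_hat_in[OF F1 p] and p2 = mor_hat_in[OF F2 p]
    note \<theta>in = trans_in[OF \<theta> Q F1 F2]
    have "gmul R (?s x2) (mhat G1 (mhat F1 p)) =
        gmul R (mhat G2 (tsec \<theta> x2)) (gmul R (mhat G2 (mhat F1 p)) (tsec \<rho> (mbase F1 x1)))"
      using assoc[OF in1[OF x(2)] in2[OF x(2)] mor_hat_in[OF G1 p1]]
        trans_natural[OF \<rho> R G1 G2 p1 mor_base_in[OF F1 x(1)] mor_base_in[OF F1 x(2)]] by simp
    also have "\<dots> = gmul R (gmul R (mhat G2 (tsec \<theta> x2)) (mhat G2 (mhat F1 p))) (tsec \<rho> (mbase F1 x1))"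
      by (rule assoc[OF in1[OF x(2)] mor_hat_in[OF G2 p1] in2[OF x(1)], symmetric])
    also have "gmul R (mhat G2 (tsec \<theta> x2)) (mhat G2 (mhat F1 p)) = gmul R (mhat G2 (mhat F2 p)) (mhat G2 (tsec \<theta> x1))"
      using mor_hat_mul[OF G2 \<theta>in[OF x(2)] p1] mor_hat_mul[OF G2 p2 \<theta>in[OF x(1)]]
        trans_natural[OF \<theta> Q F1 F2 p x] by simp
    also have "gmul R (gmul R (mhat G2 (mhat F2 p)) (mhat G2 (tsec \<theta> x1))) (tsec \<rho> (mbase F1 x1)) =
        gmul R (mhat G2 (mhat F2 p)) (?s x1)"
      by (rule assoc[OF mor_hat_in[OF G2 p2] in1[OF x(1)] in2[OF x(1)]])
    finally show ?thesis
      using gfibre_pts[OF p] by (simp add: comp_morphism_hat mor_dom[OF F1] mor_dom[OF F2])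
  qed
qed

end

text \<open>
  The laws hold at each point \<open>x\<close>, because the arrows of \<open>Q\<close> form a category.
\<close>

lemma gerbe_hom_category:
  assumes P: "bundle_gerbe M P" and Q: "bundle_gerbe M Q"
  shows "category (gerbe_morphisms P Q) transformations id_trans vert_trans"
proof
  fix F G H K \<alpha> \<beta> \<gamma>
  assume F: "F \<in> gerbe_morphisms P Q"
  note idF = id_trans_in[OF P Q F]
  show "id_trans F \<in> transformations F F" by (rule idF)
  assume G: "G \<in> gerbe_morphisms P Q" and \<alpha>: "\<alpha> \<in> transformations F G"
  note \<alpha>in = trans_in[OF \<alpha> Q F G]
  note idG = id_trans_in[OF P Q G]
  show "vert_trans (id_trans G) \<alpha> = \<alpha>"
    by (rule transformation_eqI[OF Q F G vert_trans_in[OF P Q F G G \<alpha> idG] \<alpha>])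
       (simp add: vert_trans_sec[OF P Q F G G \<alpha> idG] id_trans_sec[OF G] gunit_left[OF Q \<alpha>in])
  show "vert_trans \<alpha> (id_trans F) = \<alpha>"
    by (rule transformation_eqI[OF Q F G vert_trans_in[OF P Q F F G idF \<alpha>] \<alpha>])
       (simp add: vert_trans_sec[OF P Q F F G idF \<alpha>] id_trans_sec[OF F] gunit_right[OF Q \<alpha>in])
  assume H: "H \<in> gerbe_morphisms P Q" and \<beta>: "\<beta> \<in> transformations G H"
  note \<beta>\<alpha> = vert_trans_in[OF P Q F G H \<alpha> \<beta>]
  show "vert_trans \<beta> \<alpha> \<in> transformations F H" by (rule \<beta>\<alpha>)
  assume K: "K \<in> gerbe_morphisms P Q" and \<gamma>: "\<gamma> \<in> transformations H K"
  note \<gamma>\<beta> = vert_trans_in[OF P Q G H K \<beta> \<gamma>]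
  show "vert_trans (vert_trans \<gamma> \<beta>) \<alpha> = vert_trans \<gamma> (vert_trans \<beta> \<alpha>)"
    by (rule transformation_eqI[OF Q F K vert_trans_in[OF P Q F G K \<alpha> \<gamma>\<beta>] vert_trans_in[OF P Q F H K \<beta>\<alpha> \<gamma>]])
       (simp add: vert_trans_sec[OF P Q F G K \<alpha> \<gamma>\<beta>] vert_trans_sec[OF P Q F H K \<beta>\<alpha> \<gamma>]
         vert_trans_sec[OF P Q F G H \<alpha> \<beta>] vert_trans_sec[OF P Q G H K \<beta> \<gamma>]
         gmul_assoc[OF Q trans_in[OF \<gamma> Q H K] trans_in[OF \<beta> Q G H] \<alpha>in])
qed

lemma horiz_id_trans:
  assumes P: "bundle_gerbe M P" and Q: "bundle_gerbe M Q" and R: "bundle_gerbe M R"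
    and F: "F \<in> gerbe_morphisms P Q" and G: "G \<in> gerbe_morphisms Q R"
  shows "horiz_trans (id_trans G) (id_trans F) = id_trans (comp_morphism G F)"
proof -
  note GF = comp_morphism_in[OF P Q R F G]
  note i = id_trans_in[OF P Q F] id_trans_in[OF Q R G] id_trans_in[OF P R GF]
  show ?thesis
  proof (rule transformation_eqI[OF R GF GF horiz_trans_in[OF P Q R F F G G i(1,2)] i(3)])
    fix x assume x: "x \<in> pts (gX P)"
    note fx = mor_base_in[OF F x]
    show "tsec (horiz_trans (id_trans G) (id_trans F)) x = tsec (id_trans (comp_morphism G F)) x"
      using x fx gunit_idem[OF R mor_base_in[OF G fx]]
      by (simp add: horiz_trans_sec[OF P Q R F F G G i(1,2)] id_trans_sec[OF F] id_trans_sec[OF G]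
          id_trans_sec[OF GF] mor_hat_unit[OF Q R G] comp_morphism_base mor_dom[OF F])
  qed
qed

text \<open>
  The two sides differ by the order in which \<open>\<alpha>\<close> and \<open>\<beta>'\<close> are applied, and the naturality square of
  \<open>\<beta>'\<close> at the arrow \<open>\<alpha> x\<close> exchanges them.
\<close>

lemma interchange_trans:
  assumes P: "bundle_gerbe M P" and Q: "bundle_gerbe M Q" and R: "bundle_gerbe M R"
    and F: "F1 \<in> gerbe_morphisms P Q" "F2 \<in> gerbe_morphisms P Q" "F3 \<in> gerbe_morphisms P Q"
    and G: "G1 \<in> gerbe_morphisms Q R" "G2 \<in> gerbe_morphisms Q R" "G3 \<in> gerbe_morphisms Q R"
    and \<alpha>: "\<alpha> \<in> transformations F1 F2" and \<alpha>': "\<alpha>' \<in> transformations F2 F3"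
    and \<beta>: "\<beta> \<in> transformations G1 G2" and \<beta>': "\<beta>' \<in> transformations G2 G3"
  shows "horiz_trans (vert_trans \<beta>' \<beta>) (vert_trans \<alpha>' \<alpha>) = vert_trans (horiz_trans \<beta>' \<alpha>') (horiz_trans \<beta> \<alpha>)"
proof -
  note GF1 = comp_morphism_in[OF P Q R F(1) G(1)]
  note GF2 = comp_morphism_in[OF P Q R F(2) G(2)]
  note GF3 = comp_morphism_in[OF P Q R F(3) G(3)]
  note \<alpha>\<alpha> = vert_trans_in[OF P Q F \<alpha> \<alpha>'] and \<beta>\<beta> = vert_trans_in[OF Q R G \<beta> \<beta>']
  note \<beta>\<alpha> = horiz_trans_in[OF P Q R F(1,2) G(1,2) \<alpha> \<beta>]
  note \<beta>\<alpha>' = horiz_trans_in[OF P Q R F(2,3) G(2,3) \<alpha>' \<beta>']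
  show ?thesis
  proof (rule transformation_eqI[OF R GF1 GF3 horiz_trans_in[OF P Q R F(1,3) G(1,3) \<alpha>\<alpha> \<beta>\<beta>]
        vert_trans_in[OF P R GF1 GF2 GF3 \<beta>\<alpha> \<beta>\<alpha>']])
    fix x assume x: "x \<in> pts (gX P)"
    note f1 = mor_base_in[OF F(1) x] and f2 = mor_base_in[OF F(2) x]
    note a = trans_in[OF \<alpha> Q F(1,2) x] and a' = trans_in[OF \<alpha>' Q F(2,3) x]
    note b = trans_in[OF \<beta> R G(1,2) f1] and b' = trans_in[OF \<beta>' R G(2,3) f1] and c' = trans_in[OF \<beta>' R G(2,3) f2]
    note assoc = gmul_assoc[OF R]
    let ?A = "mhat G3 (tsec \<alpha> x)" and ?A' = "mhat G3 (tsec \<alpha>' x)" and ?a = "mhat G2 (tsec \<alpha> x)"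
      and ?b = "tsec \<beta> (mbase F1 x)" and ?b' = "tsec \<beta>' (mbase F1 x)" and ?c' = "tsec \<beta>' (mbase F2 x)"
    note A = mor_hat_in[OF G(3) a] and A' = mor_hat_in[OF G(3) a'] and a2 = mor_hat_in[OF G(2) a]
    have "tsec (horiz_trans (vert_trans \<beta>' \<beta>) (vert_trans \<alpha>' \<alpha>)) x = gmul R (gmul R ?A' ?A) (gmul R ?b' ?b)"
      using x f1 by (simp add: horiz_trans_sec[OF P Q R F(1,3) G(1,3) \<alpha>\<alpha> \<beta>\<beta>] vert_trans_sec[OF P Q F \<alpha> \<alpha>']
          vert_trans_sec[OF Q R G \<beta> \<beta>'] mor_hat_mul[OF G(3) a' a])
    also have "\<dots> = gmul R ?A' (gmul R (gmul R ?A ?b') ?b)"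
      using assoc[OF A' A gmul_in[OF R b' b]] assoc[OF A b' b] by simp
    also have "gmul R ?A ?b' = gmul R ?c' ?a"
      using trans_natural[OF \<beta>' R G(2,3) a f1 f2] by simp
    also have "gmul R ?A' (gmul R (gmul R ?c' ?a) ?b) = gmul R (gmul R ?A' ?c') (gmul R ?a ?b)"
      using assoc[OF c' a2 b] assoc[OF A' c' gmul_in[OF R a2 b]] by simp
    also have "\<dots> = tsec (vert_trans (horiz_trans \<beta>' \<alpha>') (horiz_trans \<beta> \<alpha>)) x"
      using x by (simp add: vert_trans_sec[OF P R GF1 GF2 GF3 \<beta>\<alpha> \<beta>\<alpha>']
          horiz_trans_sec[OF P Q R F(1,2) G(1,2) \<alpha> \<beta>] horiz_trans_sec[OF P Q R F(2,3) G(2,3) \<alpha>' \<beta>'])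
    finally show "tsec (horiz_trans (vert_trans \<beta>' \<beta>) (vert_trans \<alpha>' \<alpha>)) x =
        tsec (vert_trans (horiz_trans \<beta>' \<alpha>') (horiz_trans \<beta> \<alpha>)) x" .
  qed
qed

text \<open>
  At each point both sides are the product of the same three arrows, since \<open>H2\<close> preserves products.
\<close>

lemma horiz_trans_assoc:
  assumes P: "bundle_gerbe M P" and Q: "bundle_gerbe M Q" and R: "bundle_gerbe M R" and S: "bundle_gerbe M S"
    and F: "F1 \<in> gerbe_morphisms P Q" "F2 \<in> gerbe_morphisms P Q"
    and G: "G1 \<in> gerbe_morphisms Q R" "G2 \<in> gerbe_morphisms Q R"
    and H: "H1 \<in> gerbe_morphisms R S" "H2 \<in> gerbe_morphisms R S"
    and \<alpha>: "\<alpha> \<in> transformations F1 F2" and \<beta>: "\<beta> \<in> transformations G1 G2" and \<gamma>: "\<gamma> \<in> transformations H1 H2"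
  shows "horiz_trans (horiz_trans \<gamma> \<beta>) \<alpha> = horiz_trans \<gamma> (horiz_trans \<beta> \<alpha>)"
proof -
  note GF1 = comp_morphism_in[OF P Q R F(1) G(1)] and GF2 = comp_morphism_in[OF P Q R F(2) G(2)]
  note HG1 = comp_morphism_in[OF Q R S G(1) H(1)] and HG2 = comp_morphism_in[OF Q R S G(2) H(2)]
  note HGF1 = comp_morphism_in[OF P Q S F(1) HG1] and HGF2 = comp_morphism_in[OF P Q S F(2) HG2]
  note \<beta>\<alpha> = horiz_trans_in[OF P Q R F G \<alpha> \<beta>] and \<gamma>\<beta> = horiz_trans_in[OF Q R S G H \<beta> \<gamma>]
  have r: "horiz_trans \<gamma> (horiz_trans \<beta> \<alpha>) \<in>
      transformations (comp_morphism (comp_morphism H1 G1) F1) (comp_morphism (comp_morphism H2 G2) F2)"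
    using horiz_trans_in[OF P R S GF1 GF2 H \<beta>\<alpha> \<gamma>]
    by (simp add: comp_morphism_assoc[OF F(1) G(1) H(1)] comp_morphism_assoc[OF F(2) G(2) H(2)])
  show ?thesis
  proof (rule transformation_eqI[OF S HGF1 HGF2 horiz_trans_in[OF P Q S F HG1 HG2 \<alpha> \<gamma>\<beta>] r])
    fix x assume x: "x \<in> pts (gX P)"
    note f1 = mor_base_in[OF F(1) x]
    note a = trans_in[OF \<alpha> Q F x] and b = trans_in[OF \<beta> R G f1]
      and c = trans_in[OF \<gamma> S H mor_base_in[OF G(1) f1]]
    note a2 = mor_hat_in[OF G(2) a]
    have "tsec (horiz_trans (horiz_trans \<gamma> \<beta>) \<alpha>) x =
        gmul S (mhat H2 (mhat G2 (tsec \<alpha> x))) (gmul S (mhat H2 (tsec \<beta> (mbase F1 x))) (tsec \<gamma> (mbase G1 (mbase F1 x))))"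
      using x f1 gfibre_pts[OF a]
      by (simp add: horiz_trans_sec[OF P Q S F HG1 HG2 \<alpha> \<gamma>\<beta>] horiz_trans_sec[OF Q R S G H \<beta> \<gamma>]
          comp_morphism_hat mor_dom[OF G(2)])
    also have "\<dots> = gmul S (mhat H2 (gmul R (mhat G2 (tsec \<alpha> x)) (tsec \<beta> (mbase F1 x)))) (tsec \<gamma> (mbase G1 (mbase F1 x)))"
      using gmul_assoc[OF S mor_hat_in[OF H(2) a2] mor_hat_in[OF H(2) b] c] mor_hat_mul[OF H(2) a2 b] by simp
    also have "\<dots> = tsec (horiz_trans \<gamma> (horiz_trans \<beta> \<alpha>)) x"
      using x by (simp add: horiz_trans_sec[OF P R S GF1 GF2 H \<beta>\<alpha> \<gamma>] horiz_trans_sec[OF P Q R F G \<alpha> \<beta>]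
          comp_morphism_base mor_dom[OF F(1)])
    finally show "tsec (horiz_trans (horiz_trans \<gamma> \<beta>) \<alpha>) x = tsec (horiz_trans \<gamma> (horiz_trans \<beta> \<alpha>)) x" .
  qed
qed

text \<open>
  On one side the second factor is a unit of \<open>Q\<close>; on the other side the first factor is the image of
  a unit under \<open>F2\<close>, hence a unit.
\<close>

lemma horiz_trans_id:
  assumes P: "bundle_gerbe M P" and Q: "bundle_gerbe M Q"
    and F1: "F1 \<in> gerbe_morphisms P Q" and F2: "F2 \<in> gerbe_morphisms P Q" and \<alpha>: "\<alpha> \<in> transformations F1 F2"
  shows "horiz_trans (id_trans (id_morphism Q)) \<alpha> = \<alpha>" "horiz_trans \<alpha> (id_trans (id_morphism P)) = \<alpha>"
proof -
  note iP = id_morphism_in[OF P] and iQ = id_morphism_in[OF Q]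
  note iiP = id_trans_in[OF P P iP] and iiQ = id_trans_in[OF Q Q iQ]
  show "horiz_trans (id_trans (id_morphism Q)) \<alpha> = \<alpha>"
  proof (rule transformation_eqI[OF Q F1 F2 _ \<alpha>])
    show "horiz_trans (id_trans (id_morphism Q)) \<alpha> \<in> transformations F1 F2"
      using horiz_trans_in[OF P Q Q F1 F2 iQ iQ \<alpha> iiQ] by (simp add: comp_id_morphism[OF F1] comp_id_morphism[OF F2])
    fix x assume x: "x \<in> pts (gX P)"
    note a = trans_in[OF \<alpha> Q F1 F2 x] and f1 = mor_base_in[OF F1 x]
    have id: "mhat (id_morphism Q) (tsec \<alpha> x) = tsec \<alpha> x" "mbase (id_morphism Q) (mbase F1 x) = mbase F1 x"
      using f1 gfibre_pts[OF a] by (simp_all add: id_morphism_def)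
    show "tsec (horiz_trans (id_trans (id_morphism Q)) \<alpha>) x = tsec \<alpha> x"
      using x f1 gunit_right[OF Q a]
      by (simp add: horiz_trans_sec[OF P Q Q F1 F2 iQ iQ \<alpha> iiQ] id_trans_sec[OF iQ] id)
  qed
  show "horiz_trans \<alpha> (id_trans (id_morphism P)) = \<alpha>"
  proof (rule transformation_eqI[OF Q F1 F2 _ \<alpha>])
    show "horiz_trans \<alpha> (id_trans (id_morphism P)) \<in> transformations F1 F2"
      using horiz_trans_in[OF P P Q iP iP F1 F2 iiP \<alpha>] by (simp add: comp_id_morphism[OF F1] comp_id_morphism[OF F2])
    fix x assume x: "x \<in> pts (gX P)"
    note a = trans_in[OF \<alpha> Q F1 F2 x]
    have base: "mbase (id_morphism P) x = x" using x by (simp add: id_morphism_def)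
    show "tsec (horiz_trans \<alpha> (id_trans (id_morphism P))) x = tsec \<alpha> x"
      using x gunit_left[OF Q a]
      by (simp add: horiz_trans_sec[OF P P Q iP iP F1 F2 iiP \<alpha>] id_trans_sec[OF iP] base mor_hat_unit[OF P Q F2])
  qed
qed

section \<open>The 2-category\<close>

text \<open>
  If composition is strictly associative and unital on 1-arrows and on 2-arrows, then identities
  satisfy all conditions on the constraints of a bicategory: each of them then equates two composites
  that reduce to the same identity or to the same 2-arrow.
\<close>

lemma two_category_strictI:
  fixes Obj :: "'o set" and Arr :: "'o \<Rightarrow> 'o \<Rightarrow> 'a set" and Cell :: "'a \<Rightarrow> 'a \<Rightarrow> 'c set"
  assumes hom: "\<And>a b. \<lbrakk>a \<in> Obj; b \<in> Obj\<rbrakk> \<Longrightarrow> category (Arr a b) Cell id2 vert"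
    and id1_in: "\<And>a. a \<in> Obj \<Longrightarrow> id1 a \<in> Arr a a"
    and comp1_in: "\<And>a b c f g. \<lbrakk>a \<in> Obj; b \<in> Obj; c \<in> Obj; f \<in> Arr a b; g \<in> Arr b c\<rbrakk> \<Longrightarrow> comp1 g f \<in> Arr a c"
    and horiz_in: "\<And>a b c f f' g g' \<alpha> \<beta>. \<lbrakk>a \<in> Obj; b \<in> Obj; c \<in> Obj; f \<in> Arr a b; f' \<in> Arr a b;
        g \<in> Arr b c; g' \<in> Arr b c; \<alpha> \<in> Cell f f'; \<beta> \<in> Cell g g'\<rbrakk>
        \<Longrightarrow> horiz \<beta> \<alpha> \<in> Cell (comp1 g f) (comp1 g' f')"
    and horiz_id2: "\<And>a b c f g. \<lbrakk>a \<in> Obj; b \<in> Obj; c \<in> Obj; f \<in> Arr a b; g \<in> Arr b c\<rbrakk>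
        \<Longrightarrow> horiz (id2 g) (id2 f) = id2 (comp1 g f)"
    and interchange: "\<And>a b c f f' f'' g g' g'' \<alpha> \<alpha>' \<beta> \<beta>'. \<lbrakk>a \<in> Obj; b \<in> Obj; c \<in> Obj;
        f \<in> Arr a b; f' \<in> Arr a b; f'' \<in> Arr a b; g \<in> Arr b c; g' \<in> Arr b c; g'' \<in> Arr b c;
        \<alpha> \<in> Cell f f'; \<alpha>' \<in> Cell f' f''; \<beta> \<in> Cell g g'; \<beta>' \<in> Cell g' g''\<rbrakk>
        \<Longrightarrow> horiz (vert \<beta>' \<beta>) (vert \<alpha>' \<alpha>) = vert (horiz \<beta>' \<alpha>') (horiz \<beta> \<alpha>)"
    and assoc1: "\<And>a b c d f g h. \<lbrakk>a \<in> Obj; b \<in> Obj; c \<in> Obj; d \<in> Obj; f \<in> Arr a b; g \<in> Arr b c; h \<in> Arr c d\<rbrakk>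
        \<Longrightarrow> comp1 (comp1 h g) f = comp1 h (comp1 g f)"
    and assoc2: "\<And>a b c d f f' g g' h h' \<alpha> \<beta> \<gamma>. \<lbrakk>a \<in> Obj; b \<in> Obj; c \<in> Obj; d \<in> Obj; f \<in> Arr a b; f' \<in> Arr a b;
        g \<in> Arr b c; g' \<in> Arr b c; h \<in> Arr c d; h' \<in> Arr c d;
        \<alpha> \<in> Cell f f'; \<beta> \<in> Cell g g'; \<gamma> \<in> Cell h h'\<rbrakk>
        \<Longrightarrow> horiz (horiz \<gamma> \<beta>) \<alpha> = horiz \<gamma> (horiz \<beta> \<alpha>)"
    and unit1: "\<And>a b f. \<lbrakk>a \<in> Obj; b \<in> Obj; f \<in> Arr a b\<rbrakk> \<Longrightarrow> comp1 (id1 b) f = f"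
      "\<And>a b f. \<lbrakk>a \<in> Obj; b \<in> Obj; f \<in> Arr a b\<rbrakk> \<Longrightarrow> comp1 f (id1 a) = f"
    and unit2: "\<And>a b f f' \<alpha>. \<lbrakk>a \<in> Obj; b \<in> Obj; f \<in> Arr a b; f' \<in> Arr a b; \<alpha> \<in> Cell f f'\<rbrakk>
        \<Longrightarrow> horiz (id2 (id1 b)) \<alpha> = \<alpha>"
      "\<And>a b f f' \<alpha>. \<lbrakk>a \<in> Obj; b \<in> Obj; f \<in> Arr a b; f' \<in> Arr a b; \<alpha> \<in> Cell f f'\<rbrakk>
        \<Longrightarrow> horiz \<alpha> (id2 (id1 a)) = \<alpha>"
  shows "two_category Obj Arr Cell id2 vert id1 comp1 horiz (\<lambda>h g f. id2 (comp1 (comp1 h g) f)) id2 id2"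
proof -
  have id2_in: "id2 f \<in> Cell f f" if "a \<in> Obj" "b \<in> Obj" "f \<in> Arr a b" for a b f
    using category.idn_in[OF hom[OF that(1,2)] that(3)] .
  have idl: "vert (id2 g) \<alpha> = \<alpha>" and idr: "vert \<alpha> (id2 f) = \<alpha>"
    if "a \<in> Obj" "b \<in> Obj" "f \<in> Arr a b" "g \<in> Arr a b" "\<alpha> \<in> Cell f g" for a b f g \<alpha>
    using category.cmp_idn_left[OF hom[OF that(1,2)] that(3-5)]
      category.cmp_idn_right[OF hom[OF that(1,2)] that(3-5)] by auto
  have id2_id2: "vert (id2 f) (id2 f) = id2 f" if "a \<in> Obj" "b \<in> Obj" "f \<in> Arr a b" for a b f
    by (rule idl[OF that that(3) id2_in[OF that]])
  have iso: "id2 f \<in> isos Cell id2 vert f f" if "a \<in> Obj" "b \<in> Obj" "f \<in> Arr a b" for a b f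
    using id2_in[OF that] id2_id2[OF that] by (auto simp: isos_def)
  show ?thesis
  proof (intro two_category.intro bicategory.intro two_category_axioms.intro, goal_cases)
    case (1 a b) then show ?case by (rule hom)
  next
    case (2 a) then show ?case by (rule id1_in)
  next
    case (3 a b c f g) then show ?case by (rule comp1_in)
  next
    case (4 a b c f f' g g' \<alpha> \<beta>) then show ?case by (rule horiz_in)
  next
    case (5 a b c f g) then show ?case by (rule horiz_id2)
  next
    case (6 a b c f f' f'' g g' g'' \<alpha> \<alpha>' \<beta> \<beta>') then show ?case by (rule interchange)
  next
    case (7 a b c d f g h)
    have "comp1 h (comp1 g f) \<in> Arr a d"
      using 7 comp1_in[of a b c f g] by (intro comp1_in[of a c d]) auto
    then show ?case using iso 7(1,4) assoc1[OF 7] by simp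
  next
    case (8 a b c d f f' g g' h h' \<alpha> \<beta> \<gamma>)
    have k: "comp1 h (comp1 g f) \<in> Arr a d" "comp1 h' (comp1 g' f') \<in> Arr a d"
      using 8 by (auto intro!: comp1_in[of a c d] comp1_in[of a b c])
    have "horiz \<gamma> (horiz \<beta> \<alpha>) \<in> Cell (comp1 h (comp1 g f)) (comp1 h' (comp1 g' f'))"
      using 8 by (intro horiz_in[of a c d] horiz_in[of a b c] comp1_in[of a b c]) auto
    then show ?case
      using assoc2[OF 8] assoc1[OF 8(1-4,5,7,9)] assoc1[OF 8(1-4,6,8,10)] idl[OF 8(1,4) k] idr[OF 8(1,4) k]
      by simp
  next
    case (9 a b f) then show ?case using iso unit1(1) by simp
  next
    case (10 a b f f' \<alpha>) then show ?case using unit2(1)[OF 10] idl[OF 10] idr[OF 10] by simp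
  next
    case (11 a b f) then show ?case using iso unit1(2) by simp
  next
    case (12 a b f f' \<alpha>) then show ?case using unit2(2)[OF 12] idl[OF 12] idr[OF 12] by simp
  next
    case (13 a b c d e f g h k)
    note ob = 13(1-5) and ar = 13(6-9)
    have gf: "comp1 g f \<in> Arr a c" and hg: "comp1 h g \<in> Arr b d" and kh: "comp1 k h \<in> Arr c e"
      using ob ar comp1_in by blast+
    have hgf: "comp1 h (comp1 g f) \<in> Arr a d" and khg: "comp1 k (comp1 h g) \<in> Arr b e"
      using ob ar gf hg comp1_in by blast+
    have all: "comp1 k (comp1 h (comp1 g f)) \<in> Arr a e"
      using ob ar hgf comp1_in by blast
    have eq: "comp1 (comp1 h g) f = comp1 h (comp1 g f)" "comp1 (comp1 k h) g = comp1 k (comp1 h g)"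
      "comp1 (comp1 k (comp1 h g)) f = comp1 k (comp1 h (comp1 g f))"
      "comp1 (comp1 k h) (comp1 g f) = comp1 k (comp1 h (comp1 g f))"
      using assoc1[OF ob(1-4) ar(1-3)] assoc1[OF ob(2-5) ar(2-4)] assoc1[OF ob(1,2,4,5) ar(1) hg ar(4)]
        assoc1[OF ob(1,3-5) gf ar(3,4)] by simp_all
    show ?case
      using horiz_id2[OF ob(1,4,5) hgf ar(4)] horiz_id2[OF ob(1,2,5) ar(1) khg] id2_id2[OF ob(1,5) all]
      by (simp add: eq)
  next
    case (14 a b c f g)
    then show ?case
      using id2_id2[OF 14(1,3) comp1_in[OF 14]] horiz_id2[OF 14] unit1 by simp
  next
    case (15 a b c d f g h) then show ?case by (rule assoc1)
  next
    case (16 a b c d f g h) then show ?case by simp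
  next
    case (17 a b c d f f' g g' h h' \<alpha> \<beta> \<gamma>) then show ?case by (rule assoc2)
  next
    case (18 a b f) then show ?case by (rule unit1)
  next
    case (19 a b f) then show ?case by (rule unit1)
  next
    case 20 then show ?case by simp
  next
    case 21 then show ?case by simp
  qed
qed

theorem proposition3p8:
  fixes M :: "'m mfd"
  assumes "smooth_manifold M"
  shows "two_category
           {P :: ('m, 'x, 'p) gerbe. bundle_gerbe M P}
           gerbe_morphisms
           transformations
           id_trans
           vert_trans
           id_morphism
           comp_morphism
           horiz_trans
           (\<lambda>H G F. id_trans (comp_morphism (comp_morphism H G) F))
           (\<lambda>F. id_trans F)
           (\<lambda>F. id_trans F)"
proof (rule two_category_strictI; (unfold mem_Collect_eq)?)
  fix P Q R S :: "('m, 'x, 'p) gerbe"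
  fix F F' F'' G G' G'' H H' \<alpha> \<alpha>' \<beta> \<beta>' \<gamma>
  assume P: "bundle_gerbe M P"
  show "id_morphism P \<in> gerbe_morphisms P P" by (rule id_morphism_in[OF P])
  assume Q: "bundle_gerbe M Q"
  show "category (gerbe_morphisms P Q) transformations id_trans vert_trans"
    by (rule gerbe_hom_category[OF P Q])
  assume F: "F \<in> gerbe_morphisms P Q"
  show "comp_morphism (id_morphism Q) F = F" "comp_morphism F (id_morphism P) = F"
    by (rule comp_id_morphism[OF F])+
qed (rule comp_morphism_in horiz_trans_in horiz_id_trans interchange_trans comp_morphism_assoc
    horiz_trans_assoc horiz_trans_id; assumption)+

end
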